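(* Let $(H,\alpha)$ be a monoidal Hom-Hopf algebra over a commutative ring $k$ and $(A,\beta)$ a right $(H,\alpha)$-Hom-comodule algebra. Consider the two types of relative Hom-Hopf module structure on $A\otimes H$: $G(A)$, given by $$(a\otimes h)\cdot b=ab_{[0]}\otimes hb_{[1]},\qquad \rho_{A\otimes H}(a\otimes h)=(\beta^{-1}(a)\otimes h_{(1)})\otimes\alpha(h_{(2)}),$$ and $\widetilde G(H)$, given by $$(a\otimes h)\cdot b=a\beta(b)\otimes\alpha^{-1}(h),\qquad \rho_{A\otimes H}(a\otimes h)=(a_{[0]}\otimes h_{(1)})\otimes a_{[1]}h_{(2)},$$ for $a,b\in A$, $h\in H$. Then $G(A)\cong\widetilde G(H)$ in $\widetilde{\mathscr{H}}(\mathscr{M}_k)^{H}_{A}$.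
   Context: Conventions. $k$ is a commutative ring, $\otimes=\otimes_k$. $\widetilde{\mathscr{H}}(\mathscr{M}_k)$ is the category with objects pairs $(M,\mu)$, $M$ a $k$-module and $\mu$ a $k$-linear automorphism of $M$; a morphism $f:(M,\mu)\to(N,\nu)$ is a $k$-linear map with $\nu f=f\mu$; $(M,\mu)\otimes(N,\nu)=(M\otimes N,\mu\otimes\nu)$. Monoidal Hom-algebra $(A,\alpha)$: an object of $\widetilde{\mathscr{H}}(\mathscr{M}_k)$ with a $k$-linear multiplication and $1_A\in A$ such that $\alpha(ab)=\alpha(a)\alpha(b)$, $\alpha(1_A)=1_A$, $\alpha(a)(bc)=(ab)\alpha(c)$, $a1_A=1_Aa=\alpha(a)$. Monoidal Hom-coalgebra $(C,\gamma)$: an object of $\widetilde{\mathscr{H}}(\mathscr{M}_k)$ with $k$-linear maps $\Delta:C\to C\otimes C$, $\Delta(c)=c_{(1)}\otimes c_{(2)}$, and $\varepsilon:C\to k$ such that $\Delta(\gamma(c))=\gamma(c_{(1)})\otimes\gamma(c_{(2)})$, $\varepsilon\gamma=\varepsilon$, $\gamma^{-1}(c_{(1)})\otimes c_{(2)(1)}\otimes c_{(2)(2)}=c_{(1)(1)}\otimes c_{(1)(2)}\otimes\gamma^{-1}(c_{(2)})$, $\varepsilon(c_{(1)})c_{(2)}=\varepsilon(c_{(2)})c_{(1)}=\gamma^{-1}(c)$. Monoidal Hom-Hopf algebra $(H,\alpha)$: $(H,\alpha)$ is both a monoidal Hom-algebra and a monoidal Hom-coalgebra, $\Delta(ab)=a_{(1)}b_{(1)}\otimes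 a_{(2)}b_{(2)}$, $\Delta(1_H)=1_H\otimes1_H$, $\varepsilon(ab)=\varepsilon(a)\varepsilon(b)$, $\varepsilon(1_H)=1$, and there is a $k$-linear $S:H\to H$ with $S\alpha=\alpha S$ and $S(h_{(1)})h_{(2)}=h_{(1)}S(h_{(2)})=\varepsilon(h)1_H$. Right $(A,\beta)$-Hom-module $(M,\mu)$: an object of $\widetilde{\mathscr{H}}(\mathscr{M}_k)$ with $k$-linear action $M\otimes A\to M$ such that $\mu(m\cdot a)=\mu(m)\cdot\beta(a)$, $(m\cdot a)\cdot\beta(b)=\mu(m)\cdot(ab)$, $m\cdot1_A=\mu(m)$. Right $(H,\alpha)$-Hom-comodule $(M,\mu)$: an object of $\widetilde{\mathscr{H}}(\mathscr{M}_k)$ with $k$-linear $\rho_M:M\to M\otimes H$, $\rho_M(m)=m_{[0]}\otimes m_{[1]}$, such that $\rho_M(\mu(m))=\mu(m_{[0]})\otimes\alpha(m_{[1]})$, $m_{[0][0]}\otimes m_{[0][1]}\otimes\alpha^{-1}(m_{[1]})=\mu^{-1}(m_{[0]})\otimes\Delta(m_{[1]})$, $m_{[0]}\varepsilon(m_{[1]})=\mu^{-1}(m)$. Right $(H,\alpha)$-Hom-comodule algebra $(A,\beta)$: a monoidal Hom-algebra that is a right $(H,\alpha)$-Hom-comodule with $\rho_A(a)=a_{[0]}\otimes a_{[1]}$, $\rho_A(ab)=a_{[0]}b_{[0]}\otimes a_{[1]}b_{[1]}$, $\rho_A(1_A)=1_A\otimes1_H$. Relative Hom-Hopf module: $(M,\mu)$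 which is both a right $(A,\beta)$-Hom-module and a right $(H,\alpha)$-Hom-comodule with $\rho_M(m\cdot a)=m_{[0]}\cdot a_{[0]}\otimes m_{[1]}a_{[1]}$. The category (morphisms of $\widetilde{\mathscr{H}}(\mathscr{M}_k)$ that are both $A$-linear and $H$-colinear) is $\widetilde{\mathscr{H}}(\mathscr{M}_k)^H_A$. Here $G$ denotes the right adjoint $M\mapsto M\otimes H$ of the functor from $\widetilde{\mathscr{H}}(\mathscr{M}_k)^H_A$ to right $(A,\beta)$-Hom-modules forgetting the coaction, applied to $A$; and $\widetilde G$ denotes the left adjoint $N\mapsto A\otimes N$ of the functor from $\widetilde{\mathscr{H}}(\mathscr{M}_k)^H_A$ to right $(H,\alpha)$-Hom-comodules forgetting the $A$-action, applied to $H$ (a right Hom-comodule over itself via $\Delta$).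
   Formalization: It is additionally assumed that the printed formulas for G̃(H) define a relative Hom-Hopf module; this can fail (the unit axiom forces id⊗α² = id on A⊗H, and compatibility forces a commutation condition) and is necessary for the stated isomorphism. *)

theory Defs
  imports "HOL-Algebra.Module" "HOL-Algebra.AbelCoset" "HOL-Library.FuncSet"
begin

text \<open>
  Everything is relative to carriers, over a commutative ring \<open>R\<close> in the sense of
  \<^locale>\<open>cring\<close> (the zero ring is allowed).
\<close>

section \<open>Linear and bilinear maps, tensor products\<close>

definition linear_maps ::
    "('r, 'x) ring_scheme \<Rightarrow> ('r, 'm, 'y) module_scheme \<Rightarrow> ('r, 'n, 'z) module_scheme
      \<Rightarrow> ('m \<Rightarrow> 'n) set" where
  "linear_maps R M N =
    {f. f \<in> carrier M \<rightarrow> carrier N \<and>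
        (\<forall>x\<in>carrier M. \<forall>y\<in>carrier M. f (x \<oplus>\<^bsub>M\<^esub> y) = f x \<oplus>\<^bsub>N\<^esub> f y) \<and>
        (\<forall>r\<in>carrier R. \<forall>x\<in>carrier M. f (r \<odot>\<^bsub>M\<^esub> x) = r \<odot>\<^bsub>N\<^esub> f x)}"

definition bilinear_map ::
    "('r, 'x) ring_scheme \<Rightarrow> ('r, 'm, 'y) module_scheme \<Rightarrow> ('r, 'n, 'z) module_scheme
      \<Rightarrow> ('r, 'p, 'w) module_scheme \<Rightarrow> ('m \<Rightarrow> 'n \<Rightarrow> 'p) \<Rightarrow> bool" where
  "bilinear_map R M N P f \<longleftrightarrow>
    (\<forall>n\<in>carrier N. (\<lambda>m. f m n) \<in> linear_maps R M P) \<and>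
    (\<forall>m\<in>carrier M. f m \<in> linear_maps R N P)"

text \<open>The multiplicative fields of a \<^typ>\<open>('r, 'm) module\<close> record carry no meaning for a
  plain module; they are left \<^const>\<open>undefined\<close> below.\<close>

definition ground_module :: "('r, 'x) ring_scheme \<Rightarrow> ('r, 'r) module" where
  "ground_module R =
    \<lparr>carrier = carrier R, mult = mult R, one = one R, zero = zero R, add = add R,
     smult = mult R\<rparr>"

definition free_module :: "('r, 'x) ring_scheme \<Rightarrow> 'b set \<Rightarrow> ('r, 'b \<Rightarrow> 'r) module" where
  "free_module R B =
    \<lparr>carrier = {f. (\<forall>b. f b \<in> carrier R) \<and> (\<forall>b. b \<notin> B \<longrightarrow> f b = \<zero>\<^bsub>R\<^esub>) \<and> finite {b. f b \<noteq> \<zero>\<^bsub>R\<^esub>}},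
     mult = undefined, one = undefined,
     zero = (\<lambda>_. \<zero>\<^bsub>R\<^esub>), add = (\<lambda>f g b. f b \<oplus>\<^bsub>R\<^esub> g b),
     smult = (\<lambda>r f b. r \<otimes>\<^bsub>R\<^esub> f b)\<rparr>"

definition free_gen :: "('r, 'x) ring_scheme \<Rightarrow> 'b \<Rightarrow> 'b \<Rightarrow> 'r" where
  "free_gen R b = (\<lambda>b'. if b' = b then \<one>\<^bsub>R\<^esub> else \<zero>\<^bsub>R\<^esub>)"

definition submodule_span ::
    "('r, 'x) ring_scheme \<Rightarrow> ('r, 'm, 'y) module_scheme \<Rightarrow> 'm set \<Rightarrow> 'm set" where
  "submodule_span R M X = \<Inter>{K. submodule K R M \<and> X \<subseteq> K}"

definition quotient_module :: "('r, 'm, 'y) module_scheme \<Rightarrow> 'm set \<Rightarrow> ('r, 'm set) module" where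
  "quotient_module M K =
    \<lparr>carrier = a_rcosets\<^bsub>M\<^esub> K, mult = undefined, one = undefined,
     zero = K, add = set_add M,
     smult = (\<lambda>r X. \<Union>x\<in>X. K +>\<^bsub>M\<^esub> (r \<odot>\<^bsub>M\<^esub> x))\<rparr>"

definition tensor_relations ::
    "('r, 'x) ring_scheme \<Rightarrow> ('r, 'm, 'y) module_scheme \<Rightarrow> ('r, 'n, 'z) module_scheme
      \<Rightarrow> ('m \<times> 'n \<Rightarrow> 'r) set" where
  "tensor_relations R M N =
    (let F = free_module R (carrier M \<times> carrier N); \<delta> = free_gen R in
      {\<delta> (m \<oplus>\<^bsub>M\<^esub> m', n) \<ominus>\<^bsub>F\<^esub> (\<delta> (m, n) \<oplus>\<^bsub>F\<^esub> \<delta> (m', n)) | m m' n.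
        m \<in> carrier M \<and> m' \<in> carrier M \<and> n \<in> carrier N} \<union>
      {\<delta> (m, n \<oplus>\<^bsub>N\<^esub> n') \<ominus>\<^bsub>F\<^esub> (\<delta> (m, n) \<oplus>\<^bsub>F\<^esub> \<delta> (m, n')) | m n n'.
        m \<in> carrier M \<and> n \<in> carrier N \<and> n' \<in> carrier N} \<union>
      {\<delta> (r \<odot>\<^bsub>M\<^esub> m, n) \<ominus>\<^bsub>F\<^esub> r \<odot>\<^bsub>F\<^esub> \<delta> (m, n) | r m n.
        r \<in> carrier R \<and> m \<in> carrier M \<and> n \<in> carrier N} \<union>
      {\<delta> (m, r \<odot>\<^bsub>N\<^esub> n) \<ominus>\<^bsub>F\<^esub> r \<odot>\<^bsub>F\<^esub> \<delta> (m, n) | r m n.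
        r \<in> carrier R \<and> m \<in> carrier M \<and> n \<in> carrier N})"

type_synonym ('r, 'm, 'n) tensor = "('m \<times> 'n \<Rightarrow> 'r) set"

definition tensor_module ::
    "('r, 'x) ring_scheme \<Rightarrow> ('r, 'm, 'y) module_scheme \<Rightarrow> ('r, 'n, 'z) module_scheme
      \<Rightarrow> ('r, ('r, 'm, 'n) tensor) module" where
  "tensor_module R M N =
    (let F = free_module R (carrier M \<times> carrier N) in
      quotient_module F (submodule_span R F (tensor_relations R M N)))"

definition tens ::
    "('r, 'x) ring_scheme \<Rightarrow> ('r, 'm, 'y) module_scheme \<Rightarrow> ('r, 'n, 'z) module_scheme
      \<Rightarrow> 'm \<Rightarrow> 'n \<Rightarrow> ('r, 'm, 'n) tensor" where
  "tens R M N m n =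
    (let F = free_module R (carrier M \<times> carrier N) in
      submodule_span R F (tensor_relations R M N) +>\<^bsub>F\<^esub> free_gen R (m, n))"

text \<open>The linear map on a tensor product induced by a bilinear map \<open>f\<close>; see
  \<open>tensor_lift_universal\<close> below for existence and uniqueness.\<close>

definition tensor_lift ::
    "('r, 'x) ring_scheme \<Rightarrow> ('r, 'm, 'y) module_scheme \<Rightarrow> ('r, 'n, 'z) module_scheme
      \<Rightarrow> ('r, 'p, 'w) module_scheme \<Rightarrow> ('m \<Rightarrow> 'n \<Rightarrow> 'p) \<Rightarrow> ('r, 'm, 'n) tensor \<Rightarrow> 'p" where
  "tensor_lift R M N P f =
    (THE g. g \<in> linear_maps R (tensor_module R M N) P \<and>
            g \<in> extensional (carrier (tensor_module R M N)) \<and>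
            (\<forall>m\<in>carrier M. \<forall>n\<in>carrier N. g (tens R M N m n) = f m n))"

text \<open>Sweedler notation: for \<open>t = \<Sum> m \<otimes> n\<close> in the tensor product of \<open>M\<close> and \<open>N\<close>, the term
  \<open>sweedler R M N P t (\<lambda>m n. f m n)\<close> is the element \<open>\<Sum> f m n\<close> of \<open>P\<close>.\<close>

abbreviation sweedler ::
    "('r, 'x) ring_scheme \<Rightarrow> ('r, 'm, 'y) module_scheme \<Rightarrow> ('r, 'n, 'z) module_scheme
      \<Rightarrow> ('r, 'p, 'w) module_scheme \<Rightarrow> ('r, 'm, 'n) tensor \<Rightarrow> ('m \<Rightarrow> 'n \<Rightarrow> 'p) \<Rightarrow> 'p" where
  "sweedler R M N P t f \<equiv> tensor_lift R M N P f t"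


section \<open>The universal property of the tensor product\<close>

lemma linear_mapsI:
  assumes "\<And>x. x \<in> carrier M \<Longrightarrow> f x \<in> carrier N"
    and "\<And>x y. x \<in> carrier M \<Longrightarrow> y \<in> carrier M \<Longrightarrow> f (x \<oplus>\<^bsub>M\<^esub> y) = f x \<oplus>\<^bsub>N\<^esub> f y"
    and "\<And>r x. r \<in> carrier R \<Longrightarrow> x \<in> carrier M \<Longrightarrow> f (r \<odot>\<^bsub>M\<^esub> x) = r \<odot>\<^bsub>N\<^esub> f x"
  shows "f \<in> linear_maps R M N"
  using assms unfolding linear_maps_def by auto

lemma linear_mapsD:
  assumes "f \<in> linear_maps R M N"
  shows "\<And>x. x \<in> carrier M \<Longrightarrow> f x \<in> carrier N"
    and "\<And>x y. x \<in> carrier M \<Longrightarrow> y \<in> carrier M \<Longrightarrow> f (x \<oplus>\<^bsub>M\<^esub> y) = f x \<oplus>\<^bsub>N\<^esub> f y"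
    and "\<And>r x. r \<in> carrier R \<Longrightarrow> x \<in> carrier M \<Longrightarrow> f (r \<odot>\<^bsub>M\<^esub> x) = r \<odot>\<^bsub>N\<^esub> f x"
  using assms unfolding linear_maps_def by auto

lemma free_module_simps [simp]:
  "zero (free_module R B) = (\<lambda>_. \<zero>\<^bsub>R\<^esub>)"
  "add (free_module R B) = (\<lambda>f g b. f b \<oplus>\<^bsub>R\<^esub> g b)"
  "smult (free_module R B) = (\<lambda>r f b. r \<otimes>\<^bsub>R\<^esub> f b)"
  by (simp_all add: free_module_def)

lemma free_module_carrier:
  "u \<in> carrier (free_module R B) \<longleftrightarrow>
    (\<forall>b. u b \<in> carrier R) \<and> (\<forall>b. b \<notin> B \<longrightarrow> u b = \<zero>\<^bsub>R\<^esub>) \<and> finite {b. u b \<noteq> \<zero>\<^bsub>R\<^esub>}"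
  by (simp add: free_module_def)

lemma free_module_module:
  assumes "cring R"
  shows "module R (free_module R B)"
proof -
  interpret R: cring R by fact
  let ?F = "free_module R B"
  have add: "(\<lambda>b. u b \<oplus>\<^bsub>R\<^esub> v b) \<in> carrier ?F" if "u \<in> carrier ?F" "v \<in> carrier ?F" for u v
  proof -
    have "{b. u b \<oplus>\<^bsub>R\<^esub> v b \<noteq> \<zero>\<^bsub>R\<^esub>} \<subseteq> {b. u b \<noteq> \<zero>\<^bsub>R\<^esub>} \<union> {b. v b \<noteq> \<zero>\<^bsub>R\<^esub>}" by auto
    then show ?thesis using that finite_subset
      unfolding free_module_carrier by (auto intro: finite_subset)
  qed
  have neg: "(\<lambda>b. \<ominus>\<^bsub>R\<^esub> u b) \<in> carrier ?F" if "u \<in> carrier ?F" for u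
  proof -
    have "{b. \<ominus>\<^bsub>R\<^esub> u b \<noteq> \<zero>\<^bsub>R\<^esub>} \<subseteq> {b. u b \<noteq> \<zero>\<^bsub>R\<^esub>}" by auto
    then show ?thesis using that
      unfolding free_module_carrier by (auto intro: finite_subset)
  qed
  have sm: "(\<lambda>b. r \<otimes>\<^bsub>R\<^esub> u b) \<in> carrier ?F" if "r \<in> carrier R" "u \<in> carrier ?F" for r u
  proof -
    have "{b. r \<otimes>\<^bsub>R\<^esub> u b \<noteq> \<zero>\<^bsub>R\<^esub>} \<subseteq> {b. u b \<noteq> \<zero>\<^bsub>R\<^esub>}" using that by auto
    then show ?thesis using that
      unfolding free_module_carrier by (auto intro: finite_subset)
  qed
  have ag: "abelian_group ?F"
  proof (rule abelian_groupI)
    fix x assume "x \<in> carrier ?F"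
    then show "\<exists>y\<in>carrier ?F. y \<oplus>\<^bsub>?F\<^esub> x = \<zero>\<^bsub>?F\<^esub>"
      using neg[of x] by (intro bexI[of _ "\<lambda>b. \<ominus>\<^bsub>R\<^esub> x b"]) (auto simp: free_module_carrier R.l_neg)
  qed (use add in \<open>auto simp: free_module_carrier R.a_ac\<close>)
  show ?thesis
    by (rule moduleI) (use assms ag sm in \<open>auto simp: free_module_carrier R.l_distr R.r_distr R.m_assoc\<close>)
qed

lemma free_gen_closed: "cring R \<Longrightarrow> b \<in> B \<Longrightarrow> free_gen R b \<in> carrier (free_module R B)"
proof -
  assume "cring R" "b \<in> B"
  then interpret cring R by simp
  have "{b'. free_gen R b b' \<noteq> \<zero>\<^bsub>R\<^esub>} \<subseteq> {b}" by (auto simp: free_gen_def)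
  then show ?thesis using \<open>b \<in> B\<close>
    unfolding free_module_carrier by (auto simp: free_gen_def intro: finite_subset)
qed

context module begin

lemma submodule_span_submodule:
  assumes "X \<subseteq> carrier M"
  shows "submodule (submodule_span R M X) R M"
proof -
  have c: "submodule (carrier M) R M \<and> X \<subseteq> carrier M"
    using assms carrier_is_submodule by simp
  show ?thesis
  proof (rule submoduleI)
    show "submodule_span R M X \<subseteq> carrier M" using c unfolding submodule_span_def by auto
    show "\<zero>\<^bsub>M\<^esub> \<in> submodule_span R M X" unfolding submodule_span_def
      using subgroup.one_closed submodule.axioms(1) by fastforce
    show "a \<odot>\<^bsub>M\<^esub> x \<in> submodule_span R M X" if "a \<in> carrier R" "x \<in> submodule_span R M X" for a x
      using that submoduleE(4) unfolding submodule_span_def by blast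
    show "a \<oplus>\<^bsub>M\<^esub> b \<in> submodule_span R M X"
      if "a \<in> submodule_span R M X" "b \<in> submodule_span R M X" for a b
      using that submoduleE(5) unfolding submodule_span_def by blast
    show "\<ominus>\<^bsub>M\<^esub> a \<in> submodule_span R M X" if "a \<in> submodule_span R M X" for a
      using that submoduleE(3) unfolding submodule_span_def by blast
  qed
qed

lemma submodule_span_least: "submodule K R M \<Longrightarrow> X \<subseteq> K \<Longrightarrow> submodule_span R M X \<subseteq> K"
  unfolding submodule_span_def by auto

lemma submodule_span_incl: "X \<subseteq> submodule_span R M X"
  unfolding submodule_span_def by auto

end

lemma quotient_module_simps:
  "carrier (quotient_module M K) = a_rcosets\<^bsub>M\<^esub> K"
  "zero (quotient_module M K) = K"
  "add (quotient_module M K) = set_add M"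
  "smult (quotient_module M K) = (\<lambda>r X. \<Union>x\<in>X. K +>\<^bsub>M\<^esub> (r \<odot>\<^bsub>M\<^esub> x))"
  by (simp_all add: quotient_module_def)

locale module_quotient = module R M for R (structure) and M (structure) +
  fixes K assumes sub: "submodule K R M"
begin

abbreviation "pr x \<equiv> K +>\<^bsub>M\<^esub> x"

lemma ab: "abelian_subgroup K M"
  by (rule abelian_subgroupI3[OF additive_subgroup.intro[OF submodule.axioms(1)[OF sub]]])
     (rule abelian_group_axioms)

sublocale abelian_subgroup K M by (rule ab)

lemma pr_add: "x \<in> carrier M \<Longrightarrow> y \<in> carrier M \<Longrightarrow> set_add M (pr x) (pr y) = pr (x \<oplus>\<^bsub>M\<^esub> y)"
  by (rule a_rcos_sum)

lemma pr_eq: "x \<in> carrier M \<Longrightarrow> y \<in> carrier M \<Longrightarrow> pr x = pr y \<longleftrightarrow> x \<ominus>\<^bsub>M\<^esub> y \<in> K"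
  by (metis a_repr_independence' a_rcos_self a_rcos_module_imp a_rcos_module_rev a_subgroup minus_closed a_minus_def)

lemma pr_smult:
  assumes r: "r \<in> carrier R" and x: "x \<in> carrier M"
  shows "(\<Union>z\<in>pr x. pr (r \<odot>\<^bsub>M\<^esub> z)) = pr (r \<odot>\<^bsub>M\<^esub> x)"
proof -
  have "pr (r \<odot>\<^bsub>M\<^esub> z) = pr (r \<odot>\<^bsub>M\<^esub> x)" if z: "z \<in> pr x" for z
  proof -
    have zc: "z \<in> carrier M" using z x a_r_coset_subset_G a_subset by blast
    have "z \<ominus>\<^bsub>M\<^esub> x \<in> K" using z zc x pr_eq a_repr_independence' by blast
    then have "r \<odot>\<^bsub>M\<^esub> (z \<ominus>\<^bsub>M\<^esub> x) \<in> K" using r sub submoduleE(4) by blast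
    moreover have "r \<odot>\<^bsub>M\<^esub> (z \<ominus>\<^bsub>M\<^esub> x) = r \<odot>\<^bsub>M\<^esub> z \<ominus>\<^bsub>M\<^esub> r \<odot>\<^bsub>M\<^esub> x"
      using r x zc by (simp add: a_minus_def smult_r_distr smult_r_minus)
    ultimately show ?thesis using pr_eq r x zc by simp
  qed
  then show ?thesis using a_rcos_self[OF x] by blast
qed

lemma quot_carrier: "X \<in> carrier (quotient_module M K) \<longleftrightarrow> (\<exists>x\<in>carrier M. X = pr x)"
  by (auto simp: quotient_module_simps A_RCOSETS_def')

lemma pr_linear: "(\<lambda>x. pr x) \<in> linear_maps R M (quotient_module M K)"
  by (rule linear_mapsI) (auto simp: quot_carrier, auto simp: quotient_module_simps pr_add pr_smult)

lemma pr_zero: "pr \<zero>\<^bsub>M\<^esub> = K"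
  using a_coset_join2 a_subset a_subgroup zero_closed by (simp add: a_coset_add_zero)

lemma quot_module: "module R (quotient_module M K)"
proof -
  let ?Q = "quotient_module M K"
  have ad: "pr x \<oplus>\<^bsub>?Q\<^esub> pr y = pr (x \<oplus>\<^bsub>M\<^esub> y)" if "x \<in> carrier M" "y \<in> carrier M" for x y
    using that by (simp add: quotient_module_simps pr_add)
  have sm: "r \<odot>\<^bsub>?Q\<^esub> pr x = pr (r \<odot>\<^bsub>M\<^esub> x)" if "r \<in> carrier R" "x \<in> carrier M" for r x
    using that by (simp add: quotient_module_simps pr_smult)
  have ze: "\<zero>\<^bsub>?Q\<^esub> = pr \<zero>\<^bsub>M\<^esub>" by (simp add: quotient_module_simps pr_zero)
  have ex: "(\<exists>y\<in>carrier M. pr x = pr y)" if "x \<in> carrier M" for x using that by blast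
  note s = ad sm ze
  have ag: "abelian_group ?Q"
  proof (rule abelian_groupI)
    show "\<zero>\<^bsub>?Q\<^esub> \<in> carrier ?Q" by (auto simp: quot_carrier s ex)
    fix x assume "x \<in> carrier ?Q"
    then obtain a where a: "a \<in> carrier M" "x = pr a" unfolding quot_carrier by auto
    show "\<zero>\<^bsub>?Q\<^esub> \<oplus>\<^bsub>?Q\<^esub> x = x" using a by (simp add: s)
    show "\<exists>y\<in>carrier ?Q. y \<oplus>\<^bsub>?Q\<^esub> x = \<zero>\<^bsub>?Q\<^esub>"
      by (rule bexI[of _ "pr (\<ominus>\<^bsub>M\<^esub> a)"]) (use a in \<open>auto simp: s quot_carrier M.l_neg ex\<close>)
  qed (auto simp: quot_carrier s M.a_ac ex)
  show ?thesis
    by (rule moduleI) (use ag in \<open>auto simp: quot_carrier s smult_l_distr smult_r_distr smult_assoc1 is_cring ex\<close>)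
qed

end


lemma tensor_relations_closed:
  assumes "module R M" "module R N"
  shows "tensor_relations R M N \<subseteq> carrier (free_module R (carrier M \<times> carrier N))"
proof -
  interpret M: module R M by fact
  interpret N: module R N by fact
  let ?F = "free_module R (carrier M \<times> carrier N)"
  interpret F: module R ?F by (rule free_module_module) (rule M.is_cring)
  have d: "free_gen R (m, n) \<in> carrier ?F" if "m \<in> carrier M" "n \<in> carrier N" for m n
    using that by (intro free_gen_closed M.is_cring) auto
  note c = F.M.minus_closed F.add.m_closed F.smult_closed d
    M.add.m_closed N.add.m_closed M.smult_closed N.smult_closed
  show ?thesis
    unfolding tensor_relations_def Let_def
    by (intro Un_least subsetI; elim CollectE exE conjE; hypsubst)
      (rule c | assumption)+
qed

lemma tensor_quot:
  assumes "module R M" "module R N"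
  shows "module_quotient R (free_module R (carrier M \<times> carrier N))
    (submodule_span R (free_module R (carrier M \<times> carrier N)) (tensor_relations R M N))"
proof -
  interpret M: module R M by fact
  interpret F: module R "free_module R (carrier M \<times> carrier N)"
    by (rule free_module_module) (rule M.is_cring)
  show ?thesis
    by (rule module_quotient.intro[OF F.module_axioms module_quotient_axioms.intro])
      (rule F.submodule_span_submodule[OF tensor_relations_closed[OF assms]])
qed

lemma tensor_module_module:
  assumes "module R M" "module R N"
  shows "module R (tensor_module R M N)"
  using module_quotient.quot_module[OF tensor_quot[OF assms]] by (simp add: tensor_module_def Let_def)

lemma free_module_finsum:
  assumes "module R P" and f: "\<And>b. b \<in> B \<Longrightarrow> f b \<in> carrier P"
  shows "(\<lambda>u. \<Oplus>\<^bsub>P\<^esub>b\<in>{b. u b \<noteq> \<zero>\<^bsub>R\<^esub>}. u b \<odot>\<^bsub>P\<^esub> f b) \<in> linear_maps R (free_module R B) P"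
    (is "?g \<in> _")
    and "b \<in> B \<Longrightarrow> (\<Oplus>\<^bsub>P\<^esub>b'\<in>{b'. free_gen R b b' \<noteq> \<zero>\<^bsub>R\<^esub>}. free_gen R b b' \<odot>\<^bsub>P\<^esub> f b') = f b"
proof -
  interpret P: module R P by fact
  let ?F = "free_module R B"
  have ext: "?g u = (\<Oplus>\<^bsub>P\<^esub>b\<in>S. u b \<odot>\<^bsub>P\<^esub> f b)"
    if u: "u \<in> carrier ?F" and S: "finite S" "{b. u b \<noteq> \<zero>\<^bsub>R\<^esub>} \<subseteq> S" "S \<subseteq> B" for u S
  proof -
    have "(\<Oplus>\<^bsub>P\<^esub>b\<in>S. u b \<odot>\<^bsub>P\<^esub> f b) = ?g u"
      by (rule P.add.finprod_mono_neutral_cong_right)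
        (use u S f in \<open>auto simp: free_module_carrier subset_eq\<close>)
    then show ?thesis by simp
  qed
  have sup: "{b. u b \<noteq> \<zero>\<^bsub>R\<^esub>} \<subseteq> B" "finite {b. u b \<noteq> \<zero>\<^bsub>R\<^esub>}" "\<And>b. u b \<in> carrier R"
    if "u \<in> carrier ?F" for u
    using that by (auto simp: free_module_carrier)
  interpret F: module R ?F by (rule free_module_module) (rule P.is_cring)
  show "?g \<in> linear_maps R ?F P"
  proof (rule linear_mapsI)
    fix u v assume u: "u \<in> carrier ?F" and v: "v \<in> carrier ?F"
    let ?S = "{b. u b \<noteq> \<zero>\<^bsub>R\<^esub>} \<union> {b. v b \<noteq> \<zero>\<^bsub>R\<^esub>}"
    have S: "finite ?S" "?S \<subseteq> B" using sup u v by auto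
    have uv: "u \<oplus>\<^bsub>?F\<^esub> v \<in> carrier ?F" using u v by (rule F.add.m_closed)
    have "?g (u \<oplus>\<^bsub>?F\<^esub> v) = (\<Oplus>\<^bsub>P\<^esub>b\<in>?S. (u \<oplus>\<^bsub>?F\<^esub> v) b \<odot>\<^bsub>P\<^esub> f b)"
      by (rule ext[OF uv]) (use S in auto)
    also have "\<dots> = (\<Oplus>\<^bsub>P\<^esub>b\<in>?S. u b \<odot>\<^bsub>P\<^esub> f b \<oplus>\<^bsub>P\<^esub> v b \<odot>\<^bsub>P\<^esub> f b)"
      by (rule P.finsum_cong') (use S sup[OF u] sup[OF v] f in \<open>auto simp: P.smult_l_distr\<close>)
    also have "\<dots> = (\<Oplus>\<^bsub>P\<^esub>b\<in>?S. u b \<odot>\<^bsub>P\<^esub> f b) \<oplus>\<^bsub>P\<^esub> (\<Oplus>\<^bsub>P\<^esub>b\<in>?S. v b \<odot>\<^bsub>P\<^esub> f b)"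
      by (rule P.finsum_addf) (use S sup[OF u] sup[OF v] f in auto)
    also have "\<dots> = ?g u \<oplus>\<^bsub>P\<^esub> ?g v"
      using ext[OF u S(1)] ext[OF v S(1)] S(2) by auto
    finally show "?g (u \<oplus>\<^bsub>?F\<^esub> v) = ?g u \<oplus>\<^bsub>P\<^esub> ?g v" .
  next
    fix u assume u: "u \<in> carrier ?F"
    show "?g u \<in> carrier P"
      by (rule P.finsum_closed) (use sup[OF u] f in auto)
    fix r assume r: "r \<in> carrier R"
    let ?S = "{b. u b \<noteq> \<zero>\<^bsub>R\<^esub>}"
    have ru: "r \<odot>\<^bsub>?F\<^esub> u \<in> carrier ?F" using r u by (rule F.smult_closed)
    have "?g (r \<odot>\<^bsub>?F\<^esub> u) = (\<Oplus>\<^bsub>P\<^esub>b\<in>?S. (r \<odot>\<^bsub>?F\<^esub> u) b \<odot>\<^bsub>P\<^esub> f b)"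
      by (rule ext[OF ru]) (use sup[OF u] r in auto)
    also have "\<dots> = (\<Oplus>\<^bsub>P\<^esub>b\<in>?S. r \<odot>\<^bsub>P\<^esub> (u b \<odot>\<^bsub>P\<^esub> f b))"
      by (rule P.finsum_cong') (use sup[OF u] r f in \<open>auto simp: P.smult_assoc1 subset_eq\<close>)
    also have "\<dots> = r \<odot>\<^bsub>P\<^esub> ?g u"
      by (rule P.finsum_smult_ldistr[symmetric]) (use sup[OF u] r f in auto)
    finally show "?g (r \<odot>\<^bsub>?F\<^esub> u) = r \<odot>\<^bsub>P\<^esub> ?g u" .
  qed
  assume b: "b \<in> B"
  have "?g (free_gen R b) = (\<Oplus>\<^bsub>P\<^esub>b'\<in>{b}. free_gen R b b' \<odot>\<^bsub>P\<^esub> f b')"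
    by (rule ext[OF free_gen_closed[OF P.is_cring b]]) (use b in \<open>auto simp: free_gen_def\<close>)
  also have "\<dots> = f b" using f[OF b] by (simp add: free_gen_def)
  finally show "?g (free_gen R b) = f b" .
qed

lemma free_module_induct [consumes 2, case_names zero gen add]:
  assumes R: "cring R" and u: "u \<in> carrier (free_module R B)"
    and zero: "Q (\<lambda>_. \<zero>\<^bsub>R\<^esub>)"
    and gen: "\<And>r b. r \<in> carrier R \<Longrightarrow> b \<in> B \<Longrightarrow> Q (r \<odot>\<^bsub>free_module R B\<^esub> free_gen R b)"
    and add: "\<And>u v. u \<in> carrier (free_module R B) \<Longrightarrow> v \<in> carrier (free_module R B)
      \<Longrightarrow> Q u \<Longrightarrow> Q v \<Longrightarrow> Q (u \<oplus>\<^bsub>free_module R B\<^esub> v)"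
  shows "Q u"
proof -
  interpret R: cring R by fact
  let ?F = "free_module R B"
  interpret F: module R ?F by (rule free_module_module[OF R])
  have "finite S \<Longrightarrow> (\<forall>u\<in>carrier ?F. {b. u b \<noteq> \<zero>\<^bsub>R\<^esub>} \<subseteq> S \<longrightarrow> Q u)" for S
  proof (induction S rule: finite_induct)
    case empty
    have "u = (\<lambda>_. \<zero>\<^bsub>R\<^esub>)" if "{b. u b \<noteq> \<zero>\<^bsub>R\<^esub>} \<subseteq> {}" for u using that by auto
    then show ?case using zero by simp
  next
    case (insert b S)
    show ?case
    proof (intro ballI impI)
      fix u assume u: "u \<in> carrier ?F" and s: "{b. u b \<noteq> \<zero>\<^bsub>R\<^esub>} \<subseteq> insert b S"
      show "Q u"
      proof (cases "u b = \<zero>\<^bsub>R\<^esub>")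
        case True
        then have "{b. u b \<noteq> \<zero>\<^bsub>R\<^esub>} \<subseteq> S" using s by auto
        then show ?thesis using insert.IH u by blast
      next
        case False
        then have b: "b \<in> B" and ub: "u b \<in> carrier R" using u by (auto simp: free_module_carrier)
        define v where "v = u(b := \<zero>\<^bsub>R\<^esub>)"
        have v: "v \<in> carrier ?F" "{b. v b \<noteq> \<zero>\<^bsub>R\<^esub>} \<subseteq> S"
        proof -
          have "{b. v b \<noteq> \<zero>\<^bsub>R\<^esub>} \<subseteq> {b. u b \<noteq> \<zero>\<^bsub>R\<^esub>}" by (auto simp: v_def)
          then show "v \<in> carrier ?F" using u unfolding free_module_carrier
            by (auto simp: v_def intro: finite_subset)
          show "{b. v b \<noteq> \<zero>\<^bsub>R\<^esub>} \<subseteq> S" using s by (auto simp: v_def)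
        qed
        have "u = (u b \<odot>\<^bsub>?F\<^esub> free_gen R b) \<oplus>\<^bsub>?F\<^esub> v"
        proof (rule ext)
          fix x
          have "u x \<in> carrier R" using u by (simp add: free_module_carrier)
          then show "u x = ((u b \<odot>\<^bsub>?F\<^esub> free_gen R b) \<oplus>\<^bsub>?F\<^esub> v) x"
            using ub by (cases "x = b") (simp_all add: v_def free_gen_def)
        qed
        moreover have "Q ((u b \<odot>\<^bsub>?F\<^esub> free_gen R b) \<oplus>\<^bsub>?F\<^esub> v)"
          by (rule add[OF F.smult_closed[OF ub free_gen_closed[OF R b]] v(1) gen[OF ub b]])
            (use insert.IH v in blast)
        ultimately show ?thesis by (rule ssubst[where P = Q])
      qed
    qed
  qed
  from this[of "{b. u b \<noteq> \<zero>\<^bsub>R\<^esub>}"] show ?thesis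
    using u free_module_carrier[of u R B] by blast
qed

lemma tensor_relationsI:
  fixes R M N
  defines "F \<equiv> free_module R (carrier M \<times> carrier N)" and "\<delta> \<equiv> free_gen R"
  shows "\<lbrakk>m \<in> carrier M; m' \<in> carrier M; n \<in> carrier N\<rbrakk>
      \<Longrightarrow> \<delta> (m \<oplus>\<^bsub>M\<^esub> m', n) \<ominus>\<^bsub>F\<^esub> (\<delta> (m, n) \<oplus>\<^bsub>F\<^esub> \<delta> (m', n)) \<in> tensor_relations R M N"
    and "\<lbrakk>m \<in> carrier M; n \<in> carrier N; n' \<in> carrier N\<rbrakk>
      \<Longrightarrow> \<delta> (m, n \<oplus>\<^bsub>N\<^esub> n') \<ominus>\<^bsub>F\<^esub> (\<delta> (m, n) \<oplus>\<^bsub>F\<^esub> \<delta> (m, n')) \<in> tensor_relations R M N"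
    and "\<lbrakk>r \<in> carrier R; m \<in> carrier M; n \<in> carrier N\<rbrakk>
      \<Longrightarrow> \<delta> (r \<odot>\<^bsub>M\<^esub> m, n) \<ominus>\<^bsub>F\<^esub> r \<odot>\<^bsub>F\<^esub> \<delta> (m, n) \<in> tensor_relations R M N"
    and "\<lbrakk>r \<in> carrier R; m \<in> carrier M; n \<in> carrier N\<rbrakk>
      \<Longrightarrow> \<delta> (m, r \<odot>\<^bsub>N\<^esub> n) \<ominus>\<^bsub>F\<^esub> r \<odot>\<^bsub>F\<^esub> \<delta> (m, n) \<in> tensor_relations R M N"
  unfolding tensor_relations_def Let_def F_def \<delta>_def by blast+

theorem tens_bilinear:
  assumes "module R M" "module R N"
  shows "bilinear_map R M N (tensor_module R M N) (tens R M N)"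
proof -
  interpret M: module R M by fact
  interpret N: module R N by fact
  let ?F = "free_module R (carrier M \<times> carrier N)"
  let ?K = "submodule_span R ?F (tensor_relations R M N)"
  interpret F: module R ?F by (rule free_module_module) (rule M.is_cring)
  interpret Q: module_quotient R ?F ?K by (rule tensor_quot[OF assms])
  let ?T = "tensor_module R M N"
  have T: "?T = quotient_module ?F ?K" by (simp add: tensor_module_def Let_def)
  have tens: "tens R M N m n = Q.pr (free_gen R (m, n))" for m n
    by (simp add: tens_def Let_def)
  note ss = F.submodule_span_incl[of "tensor_relations R M N"]
  have d: "free_gen R (m, n) \<in> carrier ?F" if "m \<in> carrier M" "n \<in> carrier N" for m n
    using that by (intro free_gen_closed M.is_cring) auto
  note L = linear_mapsD[OF Q.pr_linear, folded T]
  have r1: "tens R M N (m \<oplus>\<^bsub>M\<^esub> m') n = tens R M N m n \<oplus>\<^bsub>?T\<^esub> tens R M N m' n"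
    if "m \<in> carrier M" "m' \<in> carrier M" "n \<in> carrier N" for m m' n
  proof -
    have "free_gen R (m \<oplus>\<^bsub>M\<^esub> m', n) \<ominus>\<^bsub>?F\<^esub> (free_gen R (m, n) \<oplus>\<^bsub>?F\<^esub> free_gen R (m', n)) \<in> ?K"
      using subsetD[OF ss tensor_relationsI(1)] that by blast
    then show ?thesis using that d by (simp only: tens L(2)[symmetric] Q.pr_eq F.add.m_closed M.add.m_closed)
  qed
  have r2: "tens R M N m (n \<oplus>\<^bsub>N\<^esub> n') = tens R M N m n \<oplus>\<^bsub>?T\<^esub> tens R M N m n'"
    if "m \<in> carrier M" "n \<in> carrier N" "n' \<in> carrier N" for m n n'
  proof -
    have "free_gen R (m, n \<oplus>\<^bsub>N\<^esub> n') \<ominus>\<^bsub>?F\<^esub> (free_gen R (m, n) \<oplus>\<^bsub>?F\<^esub> free_gen R (m, n')) \<in> ?K"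
      using subsetD[OF ss tensor_relationsI(2)] that by blast
    then show ?thesis using that d by (simp only: tens L(2)[symmetric] Q.pr_eq F.add.m_closed N.add.m_closed)
  qed
  have r3: "tens R M N (r \<odot>\<^bsub>M\<^esub> m) n = r \<odot>\<^bsub>?T\<^esub> tens R M N m n"
    if "r \<in> carrier R" "m \<in> carrier M" "n \<in> carrier N" for r m n
  proof -
    have "free_gen R (r \<odot>\<^bsub>M\<^esub> m, n) \<ominus>\<^bsub>?F\<^esub> r \<odot>\<^bsub>?F\<^esub> free_gen R (m, n) \<in> ?K"
      using subsetD[OF ss tensor_relationsI(3)] that by blast
    then show ?thesis using that d by (simp only: tens L(3)[symmetric] Q.pr_eq F.smult_closed M.smult_closed)
  qed
  have r4: "tens R M N m (r \<odot>\<^bsub>N\<^esub> n) = r \<odot>\<^bsub>?T\<^esub> tens R M N m n"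
    if "r \<in> carrier R" "m \<in> carrier M" "n \<in> carrier N" for r m n
  proof -
    have "free_gen R (m, r \<odot>\<^bsub>N\<^esub> n) \<ominus>\<^bsub>?F\<^esub> r \<odot>\<^bsub>?F\<^esub> free_gen R (m, n) \<in> ?K"
      using subsetD[OF ss tensor_relationsI(4)] that by blast
    then show ?thesis using that d by (simp only: tens L(3)[symmetric] Q.pr_eq F.smult_closed N.smult_closed)
  qed
  have cl: "tens R M N m n \<in> carrier ?T" if "m \<in> carrier M" "n \<in> carrier N" for m n
    using L(1) d that by (simp only: tens)
  have "(\<lambda>m. tens R M N m n) \<in> linear_maps R M ?T" if "n \<in> carrier N" for n
    by (rule linear_mapsI) (rule cl r1 r3; (assumption | rule that))+
  moreover have "tens R M N m \<in> linear_maps R N ?T" if "m \<in> carrier M" for m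
    by (rule linear_mapsI) (rule cl r2 r4; (assumption | rule that))+
  ultimately show ?thesis
    unfolding bilinear_map_def by blast
qed

theorem tensor_lift_universal:
  assumes M: "module R M" and N: "module R N" and P: "module R P"
    and f: "bilinear_map R M N P f"
  shows "\<exists>!g. g \<in> linear_maps R (tensor_module R M N) P \<and>
              g \<in> extensional (carrier (tensor_module R M N)) \<and>
              (\<forall>m\<in>carrier M. \<forall>n\<in>carrier N. g (tens R M N m n) = f m n)"
proof -
  interpret M: module R M by fact
  interpret N: module R N by fact
  interpret P: module R P by fact
  let ?F = "free_module R (carrier M \<times> carrier N)"
  let ?K = "submodule_span R ?F (tensor_relations R M N)"
  interpret F: module R ?F by (rule free_module_module) (rule M.is_cring)
  interpret Q: module_quotient R ?F ?K by (rule tensor_quot[OF M N])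
  let ?T = "tensor_module R M N"
  have T: "?T = quotient_module ?F ?K" by (simp add: tensor_module_def Let_def)
  have tens: "tens R M N m n = Q.pr (free_gen R (m, n))" for m n
    by (simp add: tens_def Let_def)
  have d: "free_gen R (m, n) \<in> carrier ?F" if "m \<in> carrier M" "n \<in> carrier N" for m n
    using that by (intro free_gen_closed M.is_cring) auto
  note L = linear_mapsD[OF Q.pr_linear, folded T]
  have fl: "(\<lambda>m. f m n) \<in> linear_maps R M P" if "n \<in> carrier N" for n
    using f that unfolding bilinear_map_def by blast
  have fr: "f m \<in> linear_maps R N P" if "m \<in> carrier M" for m
    using f that unfolding bilinear_map_def by blast
  note fl = linear_mapsD[OF fl] and fr = linear_mapsD[OF fr]
  have fc: "f (fst b) (snd b) \<in> carrier P" if "b \<in> carrier M \<times> carrier N" for b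
    using fl(1) that by auto
  define G where "G u = (\<Oplus>\<^bsub>P\<^esub>b\<in>{b. u b \<noteq> \<zero>\<^bsub>R\<^esub>}. u b \<odot>\<^bsub>P\<^esub> f (fst b) (snd b))" for u
  have Gl: "G \<in> linear_maps R ?F P"
    unfolding G_def by (rule free_module_finsum(1)[OF P]) (rule fc)
  note GL = linear_mapsD[OF Gl]
  have Gg: "G (free_gen R (m, n)) = f m n" if "m \<in> carrier M" "n \<in> carrier N" for m n
    unfolding G_def using free_module_finsum(2)[where f = "\<lambda>b. f (fst b) (snd b)" and b = "(m,n)", OF P fc] that by simp
  have G0: "G \<zero>\<^bsub>?F\<^esub> = \<zero>\<^bsub>P\<^esub>"
    using GL(2)[of "\<zero>\<^bsub>?F\<^esub>" "\<zero>\<^bsub>?F\<^esub>"] GL(1)[of "\<zero>\<^bsub>?F\<^esub>"]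
    using F.M.l_zero[OF F.M.zero_closed] P.M.add.l_cancel_one'[of "G \<zero>\<^bsub>?F\<^esub>" "G \<zero>\<^bsub>?F\<^esub>"]
      F.M.zero_closed by (simp only:)
  have Gm: "G (\<ominus>\<^bsub>?F\<^esub> u) = \<ominus>\<^bsub>P\<^esub> G u" if "u \<in> carrier ?F" for u
    using GL(2)[OF F.M.a_inv_closed[OF that] that] F.M.l_neg[OF that] G0
      P.M.minus_equality[of "G (\<ominus>\<^bsub>?F\<^esub> u)" "G u"] GL(1)[OF that] GL(1)[OF F.M.a_inv_closed[OF that]]
    by (simp only:)
  have Gs: "G (u \<ominus>\<^bsub>?F\<^esub> v) = G u \<ominus>\<^bsub>P\<^esub> G v" if "u \<in> carrier ?F" "v \<in> carrier ?F" for u v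
    using that GL(2) Gm F.M.a_inv_closed by (simp only: a_minus_def)
  have pm0: "p = q" if "p \<in> carrier P" "q \<in> carrier P" "p \<ominus>\<^bsub>P\<^esub> q = \<zero>\<^bsub>P\<^esub>" for p q
    using that P.M.minus_equality[of p "\<ominus>\<^bsub>P\<^esub> q"] by (simp add: a_minus_def)
  define Ker where "Ker = {u \<in> carrier ?F. G u = \<zero>\<^bsub>P\<^esub>}"
  have Ks: "submodule Ker R ?F"
  proof (rule F.submoduleI)
    show "Ker \<subseteq> carrier ?F" by (auto simp only: Ker_def)
    show "\<zero>\<^bsub>?F\<^esub> \<in> Ker" using G0 F.M.zero_closed by (simp only: Ker_def mem_Collect_eq)
    show "\<ominus>\<^bsub>?F\<^esub> u \<in> Ker" if "u \<in> Ker" for u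
      using that Gm[of u] F.M.a_inv_closed[of u] P.M.minus_equality[OF P.M.l_zero[OF P.M.zero_closed] P.M.zero_closed P.M.zero_closed]
      by (simp only: Ker_def mem_Collect_eq)
    show "u \<oplus>\<^bsub>?F\<^esub> v \<in> Ker" if "u \<in> Ker" "v \<in> Ker" for u v
      using that GL(2)[of u v] F.add.m_closed[of u v] P.M.l_zero[OF P.M.zero_closed]
      by (simp only: Ker_def mem_Collect_eq)
    show "r \<odot>\<^bsub>?F\<^esub> u \<in> Ker" if "r \<in> carrier R" "u \<in> Ker" for r u
      using that GL(3)[of r u] F.smult_closed[of r u] P.smult_r_null[of r]
      by (simp only: Ker_def mem_Collect_eq)
  qed
  have "tensor_relations R M N \<subseteq> Ker"
  proof
    fix x assume x: "x \<in> tensor_relations R M N"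
    then have xc: "x \<in> carrier ?F" using tensor_relations_closed[OF M N] by blast
    have z: "G (u \<ominus>\<^bsub>?F\<^esub> v) = \<zero>\<^bsub>P\<^esub>" if "u \<in> carrier ?F" "v \<in> carrier ?F" "G u = G v" for u v
      using Gs[OF that(1,2)] that(3) P.M.r_neg[OF GL(1)[OF that(2)]] by (simp only: a_minus_def)
    note c = F.add.m_closed F.smult_closed d M.add.m_closed N.add.m_closed M.smult_closed
      N.smult_closed
    have "G x = \<zero>\<^bsub>P\<^esub>"
      using x unfolding tensor_relations_def Let_def
      by (elim UnE CollectE exE conjE; hypsubst; intro z)
        (simp_all only: c GL(2,3) Gg fl(2,3) fr(2,3))
    then show "x \<in> Ker" using xc by (simp add: Ker_def)
  qed
  then have KK: "?K \<subseteq> Ker" by (rule F.submodule_span_least[OF Ks])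
  define g where "g = restrict (\<lambda>X. G (SOME u. u \<in> carrier ?F \<and> X = Q.pr u)) (carrier ?T)"
  have gp: "g (Q.pr u) = G u" if u: "u \<in> carrier ?F" for u
  proof -
    let ?v = "SOME v. v \<in> carrier ?F \<and> Q.pr u = Q.pr v"
    have v: "?v \<in> carrier ?F" "Q.pr u = Q.pr ?v"
      using someI[of "\<lambda>v. v \<in> carrier ?F \<and> Q.pr u = Q.pr v" u] u by auto
    then have "u \<ominus>\<^bsub>?F\<^esub> ?v \<in> Ker" using Q.pr_eq u KK by blast
    then have "G u \<ominus>\<^bsub>P\<^esub> G ?v = \<zero>\<^bsub>P\<^esub>" using Gs u v by (simp add: Ker_def)
    then have "G u = G ?v"
      using pm0[OF GL(1)[OF u] GL(1)[OF v(1)]] by blast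
    moreover have "g (Q.pr u) = G ?v" unfolding g_def using L(1)[OF u] by simp
    ultimately show ?thesis by simp
  qed
  have Tc: "X \<in> carrier ?T \<longleftrightarrow> (\<exists>u\<in>carrier ?F. X = Q.pr u)" for X
    unfolding T by (rule Q.quot_carrier)
  have gl: "g \<in> linear_maps R ?T P"
  proof (rule linear_mapsI)
    fix X assume "X \<in> carrier ?T"
    then obtain u where u: "u \<in> carrier ?F" "X = Q.pr u" using Tc by blast
    show "g X \<in> carrier P" using u gp GL(1) by simp
    show "g (r \<odot>\<^bsub>?T\<^esub> X) = r \<odot>\<^bsub>P\<^esub> g X" if "r \<in> carrier R" for r
      using u that gp GL(3) L(3)[symmetric] F.smult_closed by (simp del: free_module_simps)
    fix Y assume "Y \<in> carrier ?T"
    then obtain v where v: "v \<in> carrier ?F" "Y = Q.pr v" using Tc by blast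
    show "g (X \<oplus>\<^bsub>?T\<^esub> Y) = g X \<oplus>\<^bsub>P\<^esub> g Y"
      using u v gp GL(2) L(2)[symmetric] F.add.m_closed by (simp del: free_module_simps)
  qed
  show ?thesis
  proof (rule ex1I[of _ g])
    show "g \<in> linear_maps R ?T P \<and> g \<in> extensional (carrier ?T) \<and>
        (\<forall>m\<in>carrier M. \<forall>n\<in>carrier N. g (tens R M N m n) = f m n)"
    proof (intro conjI ballI)
      show "g (tens R M N m n) = f m n" if "m \<in> carrier M" "n \<in> carrier N" for m n
        using gp[OF d[OF that]] Gg[OF that] by (simp only: tens)
    qed (rule gl, unfold g_def, rule restrict_extensional)
    fix g' assume g': "g' \<in> linear_maps R ?T P \<and> g' \<in> extensional (carrier ?T) \<and>
        (\<forall>m\<in>carrier M. \<forall>n\<in>carrier N. g' (tens R M N m n) = f m n)"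
    then have g'l: "g' \<in> linear_maps R ?T P" by (rule conjunct1)
    note g'L = linear_mapsD[OF g'l] and gL = linear_mapsD[OF gl]
    have eq: "g' (Q.pr u) = g (Q.pr u)" if "u \<in> carrier ?F" for u
      using M.is_cring that
    proof (induction rule: free_module_induct)
      case zero
      have "Q.pr \<zero>\<^bsub>?F\<^esub> = \<zero>\<^bsub>R\<^esub> \<odot>\<^bsub>?T\<^esub> Q.pr \<zero>\<^bsub>?F\<^esub>"
        using L(3)[of "\<zero>\<^bsub>R\<^esub>" "\<zero>\<^bsub>?F\<^esub>"] by (metis F.smult_l_null F.M.zero_closed M.R.zero_closed)
      then have hz: "h (Q.pr \<zero>\<^bsub>?F\<^esub>) = \<zero>\<^bsub>P\<^esub>" if h: "h \<in> linear_maps R ?T P" for h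
        using linear_mapsD(1,3)[OF h] L(1)[OF F.M.zero_closed] P.smult_l_null M.R.zero_closed by metis
      show ?case using hz[OF g'l] hz[OF gl] by simp
    next
      case (gen r b)
      obtain m n where b: "b = (m, n)" "m \<in> carrier M" "n \<in> carrier N" using gen by auto
      have hs: "h (Q.pr (r \<odot>\<^bsub>?F\<^esub> free_gen R b)) = r \<odot>\<^bsub>P\<^esub> h (tens R M N m n)"
        if h: "h \<in> linear_maps R ?T P" for h
        using linear_mapsD(3)[OF h] L(1,3) gen(1) b d by (simp only: tens)
      have "g (tens R M N m n) = f m n"
        unfolding tens gp[OF d[OF b(2,3)]] by (rule Gg[OF b(2,3)])
      then have "g' (tens R M N m n) = g (tens R M N m n)"
        using g' b(2,3) by metis
      then show ?case using hs[OF g'l] hs[OF gl] by (simp only:)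
    next
      case (add u v)
      show ?case
        unfolding L(2)[OF add(1,2)] g'L(2)[OF L(1)[OF add(1)] L(1)[OF add(2)]]
          gL(2)[OF L(1)[OF add(1)] L(1)[OF add(2)]] using add(3,4) by (simp only:)
    qed
    show "g' = g"
    proof (rule extensionalityI)
      show "g' \<in> extensional (carrier ?T)" by (rule conjunct1[OF conjunct2[OF g']])
      show "g \<in> extensional (carrier ?T)" unfolding g_def by (rule restrict_extensional)
      fix X assume "X \<in> carrier ?T"
      then obtain u where u: "u \<in> carrier ?F" "X = Q.pr u" unfolding Tc by (rule bexE)
      show "g' X = g X" unfolding u(2) by (rule eq[OF u(1)])
    qed
  qed
qed

lemma tensor_lift:
  assumes "module R M" "module R N" "module R P" "bilinear_map R M N P f"
  shows "tensor_lift R M N P f \<in> linear_maps R (tensor_module R M N) P"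
    and "\<lbrakk>m \<in> carrier M; n \<in> carrier N\<rbrakk> \<Longrightarrow> tensor_lift R M N P f (tens R M N m n) = f m n"
  using theI'[OF tensor_lift_universal[OF assms]] unfolding tensor_lift_def by blast+

declare free_module_simps [simp del]


section \<open>Hom-structures\<close>

record ('r, 'm) hom_object = "('r, 'm) module" +
  twist :: "'m \<Rightarrow> 'm"

abbreviation twist_inv :: "('r, 'm, 'y) hom_object_scheme \<Rightarrow> 'm \<Rightarrow> 'm" where
  "twist_inv M \<equiv> inv_into (carrier M) (twist M)"

locale hom_object = module R M for R (structure) and M (structure) +
  assumes twist_linear: "twist M \<in> linear_maps R M M"
    and twist_bij: "bij_betw (twist M) (carrier M) (carrier M)"

text \<open>The fields \<^const>\<open>mult\<close> and \<^const>\<open>one\<close> of the record are the Hom-associative multiplication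
  and its weak unit.\<close>

locale monoidal_hom_algebra = hom_object R A for R (structure) and A (structure) +
  assumes mult_bilinear: "bilinear_map R A A A (mult A)"
    and unit_closed: "\<one>\<^bsub>A\<^esub> \<in> carrier A"
    and twist_mult: "\<lbrakk>a \<in> carrier A; b \<in> carrier A\<rbrakk>
      \<Longrightarrow> twist A (a \<otimes>\<^bsub>A\<^esub> b) = twist A a \<otimes>\<^bsub>A\<^esub> twist A b"
    and twist_unit: "twist A \<one>\<^bsub>A\<^esub> = \<one>\<^bsub>A\<^esub>"
    and hom_assoc: "\<lbrakk>a \<in> carrier A; b \<in> carrier A; c \<in> carrier A\<rbrakk>
      \<Longrightarrow> twist A a \<otimes>\<^bsub>A\<^esub> (b \<otimes>\<^bsub>A\<^esub> c) = (a \<otimes>\<^bsub>A\<^esub> b) \<otimes>\<^bsub>A\<^esub> twist A c"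
    and hom_unit_right: "a \<in> carrier A \<Longrightarrow> a \<otimes>\<^bsub>A\<^esub> \<one>\<^bsub>A\<^esub> = twist A a"
    and hom_unit_left: "a \<in> carrier A \<Longrightarrow> \<one>\<^bsub>A\<^esub> \<otimes>\<^bsub>A\<^esub> a = twist A a"

record ('r, 'c) hom_coalgebra = "('r, 'c) hom_object" +
  comult :: "'c \<Rightarrow> ('r, 'c, 'c) tensor"
  counit :: "'c \<Rightarrow> 'r"

locale monoidal_hom_coalgebra = hom_object R C for R (structure) and C (structure) +
  assumes comult_linear: "comult C \<in> linear_maps R C (tensor_module R C C)"
    and counit_linear: "counit C \<in> linear_maps R C (ground_module R)"
    and comult_twist: "c \<in> carrier C \<Longrightarrow>
      comult C (twist C c) =
        sweedler R C C (tensor_module R C C) (comult C c)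
          (\<lambda>c1 c2. tens R C C (twist C c1) (twist C c2))"
    and counit_twist: "c \<in> carrier C \<Longrightarrow> counit C (twist C c) = counit C c"
    and hom_coassoc: "c \<in> carrier C \<Longrightarrow>
      (let CC = tensor_module R C C; CCC = tensor_module R C CC in
        sweedler R C C CCC (comult C c) (\<lambda>c1 c2.
          sweedler R C C CCC (comult C c2) (\<lambda>c21 c22.
            tens R C CC (twist_inv C c1) (tens R C C c21 c22))) =
        sweedler R C C CCC (comult C c) (\<lambda>c1 c2.
          sweedler R C C CCC (comult C c1) (\<lambda>c11 c12.
            tens R C CC c11 (tens R C C c12 (twist_inv C c2)))))"
    and hom_counit_left: "c \<in> carrier C \<Longrightarrow>
      sweedler R C C C (comult C c) (\<lambda>c1 c2. counit C c1 \<odot>\<^bsub>C\<^esub> c2) = twist_inv C c"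
    and hom_counit_right: "c \<in> carrier C \<Longrightarrow>
      sweedler R C C C (comult C c) (\<lambda>c1 c2. counit C c2 \<odot>\<^bsub>C\<^esub> c1) = twist_inv C c"

locale monoidal_hom_hopf_algebra =
  monoidal_hom_algebra R H + monoidal_hom_coalgebra R H for R (structure) and H (structure) +
  assumes comult_mult: "\<lbrakk>a \<in> carrier H; b \<in> carrier H\<rbrakk> \<Longrightarrow>
      (let HH = tensor_module R H H in
        comult H (a \<otimes>\<^bsub>H\<^esub> b) =
          sweedler R H H HH (comult H a) (\<lambda>a1 a2.
            sweedler R H H HH (comult H b) (\<lambda>b1 b2.
              tens R H H (a1 \<otimes>\<^bsub>H\<^esub> b1) (a2 \<otimes>\<^bsub>H\<^esub> b2))))"
    and comult_unit: "comult H \<one>\<^bsub>H\<^esub> = tens R H H \<one>\<^bsub>H\<^esub> \<one>\<^bsub>H\<^esub>"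
    and counit_mult: "\<lbrakk>a \<in> carrier H; b \<in> carrier H\<rbrakk> \<Longrightarrow>
      counit H (a \<otimes>\<^bsub>H\<^esub> b) = counit H a \<otimes>\<^bsub>R\<^esub> counit H b"
    and counit_unit: "counit H \<one>\<^bsub>H\<^esub> = \<one>\<^bsub>R\<^esub>"
    and antipode: "\<exists>S\<in>linear_maps R H H.
      (\<forall>h\<in>carrier H. S (twist H h) = twist H (S h)) \<and>
      (\<forall>h\<in>carrier H.
        sweedler R H H H (comult H h) (\<lambda>h1 h2. S h1 \<otimes>\<^bsub>H\<^esub> h2) = counit H h \<odot>\<^bsub>H\<^esub> \<one>\<^bsub>H\<^esub> \<and>
        sweedler R H H H (comult H h) (\<lambda>h1 h2. h1 \<otimes>\<^bsub>H\<^esub> S h2) = counit H h \<odot>\<^bsub>H\<^esub> \<one>\<^bsub>H\<^esub>)"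

locale right_hom_module =
  A: monoidal_hom_algebra R A + M: hom_object R M
  for R (structure) and A (structure) and M (structure) and action +
  assumes action_bilinear: "bilinear_map R M A M action"
    and twist_action: "\<lbrakk>m \<in> carrier M; a \<in> carrier A\<rbrakk> \<Longrightarrow>
      twist M (action m a) = action (twist M m) (twist A a)"
    and action_assoc: "\<lbrakk>m \<in> carrier M; a \<in> carrier A; b \<in> carrier A\<rbrakk> \<Longrightarrow>
      action (action m a) (twist A b) = action (twist M m) (a \<otimes>\<^bsub>A\<^esub> b)"
    and action_unit: "m \<in> carrier M \<Longrightarrow> action m \<one>\<^bsub>A\<^esub> = twist M m"

record ('r, 'm, 'h) hom_comodule = "('r, 'm) hom_object" +
  coact :: "'m \<Rightarrow> ('r, 'm, 'h) tensor"

locale right_hom_comodule =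
  H: monoidal_hom_hopf_algebra R H + M: hom_object R M
  for R (structure) and H (structure) and M (structure) +
  assumes coact_linear: "coact M \<in> linear_maps R M (tensor_module R M H)"
    and coact_twist: "m \<in> carrier M \<Longrightarrow>
      coact M (twist M m) =
        sweedler R M H (tensor_module R M H) (coact M m)
          (\<lambda>m0 m1. tens R M H (twist M m0) (twist H m1))"
    and coact_coassoc: "m \<in> carrier M \<Longrightarrow>
      (let HH = tensor_module R H H; MHH = tensor_module R M HH in
        sweedler R M H MHH (coact M m) (\<lambda>m0 m1.
          sweedler R M H MHH (coact M m0) (\<lambda>m00 m01.
            tens R M HH m00 (tens R H H m01 (twist_inv H m1)))) =
        sweedler R M H MHH (coact M m) (\<lambda>m0 m1.
          tens R M HH (twist_inv M m0) (comult H m1)))"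
    and coact_counit: "m \<in> carrier M \<Longrightarrow>
      sweedler R M H M (coact M m) (\<lambda>m0 m1. counit H m1 \<odot>\<^bsub>M\<^esub> m0) = twist_inv M m"

locale hom_comodule_algebra =
  right_hom_comodule R H A + A: monoidal_hom_algebra R A
  for R (structure) and H (structure) and A (structure) +
  assumes coact_mult: "\<lbrakk>a \<in> carrier A; b \<in> carrier A\<rbrakk> \<Longrightarrow>
      (let AH = tensor_module R A H in
        coact A (a \<otimes>\<^bsub>A\<^esub> b) =
          sweedler R A H AH (coact A a) (\<lambda>a0 a1.
            sweedler R A H AH (coact A b) (\<lambda>b0 b1.
              tens R A H (a0 \<otimes>\<^bsub>A\<^esub> b0) (a1 \<otimes>\<^bsub>H\<^esub> b1))))"
    and coact_unit: "coact A \<one>\<^bsub>A\<^esub> = tens R A H \<one>\<^bsub>A\<^esub> \<one>\<^bsub>H\<^esub>"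

record ('r, 'm, 'h, 'a) relative_hom_hopf = "('r, 'm, 'h) hom_comodule" +
  act :: "'m \<Rightarrow> 'a \<Rightarrow> 'm"

locale relative_hom_hopf_module =
  A: hom_comodule_algebra R H A +
  M: right_hom_comodule R H M +
  M: right_hom_module R A M "act M"
  for R (structure) and H (structure) and A (structure) and M (structure) +
  assumes coact_act: "\<lbrakk>m \<in> carrier M; a \<in> carrier A\<rbrakk> \<Longrightarrow>
      (let MH = tensor_module R M H in
        coact M (act M m a) =
          sweedler R M H MH (coact M m) (\<lambda>m0 m1.
            sweedler R A H MH (coact A a) (\<lambda>a0 a1.
              tens R M H (act M m0 a0) (m1 \<otimes>\<^bsub>H\<^esub> a1))))"


section \<open>The category of relative Hom-Hopf modules\<close>

definition relative_hom_hopf_morphisms ::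
    "('r, 'x) ring_scheme \<Rightarrow> ('r, 'h, 'y) hom_coalgebra_scheme
      \<Rightarrow> ('r, 'a, 'h, 'z) hom_comodule_scheme
      \<Rightarrow> ('r, 'm, 'h, 'a, 'w) relative_hom_hopf_scheme
      \<Rightarrow> ('r, 'n, 'h, 'a, 'v) relative_hom_hopf_scheme \<Rightarrow> ('m \<Rightarrow> 'n) set" where
  "relative_hom_hopf_morphisms R H A M N =
    {f \<in> linear_maps R M N.
      (\<forall>m\<in>carrier M. f (twist M m) = twist N (f m)) \<and>
      (\<forall>m\<in>carrier M. \<forall>a\<in>carrier A. f (act M m a) = act N (f m) a) \<and>
      (\<forall>m\<in>carrier M. coact N (f m) =
        sweedler R M H (tensor_module R N H) (coact M m) (\<lambda>m0 m1. tens R N H (f m0) m1))}"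

definition relative_hom_hopf_isomorphic ::
    "('r, 'x) ring_scheme \<Rightarrow> ('r, 'h, 'y) hom_coalgebra_scheme
      \<Rightarrow> ('r, 'a, 'h, 'z) hom_comodule_scheme
      \<Rightarrow> ('r, 'm, 'h, 'a, 'w) relative_hom_hopf_scheme
      \<Rightarrow> ('r, 'n, 'h, 'a, 'v) relative_hom_hopf_scheme \<Rightarrow> bool" where
  "relative_hom_hopf_isomorphic R H A M N \<longleftrightarrow>
    relative_hom_hopf_module R H A M \<and> relative_hom_hopf_module R H A N \<and>
    (\<exists>f\<in>relative_hom_hopf_morphisms R H A M N. \<exists>g\<in>relative_hom_hopf_morphisms R H A N M.
      (\<forall>m\<in>carrier M. g (f m) = m) \<and> (\<forall>n\<in>carrier N. f (g n) = n))"


section \<open>The two structures on the tensor product of \<open>A\<close> and \<open>H\<close>\<close>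

text \<open>As an object, the tensor product carries the tensor product of the two twists.\<close>

definition tensor_object ::
    "('r, 'x) ring_scheme \<Rightarrow> ('r, 'm, 'y) hom_object_scheme \<Rightarrow> ('r, 'n, 'z) hom_object_scheme
      \<Rightarrow> ('r, ('r, 'm, 'n) tensor) hom_object" where
  "tensor_object R M N =
    (let MN = tensor_module R M N in
      \<lparr>carrier = carrier MN, mult = mult MN, one = one MN, zero = zero MN, add = add MN,
       smult = smult MN,
       twist = (\<lambda>t. sweedler R M N MN t (\<lambda>m n. tens R M N (twist M m) (twist N n)))\<rparr>)"

definition relative_structure ::
    "('r, 'm) hom_object \<Rightarrow> ('m \<Rightarrow> ('r, 'm, 'h) tensor) \<Rightarrow> ('m \<Rightarrow> 'a \<Rightarrow> 'm)
      \<Rightarrow> ('r, 'm, 'h, 'a) relative_hom_hopf" where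
  "relative_structure M \<rho> action =
    \<lparr>carrier = carrier M, mult = mult M, one = one M, zero = zero M, add = add M,
     smult = smult M, twist = twist M, coact = \<rho>, act = action\<rparr>"

definition G_of ::
    "('r, 'x) ring_scheme \<Rightarrow> ('r, 'h, 'y) hom_coalgebra_scheme
      \<Rightarrow> ('r, 'a, 'h, 'z) hom_comodule_scheme
      \<Rightarrow> ('r, ('r, 'a, 'h) tensor, 'h, 'a) relative_hom_hopf" where
  "G_of R H A =
    (let AH = tensor_module R A H; AHH = tensor_module R AH H in
      relative_structure (tensor_object R A H)
        (\<lambda>t. sweedler R A H AHH t (\<lambda>a h.
          sweedler R H H AHH (comult H h) (\<lambda>h1 h2.
            tens R AH H (tens R A H (twist_inv A a) h1) (twist H h2))))
        (\<lambda>t b. sweedler R A H AH t (\<lambda>a h.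
          sweedler R A H AH (coact A b) (\<lambda>b0 b1.
            tens R A H (a \<otimes>\<^bsub>A\<^esub> b0) (h \<otimes>\<^bsub>H\<^esub> b1)))))"

text \<open>Unlike \<open>G_of\<close>, the following structure is not a relative Hom-Hopf module for arbitrary
  \<open>H\<close> and \<open>A\<close>: the weak unit axiom of the action forces the square of the twist of \<open>H\<close> to act
  trivially on the tensor product of \<open>A\<close> and \<open>H\<close>, and the compatibility axiom is a
  commutativity condition.\<close>

definition G_tilde_of ::
    "('r, 'x) ring_scheme \<Rightarrow> ('r, 'h, 'y) hom_coalgebra_scheme
      \<Rightarrow> ('r, 'a, 'h, 'z) hom_comodule_scheme
      \<Rightarrow> ('r, ('r, 'a, 'h) tensor, 'h, 'a) relative_hom_hopf" where
  "G_tilde_of R H A =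
    (let AH = tensor_module R A H; AHH = tensor_module R AH H in
      relative_structure (tensor_object R A H)
        (\<lambda>t. sweedler R A H AHH t (\<lambda>a h.
          sweedler R A H AHH (coact A a) (\<lambda>a0 a1.
            sweedler R H H AHH (comult H h) (\<lambda>h1 h2.
              tens R AH H (tens R A H a0 h1) (a1 \<otimes>\<^bsub>H\<^esub> h2)))))
        (\<lambda>t b. sweedler R A H AH t (\<lambda>a h.
          tens R A H (a \<otimes>\<^bsub>A\<^esub> twist A b) (twist_inv H h))))"

end

theory Submission
  imports Defs
begin

text \<open>
  In Sweedler notation the isomorphism from \<open>G_tilde_of R H A\<close> to \<open>G_of R H A\<close> is
  \<open>a \<otimes> h \<mapsto> \<beta>\<^sup>-\<^sup>1(a\<^sub>0) \<otimes> a\<^sub>1\<alpha>\<^sup>-\<^sup>1(h)\<close>, with inverse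
  \<open>a \<otimes> h \<mapsto> \<beta>\<^sup>3(a\<^sub>0) \<otimes> S(\<alpha>\<^sup>2(a\<^sub>1))\<alpha>\<^sup>-\<^sup>1(h)\<close>; bijectivity uses only the Hom-coassociativity of the
  coaction and the antipode. Linearity and colinearity rest on \<open>G_tilde_of R H A\<close> being a
  relative Hom-Hopf module: its unit axiom gives \<open>a \<otimes> \<alpha>\<^sup>2(h) = a \<otimes> h\<close>, and its
  compatibility axiom gives \<open>(b\<^sub>0 \<otimes> h\<^sub>1) \<otimes> b\<^sub>1h\<^sub>2 = (b\<^sub>0 \<otimes> h\<^sub>1) \<otimes> \<alpha>\<^sup>2(h\<^sub>2)b\<^sub>1\<close>, so that
  the map can be rewritten as \<open>a \<otimes> h \<mapsto> \<beta>\<^sup>-\<^sup>1(a\<^sub>0) \<otimes> \<alpha>(h)a\<^sub>1\<close>, which is visibly compatible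
  with the structure of \<open>G_of R H A\<close>.

  An identity of Sweedler sums is applied inside a larger expression by writing that
  expression as a multilinear map of the tensor factors.
\<close>

section \<open>Multilinear maps\<close>

lemma bilinear_mapI:
  assumes "\<And>n. n \<in> carrier N \<Longrightarrow> (\<lambda>m. f m n) \<in> linear_maps R M P"
    and "\<And>m. m \<in> carrier M \<Longrightarrow> (\<lambda>n. f m n) \<in> linear_maps R N P"
  shows "bilinear_map R M N P f"
  using assms unfolding bilinear_map_def by auto

lemma bilinear_mapD:
  assumes "bilinear_map R M N P f"
  shows "n \<in> carrier N \<Longrightarrow> (\<lambda>m. f m n) \<in> linear_maps R M P"
    and "m \<in> carrier M \<Longrightarrow> (\<lambda>n. f m n) \<in> linear_maps R N P"
    and "\<lbrakk>m \<in> carrier M; n \<in> carrier N\<rbrakk> \<Longrightarrow> f m n \<in> carrier P"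
  using assms unfolding bilinear_map_def by (auto dest: linear_mapsD(1))

lemma linear_maps_id: "(\<lambda>x. x) \<in> linear_maps R M M"
  by (auto intro: linear_mapsI)

lemma linear_maps_comp:
  assumes "g \<in> linear_maps R M N" "f \<in> linear_maps R P M"
  shows "(\<lambda>x. g (f x)) \<in> linear_maps R P N"
  using linear_mapsD[OF assms(1)] linear_mapsD[OF assms(2)] by (intro linear_mapsI) simp_all

lemma linear_maps_smult_left:
  assumes "module R M" "m \<in> carrier M" "f \<in> linear_maps R P (ground_module R)"
  shows "(\<lambda>x. f x \<odot>\<^bsub>M\<^esub> m) \<in> linear_maps R P M"
proof -
  interpret module R M by fact
  show ?thesis using linear_mapsD[OF assms(3)] assms(2)
    by (auto intro!: linear_mapsI simp: ground_module_def smult_l_distr smult_assoc1)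
qed

lemma linear_maps_smult_right:
  assumes "module R M" "r \<in> carrier R" "f \<in> linear_maps R P M"
  shows "(\<lambda>x. r \<odot>\<^bsub>M\<^esub> f x) \<in> linear_maps R P M"
proof -
  interpret module R M by fact
  show ?thesis using linear_mapsD[OF assms(3)] assms(2)
    by (auto intro!: linear_mapsI simp: smult_r_distr smult_assoc1[symmetric] m_comm)
qed

lemma linear_maps_add:
  assumes "module R M" "f \<in> linear_maps R P M" "g \<in> linear_maps R P M"
  shows "(\<lambda>x. f x \<oplus>\<^bsub>M\<^esub> g x) \<in> linear_maps R P M"
proof -
  interpret module R M by fact
  show ?thesis using linear_mapsD[OF assms(2)] linear_mapsD[OF assms(3)]
    by (auto intro!: linear_mapsI simp: smult_r_distr M.a_ac)
qed

text \<open>Sums and multiples stay in the carrier, so linearity depends only on the values there.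
  This passes from a map to its restriction.\<close>

lemma linear_maps_cong:
  assumes "module R M" "\<And>x. x \<in> carrier M \<Longrightarrow> f x = g x" "f \<in> linear_maps R M N"
  shows "g \<in> linear_maps R M N"
proof -
  interpret module R M by fact
  show ?thesis
    using linear_mapsD[OF assms(3)] assms(2)[symmetric] by (intro linear_mapsI) simp_all
qed

lemma tens_closed:
  assumes "module R M" "module R N" "m \<in> carrier M" "n \<in> carrier N"
  shows "tens R M N m n \<in> carrier (tensor_module R M N)"
  using bilinear_mapD(3)[OF tens_bilinear[OF assms(1,2)] assms(3,4)] .

lemma linear_maps_tens_left:
  assumes "module R M" "module R N" "n \<in> carrier N" "f \<in> linear_maps R P M"
  shows "(\<lambda>x. tens R M N (f x) n) \<in> linear_maps R P (tensor_module R M N)"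
  by (rule linear_maps_comp[OF bilinear_mapD(1)[OF tens_bilinear] assms(4)]) fact+

lemma linear_maps_tens_right:
  assumes "module R M" "module R N" "m \<in> carrier M" "f \<in> linear_maps R P N"
  shows "(\<lambda>x. tens R M N m (f x)) \<in> linear_maps R P (tensor_module R M N)"
  by (rule linear_maps_comp[OF bilinear_mapD(2)[OF tens_bilinear] assms(4)]) fact+

text \<open>The uniqueness half of the universal property. That property concerns extensional maps,
  so \<open>f\<close> and \<open>g\<close> are first restricted to the carrier; both restrictions
  are then the lift of the bilinear map that \<open>f\<close> induces on pure tensors. Most
  equations below are reduced to pure tensors this way.\<close>

lemma tensor_ext:
  assumes M: "module R M" and N: "module R N" and P: "module R P"
    and f: "f \<in> linear_maps R (tensor_module R M N) P"
    and g: "g \<in> linear_maps R (tensor_module R M N) P"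
    and eq: "\<And>m n. m \<in> carrier M \<Longrightarrow> n \<in> carrier N \<Longrightarrow> f (tens R M N m n) = g (tens R M N m n)"
    and t: "t \<in> carrier (tensor_module R M N)"
  shows "f t = g t"
proof -
  let ?T = "tensor_module R M N"
  interpret T: module R ?T by (rule tensor_module_module[OF M N])
  have b: "bilinear_map R M N P (\<lambda>m n. f (tens R M N m n))"
    by (rule bilinear_mapI)
      (rule linear_maps_comp[OF f bilinear_mapD(1)[OF tens_bilinear[OF M N]]]
        linear_maps_comp[OF f bilinear_mapD(2)[OF tens_bilinear[OF M N]]]; assumption)+
  have r: "restrict h (carrier ?T) \<in> linear_maps R ?T P" if "h \<in> linear_maps R ?T P" for h
    by (rule linear_maps_cong[OF T.module_axioms _ that]) simp
  \<comment> \<open>\<open>U\<close> hides the defining predicate of the lift, so that two solutions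
    are compared without unfolding it.\<close>
  define U where "U h \<longleftrightarrow> h \<in> linear_maps R ?T P \<and> h \<in> extensional (carrier ?T) \<and>
    (\<forall>m\<in>carrier M. \<forall>n\<in>carrier N. h (tens R M N m n) = f (tens R M N m n))" for h
  have U: "U (restrict h (carrier ?T))"
    if "h \<in> linear_maps R ?T P"
      and "\<And>m n. m \<in> carrier M \<Longrightarrow> n \<in> carrier N \<Longrightarrow> h (tens R M N m n) = f (tens R M N m n)" for h
    unfolding U_def using that(2) r[OF that(1)] tens_closed[OF M N] by simp
  have "\<exists>!h. U h"
    unfolding U_def by (rule tensor_lift_universal[OF M N P b])
  then have eq': "restrict f (carrier ?T) = restrict g (carrier ?T)"
    using U[OF f refl] U[OF g eq[symmetric]] by blast
  show ?thesis using t fun_cong[OF eq', of t] by simp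
qed


section \<open>Calculus of Sweedler sums\<close>

text \<open>The description behind \<open>tensor_lift\<close> mentions the bilinear map only at
  carrier elements, so the two descriptions are the same predicate.\<close>

lemma sweedler_cong:
  assumes "\<And>m n. m \<in> carrier M \<Longrightarrow> n \<in> carrier N \<Longrightarrow> F m n = G m n"
  shows "tensor_lift R M N P F = tensor_lift R M N P G"
  unfolding tensor_lift_def by (simp add: assms cong: ball_cong_simp)

lemma sweedler_eqI:
  assumes "\<And>m n. m \<in> carrier M \<Longrightarrow> n \<in> carrier N \<Longrightarrow> F m n = G m n"
  shows "sweedler R M N P t F = sweedler R M N P t G"
  by (rule fun_cong[OF sweedler_cong]) (rule assms)

lemma sweedler_tens:
  assumes "module R M" "module R N" "module R P" "m \<in> carrier M" "n \<in> carrier N"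
    "bilinear_map R M N P F"
  shows "sweedler R M N P (tens R M N m n) F = F m n"
  by (rule tensor_lift(2)) fact+

lemma sweedler_linear_maps:
  assumes "module R M" "module R N" "module R P" "f \<in> linear_maps R Q (tensor_module R M N)"
    "bilinear_map R M N P F"
  shows "(\<lambda>x. sweedler R M N P (f x) F) \<in> linear_maps R Q P"
  by (rule linear_maps_comp[OF tensor_lift(1)]) fact+

lemma sweedler_closed:
  assumes "module R M" "module R N" "module R P" "t \<in> carrier (tensor_module R M N)"
    "bilinear_map R M N P F"
  shows "sweedler R M N P t F \<in> carrier P"
  by (rule linear_mapsD(1)[OF tensor_lift(1)]) fact+

text \<open>Linearity in a parameter of the summand, complementing linearity in the tensor. For
  fixed parameters both sides of each required equation are linear in \<open>t\<close>, so
  \<open>tensor_ext\<close> reduces it to pure tensors, where it is hypothesis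
  \<open>L\<close>.\<close>

lemma linear_maps_sweedler:
  assumes M: "module R M" and N: "module R N" and P: "module R P" and Q: "module R Q"
    and t: "t \<in> carrier (tensor_module R M N)"
    and F: "\<And>x. x \<in> carrier Q \<Longrightarrow> bilinear_map R M N P (F x)"
    and L: "\<And>m n. m \<in> carrier M \<Longrightarrow> n \<in> carrier N \<Longrightarrow> (\<lambda>x. F x m n) \<in> linear_maps R Q P"
  shows "(\<lambda>x. sweedler R M N P t (F x)) \<in> linear_maps R Q P"
proof (rule linear_mapsI)
  interpret Q: module R Q by fact
  note l = tensor_lift(1)[OF M N P F] and v = tensor_lift(2)[OF M N P F]
  fix x assume x: "x \<in> carrier Q"
  show "sweedler R M N P t (F x) \<in> carrier P"
    by (rule sweedler_closed[OF M N P t F[OF x]])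
  show "sweedler R M N P t (F (x \<oplus>\<^bsub>Q\<^esub> y)) = sweedler R M N P t (F x) \<oplus>\<^bsub>P\<^esub> sweedler R M N P t (F y)"
    if y: "y \<in> carrier Q" for y
    by (rule tensor_ext[OF M N P l linear_maps_add[OF P l l] _ t])
      (simp_all add: x y v linear_mapsD(2)[OF L])
  show "sweedler R M N P t (F (r \<odot>\<^bsub>Q\<^esub> x)) = r \<odot>\<^bsub>P\<^esub> sweedler R M N P t (F x)"
    if r: "r \<in> carrier R" for r
    by (rule tensor_ext[OF M N P l linear_maps_smult_right[OF P r l] _ t])
      (simp_all add: x r v linear_mapsD(3)[OF L])
qed

lemma linear_sweedler:
  assumes M: "module R M" and N: "module R N" and P: "module R P" and Q: "module R Q"
    and L: "L \<in> linear_maps R P Q" and t: "t \<in> carrier (tensor_module R M N)"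
    and F: "bilinear_map R M N P F"
  shows "L (sweedler R M N P t F) = sweedler R M N Q t (\<lambda>m n. L (F m n))"
proof -
  have LF: "bilinear_map R M N Q (\<lambda>m n. L (F m n))"
    by (rule bilinear_mapI) (rule linear_maps_comp[OF L bilinear_mapD(1)[OF F]]
        linear_maps_comp[OF L bilinear_mapD(2)[OF F]]; assumption)+
  show ?thesis
    by (rule tensor_ext[OF M N Q linear_maps_comp[OF L tensor_lift(1)[OF M N P F]]
          tensor_lift(1)[OF M N Q LF] _ t])
      (simp add: tensor_lift(2)[OF M N P F] tensor_lift(2)[OF M N Q LF])
qed

lemma sweedler_sweedler:
  assumes M: "module R M" and N: "module R N" and M': "module R M'" and N': "module R N'"
    and P: "module R P"
    and t: "t \<in> carrier (tensor_module R M N)"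
    and F: "bilinear_map R M N (tensor_module R M' N') F"
    and G: "bilinear_map R M' N' P G"
  shows "sweedler R M' N' P (sweedler R M N (tensor_module R M' N') t F) G =
    sweedler R M N P t (\<lambda>m n. sweedler R M' N' P (F m n) G)"
  by (rule linear_sweedler[OF M N tensor_module_module[OF M' N'] P tensor_lift(1)[OF M' N' P G] t F])

lemma sweedler_tens_id:
  assumes M: "module R M" and N: "module R N" and t: "t \<in> carrier (tensor_module R M N)"
  shows "sweedler R M N (tensor_module R M N) t (tens R M N) = t"
  by (rule tensor_ext[OF M N tensor_module_module[OF M N]
        tensor_lift(1)[OF M N tensor_module_module[OF M N] tens_bilinear[OF M N]]
        linear_maps_id _ t])
    (rule tensor_lift(2)[OF M N tensor_module_module[OF M N] tens_bilinear[OF M N]])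

text \<open>Fubini for Sweedler sums. For fixed \<open>s\<close> both sides are linear in
  \<open>t\<close>, so it suffices to take \<open>t\<close> pure. The hypotheses \<open>F\<close>
  and \<open>F'\<close> together express linearity in each of the four arguments.\<close>

lemma sweedler_swap:
  assumes M: "module R M" and N: "module R N" and M': "module R M'" and N': "module R N'"
    and P: "module R P"
    and t: "t \<in> carrier (tensor_module R M N)" and s: "s \<in> carrier (tensor_module R M' N')"
    and F: "\<And>m n. m \<in> carrier M \<Longrightarrow> n \<in> carrier N \<Longrightarrow> bilinear_map R M' N' P (F m n)"
    and F': "\<And>m n. m \<in> carrier M' \<Longrightarrow> n \<in> carrier N' \<Longrightarrow> bilinear_map R M N P (\<lambda>x y. F x y m n)"
  shows "sweedler R M N P t (\<lambda>m n. sweedler R M' N' P s (F m n)) =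
    sweedler R M' N' P s (\<lambda>m' n'. sweedler R M N P t (\<lambda>m n. F m n m' n'))"
proof -
  have B: "bilinear_map R M N P (\<lambda>m n. sweedler R M' N' P s (F m n))"
  proof (rule bilinear_mapI)
    show "(\<lambda>m. sweedler R M' N' P s (F m n)) \<in> linear_maps R M P" if "n \<in> carrier N" for n
      by (rule linear_maps_sweedler[OF M' N' P M s F[OF _ that]])
        (assumption | rule bilinear_mapD(1)[OF F' that])+
    show "(\<lambda>n. sweedler R M' N' P s (F m n)) \<in> linear_maps R N P" if "m \<in> carrier M" for m
      by (rule linear_maps_sweedler[OF M' N' P N s F[OF that]])
        (assumption | rule bilinear_mapD(2)[OF F' that])+
  qed
  \<comment> \<open>The right-hand side as a function of \<open>t\<close>, the second of the two
    linear maps compared by \<open>tensor_ext\<close>.\<close>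
  have L: "(\<lambda>t. sweedler R M' N' P s (\<lambda>m' n'. sweedler R M N P t (\<lambda>m n. F m n m' n')))
      \<in> linear_maps R (tensor_module R M N) P"
  proof (rule linear_maps_sweedler[OF M' N' P tensor_module_module[OF M N] s])
    fix t assume t: "t \<in> carrier (tensor_module R M N)"
    show "bilinear_map R M' N' P (\<lambda>m' n'. sweedler R M N P t (\<lambda>m n. F m n m' n'))"
    proof (rule bilinear_mapI)
      show "(\<lambda>m'. sweedler R M N P t (\<lambda>m n. F m n m' n')) \<in> linear_maps R M' P"
        if "n' \<in> carrier N'" for n'
        by (rule linear_maps_sweedler[OF M N P M' t F'[OF _ that]])
        (assumption | rule bilinear_mapD(1)[OF F that])+
      show "(\<lambda>n'. sweedler R M N P t (\<lambda>m n. F m n m' n')) \<in> linear_maps R N' P"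
        if "m' \<in> carrier M'" for m'
        by (rule linear_maps_sweedler[OF M N P N' t F'[OF that]])
        (assumption | rule bilinear_mapD(2)[OF F that])+
    qed
  next
    fix m n assume mn: "m \<in> carrier M'" "n \<in> carrier N'"
    show "(\<lambda>t. sweedler R M N P t (\<lambda>x y. F x y m n)) \<in> linear_maps R (tensor_module R M N) P"
      by (rule tensor_lift(1)[OF M N P F'[OF mn]])
  qed
  show ?thesis
  proof (rule tensor_ext[OF M N P tensor_lift(1)[OF M N P B] L _ t])
    fix m n assume mn: "m \<in> carrier M" "n \<in> carrier N"
    have "sweedler R M' N' P s (\<lambda>m' n'. sweedler R M N P (tens R M N m n) (\<lambda>m n. F m n m' n')) =
        sweedler R M' N' P s (F m n)"
      by (rule fun_cong[OF sweedler_cong]) (rule sweedler_tens[OF M N P mn F'])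
    then show "sweedler R M N P (tens R M N m n) (\<lambda>m n. sweedler R M' N' P s (F m n)) =
        sweedler R M' N' P s (\<lambda>m' n'. sweedler R M N P (tens R M N m n) (\<lambda>m n. F m n m' n'))"
      by (simp only: sweedler_tens[OF M N P mn B])
  qed
qed

section \<open>Trilinear maps and triple tensor products\<close>

definition trilinear_map ::
    "('r, 'x) ring_scheme \<Rightarrow> ('r, 'm, 'y) module_scheme \<Rightarrow> ('r, 'n, 'z) module_scheme
      \<Rightarrow> ('r, 'q, 'v) module_scheme \<Rightarrow> ('r, 'p, 'w) module_scheme
      \<Rightarrow> ('m \<Rightarrow> 'n \<Rightarrow> 'q \<Rightarrow> 'p) \<Rightarrow> bool" where
  "trilinear_map R M N Q P F \<longleftrightarrow>
    (\<forall>m\<in>carrier M. bilinear_map R N Q P (F m)) \<and>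
    (\<forall>n\<in>carrier N. \<forall>q\<in>carrier Q. (\<lambda>m. F m n q) \<in> linear_maps R M P)"

lemma trilinear_mapI:
  assumes "\<And>n q. n \<in> carrier N \<Longrightarrow> q \<in> carrier Q \<Longrightarrow> (\<lambda>m. F m n q) \<in> linear_maps R M P"
    and "\<And>m q. m \<in> carrier M \<Longrightarrow> q \<in> carrier Q \<Longrightarrow> (\<lambda>n. F m n q) \<in> linear_maps R N P"
    and "\<And>m n. m \<in> carrier M \<Longrightarrow> n \<in> carrier N \<Longrightarrow> (\<lambda>q. F m n q) \<in> linear_maps R Q P"
  shows "trilinear_map R M N Q P F"
  using assms unfolding trilinear_map_def bilinear_map_def by blast

text \<open>The last three rules already carry a substituted linear map, so that resolution can peel
  off a composite argument. \<open>bilinear_map_comp\<close> has this form for the same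
  reason.\<close>

lemma trilinear_mapD:
  assumes "trilinear_map R M N Q P F"
  shows "m \<in> carrier M \<Longrightarrow> bilinear_map R N Q P (F m)"
    and "\<lbrakk>n \<in> carrier N; q \<in> carrier Q; f \<in> linear_maps R X M\<rbrakk>
      \<Longrightarrow> (\<lambda>x. F (f x) n q) \<in> linear_maps R X P"
    and "\<lbrakk>m \<in> carrier M; q \<in> carrier Q; g \<in> linear_maps R X N\<rbrakk>
      \<Longrightarrow> (\<lambda>x. F m (g x) q) \<in> linear_maps R X P"
    and "\<lbrakk>m \<in> carrier M; n \<in> carrier N; h \<in> linear_maps R X Q\<rbrakk>
      \<Longrightarrow> (\<lambda>x. F m n (h x)) \<in> linear_maps R X P"
proof -
  have F: "m \<in> carrier M \<Longrightarrow> bilinear_map R N Q P (F m)"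
    "\<lbrakk>n \<in> carrier N; q \<in> carrier Q\<rbrakk> \<Longrightarrow> (\<lambda>m. F m n q) \<in> linear_maps R M P" for m n q
    using assms unfolding trilinear_map_def by blast+
  show "m \<in> carrier M \<Longrightarrow> bilinear_map R N Q P (F m)"
    by (rule F)
  show "\<lbrakk>n \<in> carrier N; q \<in> carrier Q; f \<in> linear_maps R X M\<rbrakk>
      \<Longrightarrow> (\<lambda>x. F (f x) n q) \<in> linear_maps R X P"
    by (rule linear_maps_comp[OF F(2)])
  show "\<lbrakk>m \<in> carrier M; q \<in> carrier Q; g \<in> linear_maps R X N\<rbrakk>
      \<Longrightarrow> (\<lambda>x. F m (g x) q) \<in> linear_maps R X P"
    by (rule linear_maps_comp[OF bilinear_mapD(1)[OF F(1)]])
  show "\<lbrakk>m \<in> carrier M; n \<in> carrier N; h \<in> linear_maps R X Q\<rbrakk>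
      \<Longrightarrow> (\<lambda>x. F m n (h x)) \<in> linear_maps R X P"
    by (rule linear_maps_comp[OF bilinear_mapD(2)[OF F(1)]])
qed

lemma bilinear_map_comp:
  assumes "bilinear_map R M N P F"
  shows "\<lbrakk>n \<in> carrier N; f \<in> linear_maps R X M\<rbrakk> \<Longrightarrow> (\<lambda>x. F (f x) n) \<in> linear_maps R X P"
    and "\<lbrakk>m \<in> carrier M; g \<in> linear_maps R X N\<rbrakk> \<Longrightarrow> (\<lambda>x. F m (g x)) \<in> linear_maps R X P"
  using linear_maps_comp[OF bilinear_mapD(1)[OF assms]] linear_maps_comp[OF bilinear_mapD(2)[OF assms]]
  by auto

text \<open>A syntax-directed calculus. Iterating \<open>assumption | rule\<close> over these rules,
  extended by the closure and composition rules of the maps at hand, settles the linearity and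
  membership goals left by the Sweedler manipulations.\<close>

lemmas multilinear = bilinear_mapI trilinear_mapI linear_maps_id
  linear_maps_tens_left linear_maps_tens_right sweedler_linear_maps linear_maps_sweedler
  tensor_module_module tens_closed sweedler_closed
  linear_maps_smult_left linear_maps_smult_right module.smult_closed

text \<open>The lift of a trilinear map to the right-bracketed triple tensor product, which is where
  \<open>hom_coassoc\<close> and \<open>coact_coassoc\<close> are stated.\<close>

definition tensor_lift3 where
  "tensor_lift3 R M N Q P F t =
    sweedler R M (tensor_module R N Q) P t (\<lambda>m s. sweedler R N Q P s (F m))"

text \<open>The second part admits an arbitrary \<open>s\<close> instead of a pure tensor, because
  in \<open>coact_coassoc\<close> the second factor is \<open>comult H m1\<close>.\<close>

lemma tensor_lift3:
  assumes M: "module R M" and N: "module R N" and Q: "module R Q" and P: "module R P"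
    and F: "trilinear_map R M N Q P F"
  shows "tensor_lift3 R M N Q P F \<in> linear_maps R (tensor_module R M (tensor_module R N Q)) P"
    and "\<lbrakk>m \<in> carrier M; s \<in> carrier (tensor_module R N Q)\<rbrakk>
      \<Longrightarrow> tensor_lift3 R M N Q P F (tens R M (tensor_module R N Q) m s) = sweedler R N Q P s (F m)"
proof -
  note rules = multilinear trilinear_mapD[OF F] M N P Q
  have B: "bilinear_map R M (tensor_module R N Q) P (\<lambda>m s. sweedler R N Q P s (F m))"
    by (assumption | rule rules)+
  show "tensor_lift3 R M N Q P F \<in> linear_maps R (tensor_module R M (tensor_module R N Q)) P"
    unfolding tensor_lift3_def by (assumption | rule rules B)+
  show "tensor_lift3 R M N Q P F (tens R M (tensor_module R N Q) m s) = sweedler R N Q P s (F m)"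
    if "m \<in> carrier M" "s \<in> carrier (tensor_module R N Q)"
    unfolding tensor_lift3_def by (rule sweedler_tens[OF M _ P that B]) (assumption | rule rules)+
qed

text \<open>Change of variables along the tensor product of \<open>f\<close> and \<open>g\<close>.
  The twist axioms of comultiplication and coaction have right-hand sides of this shape.\<close>

lemma sweedler_sweedler_tens:
  assumes M: "module R M" and N: "module R N" and M': "module R M'" and N': "module R N'"
    and P: "module R P" and t: "t \<in> carrier (tensor_module R M N)"
    and f: "f \<in> linear_maps R M M'" and g: "g \<in> linear_maps R N N'"
    and F: "bilinear_map R M' N' P F"
  shows "sweedler R M' N' P
      (sweedler R M N (tensor_module R M' N') t (\<lambda>m n. tens R M' N' (f m) (g n))) F =
    sweedler R M N P t (\<lambda>m n. F (f m) (g n))"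
proof -
  note rules = multilinear linear_maps_comp[OF f] linear_maps_comp[OF g] bilinear_map_comp[OF F]
    linear_mapsD(1)[OF f] linear_mapsD(1)[OF g] M N M' N' P
  have "sweedler R M' N' P
      (sweedler R M N (tensor_module R M' N') t (\<lambda>m n. tens R M' N' (f m) (g n))) F =
    sweedler R M N P t (\<lambda>m n. sweedler R M' N' P (tens R M' N' (f m) (g n)) F)"
    by (rule sweedler_sweedler[OF M N M' N' P t _ F]) (assumption | rule rules)+
  also have "\<dots> = sweedler R M N P t (\<lambda>m n. F (f m) (g n))"
    by (rule sweedler_eqI, rule sweedler_tens[OF M' N' P _ _ F]) (assumption | rule rules)+
  finally show ?thesis .
qed


section \<open>Sweedler calculus for Hom-structures\<close>

context hom_object
begin

lemma twist_closed: "x \<in> carrier M \<Longrightarrow> twist M x \<in> carrier M"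
  by (rule linear_mapsD(1)[OF twist_linear])

lemma twist_inv_closed: "x \<in> carrier M \<Longrightarrow> twist_inv M x \<in> carrier M"
  using twist_bij by (metis bij_betw_imp_surj_on inv_into_into)

lemma twist_twist_inv: "x \<in> carrier M \<Longrightarrow> twist M (twist_inv M x) = x"
  using twist_bij by (metis bij_betw_inv_into_right)

lemma twist_inv_twist: "x \<in> carrier M \<Longrightarrow> twist_inv M (twist M x) = x"
  using twist_bij by (metis bij_betw_inv_into_left)

lemma twist_inv_eqI: "\<lbrakk>y \<in> carrier M; twist M y = x\<rbrakk> \<Longrightarrow> twist_inv M x = y"
  using twist_inv_twist by blast

lemma twist_inv_linear: "twist_inv M \<in> linear_maps R M M"
  by (rule linear_mapsI)
    (auto intro!: twist_inv_eqI
      simp: twist_inv_closed twist_twist_inv linear_mapsD(2,3)[OF twist_linear])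

lemmas twist_rules = twist_closed twist_inv_closed
  linear_maps_comp[OF twist_linear] linear_maps_comp[OF twist_inv_linear]

lemmas twist_simps = twist_closed twist_inv_closed twist_twist_inv twist_inv_twist

end

context monoidal_hom_algebra
begin

lemma mult_closed: "\<lbrakk>a \<in> carrier A; b \<in> carrier A\<rbrakk> \<Longrightarrow> a \<otimes>\<^bsub>A\<^esub> b \<in> carrier A"
  by (rule bilinear_mapD(3)[OF mult_bilinear])

lemmas mult_rules = mult_closed unit_closed bilinear_map_comp[OF mult_bilinear]

lemma twist_inv_mult:
  "\<lbrakk>a \<in> carrier A; b \<in> carrier A\<rbrakk>
    \<Longrightarrow> twist_inv A (a \<otimes>\<^bsub>A\<^esub> b) = twist_inv A a \<otimes>\<^bsub>A\<^esub> twist_inv A b"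
  by (rule twist_inv_eqI) (simp_all add: mult_closed twist_simps twist_mult)

lemma twist_inv_unit: "twist_inv A \<one>\<^bsub>A\<^esub> = \<one>\<^bsub>A\<^esub>"
  by (rule twist_inv_eqI) (simp_all add: unit_closed twist_unit)

text \<open>Hom-associativity as a rule that rebrackets to the left when the first factor carries no
  twist.\<close>

lemma hom_assoc_left:
  "\<lbrakk>a \<in> carrier A; b \<in> carrier A; c \<in> carrier A\<rbrakk>
    \<Longrightarrow> a \<otimes>\<^bsub>A\<^esub> (b \<otimes>\<^bsub>A\<^esub> c) = (twist_inv A a \<otimes>\<^bsub>A\<^esub> b) \<otimes>\<^bsub>A\<^esub> twist A c"
  using hom_assoc[of "twist_inv A a" b c] by (simp add: twist_simps)

lemmas mult_simps = twist_simps mult_closed unit_closed twist_mult twist_unit twist_inv_mult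
  twist_inv_unit hom_unit_left hom_unit_right

end

context monoidal_hom_coalgebra
begin

abbreviation comult_sum where
  "comult_sum P c F \<equiv> sweedler R C C P (comult C c) F"

lemma comult_closed: "c \<in> carrier C \<Longrightarrow> comult C c \<in> carrier (tensor_module R C C)"
  by (rule linear_mapsD(1)[OF comult_linear])

lemma counit_closed: "c \<in> carrier C \<Longrightarrow> counit C c \<in> carrier R"
  using linear_mapsD(1)[OF counit_linear] by (simp add: ground_module_def)

lemmas comult_rules = comult_closed counit_closed
  linear_maps_comp[OF comult_linear] linear_maps_comp[OF counit_linear] module_axioms

lemma comult_sum_twist:
  assumes "module R P" "bilinear_map R C C P F" "c \<in> carrier C"
  shows "comult_sum P (twist C c) F = comult_sum P c (\<lambda>x y. F (twist C x) (twist C y))"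
  unfolding comult_twist[OF assms(3)]
  by (rule sweedler_sweedler_tens)
    (rule assms twist_linear module_axioms comult_closed)+

text \<open>The axiom is an equation in the triple tensor product. Applying the lift of
  \<open>F\<close> to both sides makes it usable inside a larger expression.\<close>

lemma comult_sum_coassoc:
  assumes P: "module R P" and F: "trilinear_map R C C C P F" and c: "c \<in> carrier C"
  shows "comult_sum P c (\<lambda>c1 c2. comult_sum P c2 (\<lambda>x y. F (twist_inv C c1) x y)) =
    comult_sum P c (\<lambda>c1 c2. comult_sum P c1 (\<lambda>x y. F x y (twist_inv C c2)))"
proof -
  note C = module_axioms
  let ?CC = "tensor_module R C C"
  let ?CCC = "tensor_module R C ?CC"
  let ?L = "tensor_lift3 R C C C P F"
  note L = tensor_lift3[OF C C C P F]
  note rules = multilinear twist_rules comult_rules trilinear_mapD[OF F] P c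
  \<comment> \<open>Pushes \<open>?L\<close> through both sums at once. The function
    \<open>d\<close> selects the leg that is comultiplied again, so one computation serves both
    sides of the axiom.\<close>
  have step: "?L (comult_sum ?CCC c (\<lambda>c1 c2. comult_sum ?CCC (d c1 c2) (G c1 c2))) =
      comult_sum P c (\<lambda>c1 c2. comult_sum P (d c1 c2) (\<lambda>x y. ?L (G c1 c2 x y)))"
    if d: "\<And>x y. x \<in> carrier C \<Longrightarrow> y \<in> carrier C \<Longrightarrow> d x y \<in> carrier C"
      and G: "\<And>x y. x \<in> carrier C \<Longrightarrow> y \<in> carrier C \<Longrightarrow> bilinear_map R C C ?CCC (G x y)"
      and B: "bilinear_map R C C ?CCC (\<lambda>c1 c2. comult_sum ?CCC (d c1 c2) (G c1 c2))" for d G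
  proof -
    have "?L (comult_sum ?CCC c (\<lambda>c1 c2. comult_sum ?CCC (d c1 c2) (G c1 c2))) =
        comult_sum P c (\<lambda>c1 c2. ?L (comult_sum ?CCC (d c1 c2) (G c1 c2)))"
      by (rule linear_sweedler[OF C C _ P L(1) _ B]) (assumption | rule rules)+
    also have "\<dots> = comult_sum P c (\<lambda>c1 c2. comult_sum P (d c1 c2) (\<lambda>x y. ?L (G c1 c2 x y)))"
      by (rule sweedler_eqI, rule linear_sweedler[OF C C _ P L(1) _ G]) (assumption | rule rules d)+
    finally show ?thesis .
  qed
  have "comult_sum P c (\<lambda>c1 c2. comult_sum P c2 (\<lambda>x y. F (twist_inv C c1) x y)) =
      comult_sum P c (\<lambda>c1 c2. comult_sum P c2 (\<lambda>x y.
        ?L (tens R C ?CC (twist_inv C c1) (tens R C C x y))))"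
    by (intro sweedler_eqI) (simp add: L(2) C twist_simps tens_closed sweedler_tens P trilinear_mapD(1)[OF F])
  also have "\<dots> = ?L (comult_sum ?CCC c (\<lambda>c1 c2. comult_sum ?CCC c2 (\<lambda>x y.
        tens R C ?CC (twist_inv C c1) (tens R C C x y))))"
    by (rule step[symmetric]) (assumption | rule rules)+
  also have "\<dots> = ?L (comult_sum ?CCC c (\<lambda>c1 c2. comult_sum ?CCC c1 (\<lambda>x y.
        tens R C ?CC x (tens R C C y (twist_inv C c2)))))"
    using hom_coassoc[OF c] by (simp only: Let_def)
  also have "\<dots> = comult_sum P c (\<lambda>c1 c2. comult_sum P c1 (\<lambda>x y.
        ?L (tens R C ?CC x (tens R C C y (twist_inv C c2)))))"
    by (rule step) (assumption | rule rules)+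
  also have "\<dots> = comult_sum P c (\<lambda>c1 c2. comult_sum P c1 (\<lambda>x y. F x y (twist_inv C c2)))"
    by (intro sweedler_eqI) (simp add: L(2) C twist_simps tens_closed sweedler_tens P trilinear_mapD(1)[OF F])
  finally show ?thesis .
qed

text \<open>The counit axiom with a linear \<open>F\<close> pulled into the sum, where the scalar
  acts in the target of \<open>F\<close>.\<close>

lemma comult_sum_counit_left:
  assumes P: "module R P" and F: "F \<in> linear_maps R C P" and c: "c \<in> carrier C"
  shows "comult_sum P c (\<lambda>x y. counit C x \<odot>\<^bsub>P\<^esub> F y) = F (twist_inv C c)"
proof -
  note rules = multilinear comult_rules P c
  have "F (twist_inv C c) = comult_sum P c (\<lambda>x y. F (counit C x \<odot>\<^bsub>C\<^esub> y))"
    unfolding hom_counit_left[OF c, symmetric]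
    by (rule linear_sweedler[OF module_axioms module_axioms module_axioms P F]) (assumption | rule rules)+
  also have "\<dots> = comult_sum P c (\<lambda>x y. counit C x \<odot>\<^bsub>P\<^esub> F y)"
    by (rule sweedler_eqI) (simp add: linear_mapsD(3)[OF F] counit_closed)
  finally show ?thesis ..
qed

lemma comult_sum_counit_right:
  assumes P: "module R P" and F: "F \<in> linear_maps R C P" and c: "c \<in> carrier C"
  shows "comult_sum P c (\<lambda>x y. counit C y \<odot>\<^bsub>P\<^esub> F x) = F (twist_inv C c)"
proof -
  note rules = multilinear comult_rules P c
  have "F (twist_inv C c) = comult_sum P c (\<lambda>x y. F (counit C y \<odot>\<^bsub>C\<^esub> x))"
    unfolding hom_counit_right[OF c, symmetric]
    by (rule linear_sweedler[OF module_axioms module_axioms module_axioms P F]) (assumption | rule rules)+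
  also have "\<dots> = comult_sum P c (\<lambda>x y. counit C y \<odot>\<^bsub>P\<^esub> F x)"
    by (rule sweedler_eqI) (simp add: linear_mapsD(3)[OF F] counit_closed)
  finally show ?thesis ..
qed

end

text \<open>The axiom \<open>antipode\<close> only asserts existence. Choosing a solution gives the
  antipode a name that the inverse of the isomorphism can refer to.\<close>

definition hom_antipode ::
    "('r, 'x) ring_scheme \<Rightarrow> ('r, 'h, 'y) hom_coalgebra_scheme \<Rightarrow> 'h \<Rightarrow> 'h" where
  "hom_antipode R H = (SOME S. S \<in> linear_maps R H H \<and>
    (\<forall>h\<in>carrier H. S (twist H h) = twist H (S h)) \<and>
    (\<forall>h\<in>carrier H.
      sweedler R H H H (comult H h) (\<lambda>h1 h2. S h1 \<otimes>\<^bsub>H\<^esub> h2) = counit H h \<odot>\<^bsub>H\<^esub> \<one>\<^bsub>H\<^esub> \<and>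
      sweedler R H H H (comult H h) (\<lambda>h1 h2. h1 \<otimes>\<^bsub>H\<^esub> S h2) = counit H h \<odot>\<^bsub>H\<^esub> \<one>\<^bsub>H\<^esub>))"

context monoidal_hom_hopf_algebra
begin

abbreviation S where "S \<equiv> hom_antipode R H"

lemma hom_antipode:
  shows S_linear: "S \<in> linear_maps R H H"
    and S_twist: "h \<in> carrier H \<Longrightarrow> S (twist H h) = twist H (S h)"
    and S_left: "h \<in> carrier H \<Longrightarrow> comult_sum H h (\<lambda>x y. S x \<otimes>\<^bsub>H\<^esub> y) = counit H h \<odot>\<^bsub>H\<^esub> \<one>\<^bsub>H\<^esub>"
    and S_right: "h \<in> carrier H \<Longrightarrow> comult_sum H h (\<lambda>x y. x \<otimes>\<^bsub>H\<^esub> S y) = counit H h \<odot>\<^bsub>H\<^esub> \<one>\<^bsub>H\<^esub>"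
  using someI_ex[OF antipode[unfolded Bex_def]] unfolding hom_antipode_def[symmetric] by blast+

lemma S_closed: "h \<in> carrier H \<Longrightarrow> S h \<in> carrier H"
  by (rule linear_mapsD(1)[OF S_linear])

lemma S_twist_inv: "h \<in> carrier H \<Longrightarrow> S (twist_inv H h) = twist_inv H (S h)"
  using S_twist[of "twist_inv H h"] by (intro twist_inv_eqI[symmetric]) (simp_all add: twist_simps S_closed)

lemmas hopf_rules = twist_rules mult_rules comult_rules S_closed linear_maps_comp[OF S_linear]

lemmas hopf_simps = mult_simps S_closed S_twist S_twist_inv

lemma comult_sum_mult:
  assumes P: "module R P" and F: "bilinear_map R H H P F" and a: "a \<in> carrier H" and b: "b \<in> carrier H"
  shows "comult_sum P (a \<otimes>\<^bsub>H\<^esub> b) F =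
    comult_sum P a (\<lambda>a1 a2. comult_sum P b (\<lambda>b1 b2. F (a1 \<otimes>\<^bsub>H\<^esub> b1) (a2 \<otimes>\<^bsub>H\<^esub> b2)))"
proof -
  note H = module_axioms
  let ?HH = "tensor_module R H H"
  note rules = multilinear hopf_rules bilinear_map_comp[OF F] P a b
  have "comult_sum P (a \<otimes>\<^bsub>H\<^esub> b) F =
      comult_sum P a (\<lambda>a1 a2. sweedler R H H P (comult_sum ?HH b (\<lambda>b1 b2. 
        tens R H H (a1 \<otimes>\<^bsub>H\<^esub> b1) (a2 \<otimes>\<^bsub>H\<^esub> b2))) F)"
    unfolding comult_mult[OF a b, unfolded Let_def]
    by (rule sweedler_sweedler[OF H H H H P _ _ F]) (assumption | rule rules)+
  also have "\<dots> = comult_sum P a (\<lambda>a1 a2. comult_sum P b (\<lambda>b1 b2. F (a1 \<otimes>\<^bsub>H\<^esub> b1) (a2 \<otimes>\<^bsub>H\<^esub> b2)))"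
    by (rule sweedler_eqI, rule sweedler_sweedler_tens[OF H H H H P _ _ _ F]) (assumption | rule rules)+
  finally show ?thesis .
qed

text \<open>The antipode identity under a linear \<open>F\<close>, which in the application
  multiplies the product further and places it in a tensor factor.\<close>

lemma comult_sum_S_left:
  assumes P: "module R P" and F: "F \<in> linear_maps R H P" and h: "h \<in> carrier H"
  shows "comult_sum P h (\<lambda>x y. F (S x \<otimes>\<^bsub>H\<^esub> y)) = counit H h \<odot>\<^bsub>P\<^esub> F \<one>\<^bsub>H\<^esub>"
proof -
  have "comult_sum P h (\<lambda>x y. F (S x \<otimes>\<^bsub>H\<^esub> y)) = F (comult_sum H h (\<lambda>x y. S x \<otimes>\<^bsub>H\<^esub> y))"
    by (rule linear_sweedler[OF module_axioms module_axioms module_axioms P F, symmetric])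
      (assumption | rule multilinear hopf_rules h)+
  then show ?thesis
    by (simp add: S_left h linear_mapsD(3)[OF F] counit_closed unit_closed)
qed

lemma comult_sum_S_right:
  assumes P: "module R P" and F: "F \<in> linear_maps R H P" and h: "h \<in> carrier H"
  shows "comult_sum P h (\<lambda>x y. F (x \<otimes>\<^bsub>H\<^esub> S y)) = counit H h \<odot>\<^bsub>P\<^esub> F \<one>\<^bsub>H\<^esub>"
proof -
  have "comult_sum P h (\<lambda>x y. F (x \<otimes>\<^bsub>H\<^esub> S y)) = F (comult_sum H h (\<lambda>x y. x \<otimes>\<^bsub>H\<^esub> S y))"
    by (rule linear_sweedler[OF module_axioms module_axioms module_axioms P F, symmetric])
      (assumption | rule multilinear hopf_rules h)+
  then show ?thesis
    by (simp add: S_right h linear_mapsD(3)[OF F] counit_closed unit_closed)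
qed

end

context right_hom_comodule
begin

abbreviation coact_sum where
  "coact_sum P m F \<equiv> sweedler R M H P (coact M m) F"

lemma coact_closed: "m \<in> carrier M \<Longrightarrow> coact M m \<in> carrier (tensor_module R M H)"
  by (rule linear_mapsD(1)[OF coact_linear])

lemmas coact_rules = coact_closed linear_maps_comp[OF coact_linear] M.module_axioms M.twist_rules
  H.hopf_rules

lemma coact_sum_twist:
  assumes "module R P" "bilinear_map R M H P F" "m \<in> carrier M"
  shows "coact_sum P (twist M m) F = coact_sum P m (\<lambda>x y. F (twist M x) (twist H y))"
  unfolding coact_twist[OF assms(3)]
  by (rule sweedler_sweedler_tens)
    (rule assms M.twist_linear H.twist_linear M.module_axioms H.module_axioms coact_closed)+

text \<open>The axiom concerns \<open>twist M\<close>; the inverse is reached by writing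
  \<open>m\<close> as \<open>twist M (twist_inv M m)\<close>.\<close>

lemma coact_sum_twist_inv:
  assumes P: "module R P" and F: "bilinear_map R M H P F" and m: "m \<in> carrier M"
  shows "coact_sum P (twist_inv M m) F = coact_sum P m (\<lambda>x y. F (twist_inv M x) (twist_inv H y))"
proof -
  note rules = multilinear coact_rules bilinear_map_comp[OF F] P m
  have "coact_sum P m (\<lambda>x y. F (twist_inv M x) (twist_inv H y)) =
      coact_sum P (twist M (twist_inv M m)) (\<lambda>x y. F (twist_inv M x) (twist_inv H y))"
    using m by (simp add: M.twist_simps)
  also have "\<dots> = coact_sum P (twist_inv M m)
      (\<lambda>x y. F (twist_inv M (twist M x)) (twist_inv H (twist H y)))"
    by (rule coact_sum_twist) (assumption | rule rules)+
  also have "\<dots> = coact_sum P (twist_inv M m) F"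
    by (rule sweedler_eqI) (simp add: M.twist_simps H.twist_simps)
  finally show ?thesis ..
qed

text \<open>Obtained from the axiom as \<open>comult_sum_coassoc\<close> is. From left to right it
  turns an iterated coaction into a comultiplication of \<open>m1\<close>, to which antipode
  identities apply; from right to left it trades a comultiplication of \<open>m1\<close> for a
  coaction on \<open>m0\<close>.\<close>

lemma coact_sum_coassoc:
  assumes P: "module R P" and F: "trilinear_map R M H H P F" and m: "m \<in> carrier M"
  shows "coact_sum P m (\<lambda>m0 m1. coact_sum P m0 (\<lambda>x y. F x y (twist_inv H m1))) =
    coact_sum P m (\<lambda>m0 m1. H.comult_sum P m1 (\<lambda>x y. F (twist_inv M m0) x y))"
proof -
  note M = M.module_axioms and H = H.module_axioms
  let ?HH = "tensor_module R H H"
  let ?MHH = "tensor_module R M ?HH"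
  let ?L = "tensor_lift3 R M H H P F"
  note L = tensor_lift3[OF M H H P F]
  note rules = multilinear coact_rules trilinear_mapD[OF F] P m
  have "coact_sum P m (\<lambda>m0 m1. coact_sum P m0 (\<lambda>x y. F x y (twist_inv H m1))) =
      coact_sum P m (\<lambda>m0 m1. coact_sum P m0 (\<lambda>x y.
        ?L (tens R M ?HH x (tens R H H y (twist_inv H m1)))))"
    by (intro sweedler_eqI)
      (simp add: L(2) M H H.twist_simps tens_closed sweedler_tens P trilinear_mapD(1)[OF F])
  also have "\<dots> = coact_sum P m (\<lambda>m0 m1. ?L (coact_sum ?MHH m0 (\<lambda>x y.
        tens R M ?HH x (tens R H H y (twist_inv H m1)))))"
    by (rule sweedler_eqI, rule linear_sweedler[OF M H _ P L(1), symmetric])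
      (assumption | rule rules)+
  also have "\<dots> = ?L (coact_sum ?MHH m (\<lambda>m0 m1. coact_sum ?MHH m0 (\<lambda>x y.
        tens R M ?HH x (tens R H H y (twist_inv H m1)))))"
    by (rule linear_sweedler[OF M H _ P L(1), symmetric]) (assumption | rule rules)+
  also have "\<dots> = ?L (coact_sum ?MHH m (\<lambda>m0 m1. tens R M ?HH (twist_inv M m0) (comult H m1)))"
    using coact_coassoc[OF m] by (simp only: Let_def)
  also have "\<dots> = coact_sum P m (\<lambda>m0 m1. ?L (tens R M ?HH (twist_inv M m0) (comult H m1)))"
    by (rule linear_sweedler[OF M H _ P L(1)]) (assumption | rule rules)+
  also have "\<dots> = coact_sum P m (\<lambda>m0 m1. H.comult_sum P m1 (\<lambda>x y. F (twist_inv M m0) x y))"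
    by (rule sweedler_eqI) (simp add: L(2) M.twist_simps H.comult_closed)
  finally show ?thesis .
qed

lemma coact_sum_counit:
  assumes P: "module R P" and F: "F \<in> linear_maps R M P" and m: "m \<in> carrier M"
  shows "coact_sum P m (\<lambda>x y. counit H y \<odot>\<^bsub>P\<^esub> F x) = F (twist_inv M m)"
proof -
  note rules = multilinear coact_rules P m
  have "F (twist_inv M m) = coact_sum P m (\<lambda>x y. F (counit H y \<odot>\<^bsub>M\<^esub> x))"
    unfolding coact_counit[OF m, symmetric]
    by (rule linear_sweedler[OF M.module_axioms H.module_axioms M.module_axioms P F])
      (assumption | rule rules)+
  also have "\<dots> = coact_sum P m (\<lambda>x y. counit H y \<odot>\<^bsub>P\<^esub> F x)"
    by (rule sweedler_eqI) (simp add: linear_mapsD(3)[OF F] H.counit_closed)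
  finally show ?thesis ..
qed

end

context hom_comodule_algebra
begin

lemma coact_sum_mult:
  assumes P: "module R P" and F: "bilinear_map R A H P F" and a: "a \<in> carrier A" and b: "b \<in> carrier A"
  shows "coact_sum P (a \<otimes>\<^bsub>A\<^esub> b) F =
    coact_sum P a (\<lambda>a0 a1. coact_sum P b (\<lambda>b0 b1. F (a0 \<otimes>\<^bsub>A\<^esub> b0) (a1 \<otimes>\<^bsub>H\<^esub> b1)))"
proof -
  note A = M.module_axioms and H = H.module_axioms
  let ?AH = "tensor_module R A H"
  note rules = multilinear coact_rules A.mult_rules bilinear_map_comp[OF F] P a b
  have "coact_sum P (a \<otimes>\<^bsub>A\<^esub> b) F =
      coact_sum P a (\<lambda>a0 a1. sweedler R A H P (coact_sum ?AH b (\<lambda>b0 b1. 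
        tens R A H (a0 \<otimes>\<^bsub>A\<^esub> b0) (a1 \<otimes>\<^bsub>H\<^esub> b1))) F)"
    unfolding coact_mult[OF a b, unfolded Let_def]
    by (rule sweedler_sweedler[OF A H A H P _ _ F]) (assumption | rule rules)+
  also have "\<dots> = coact_sum P a (\<lambda>a0 a1. coact_sum P b (\<lambda>b0 b1. F (a0 \<otimes>\<^bsub>A\<^esub> b0) (a1 \<otimes>\<^bsub>H\<^esub> b1)))"
    by (rule sweedler_eqI, rule sweedler_sweedler_tens[OF A H A H P _ _ _ F]) (assumption | rule rules)+
  finally show ?thesis .
qed

lemma coact_sum_unit:
  assumes P: "module R P" and F: "bilinear_map R A H P F"
  shows "coact_sum P \<one>\<^bsub>A\<^esub> F = F \<one>\<^bsub>A\<^esub> \<one>\<^bsub>H\<^esub>"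
  unfolding coact_unit
  by (rule sweedler_tens[OF M.module_axioms H.module_axioms P A.unit_closed H.unit_closed F])

end

section \<open>Modules with the same linear structure\<close>

text \<open>The records \<open>tensor_object\<close>, \<open>G_of\<close> and
  \<open>G_tilde_of\<close> add fields to a tensor module. Modules, linear maps and tensor products
  read at most the four linear fields, so facts transfer between these records.\<close>

lemma module_sameI:
  assumes eq: "carrier X = carrier M" "zero X = zero M" "add X = add M" "smult X = smult M"
    and M: "module R M"
  shows "module R X"
proof -
  interpret module R M by fact
  have ag: "abelian_group X"
    by (rule abelian_groupI) (auto simp: eq M.a_ac intro: M.l_neg M.a_inv_closed)
  show ?thesis
    by (rule moduleI[OF is_cring ag]) (simp_all add: eq smult_l_distr smult_r_distr smult_assoc1)
qed

lemma module_same: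
  assumes "carrier X = carrier M" "zero X = zero M" "add X = add M" "smult X = smult M"
  shows "module R X \<longleftrightarrow> module R M"
  using module_sameI[OF assms] module_sameI[OF assms[symmetric]] by blast

lemma linear_maps_same:
  assumes "carrier X = carrier M" "add X = add M" "smult X = smult M"
  shows "linear_maps R X P = linear_maps R M P" "linear_maps R P X = linear_maps R P M"
  using assms by (simp_all add: linear_maps_def)

text \<open>Only the left factor changes its record below, since a coaction on such a record has
  \<open>H\<close> on the right.\<close>

lemma tensor_same_left:
  assumes "carrier X = carrier M" "add X = add M" "smult X = smult M"
  shows "tensor_module R X N = tensor_module R M N"
    and "tens R X N = tens R M N"
    and "tensor_lift R X N P = tensor_lift R M N P"
proof -
  have rel: "tensor_relations R X N = tensor_relations R M N"
    using assms by (simp add: tensor_relations_def)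
  show T: "tensor_module R X N = tensor_module R M N"
    using assms by (simp add: tensor_module_def rel)
  show t: "tens R X N = tens R M N"
    using assms by (intro ext) (simp add: tens_def rel)
  show "tensor_lift R X N P = tensor_lift R M N P"
    using assms by (intro ext) (simp add: tensor_lift_def T t)
qed

lemma tensor_lift_same_target:
  assumes "carrier X = carrier P" "add X = add P" "smult X = smult P"
  shows "tensor_lift R M N X = tensor_lift R M N P"
  by (intro ext) (simp add: tensor_lift_def linear_maps_same(2)[OF assms])


section \<open>Tensor products of Hom-objects\<close>

lemma tensor_object_simps:
  "carrier (tensor_object R M N) = carrier (tensor_module R M N)"
  "zero (tensor_object R M N) = zero (tensor_module R M N)"
  "add (tensor_object R M N) = add (tensor_module R M N)"
  "smult (tensor_object R M N) = smult (tensor_module R M N)"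
  by (simp_all add: tensor_object_def Let_def)

abbreviation tensor_twist where
  "tensor_twist R M N \<equiv> twist (tensor_object R M N)"

text \<open>The inverse is taken on the carrier of \<open>tensor_module\<close>, the form into which
  \<open>G_of_simps\<close> and \<open>G_tilde_of_simps\<close> rewrite \<open>twist_inv\<close> of
  those records.\<close>

abbreviation tensor_twist_inv where
  "tensor_twist_inv R M N \<equiv> inv_into (carrier (tensor_module R M N)) (tensor_twist R M N)"

lemma tensor_twist_linear:
  assumes "hom_object R M" "hom_object R N"
  shows "tensor_twist R M N \<in> linear_maps R (tensor_module R M N) (tensor_module R M N)"
    and "\<lbrakk>m \<in> carrier M; n \<in> carrier N\<rbrakk>
      \<Longrightarrow> tensor_twist R M N (tens R M N m n) = tens R M N (twist M m) (twist N n)"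
proof -
  interpret M: hom_object R M by fact
  interpret N: hom_object R N by fact
  note rules = multilinear M.module_axioms N.module_axioms M.twist_rules N.twist_rules
  have tw: "tensor_twist R M N = (\<lambda>t. sweedler R M N (tensor_module R M N) t
      (\<lambda>m n. tens R M N (twist M m) (twist N n)))"
    by (simp add: tensor_object_def Let_def)
  show "tensor_twist R M N \<in> linear_maps R (tensor_module R M N) (tensor_module R M N)"
    unfolding tw by (assumption | rule rules)+
  show "\<lbrakk>m \<in> carrier M; n \<in> carrier N\<rbrakk>
      \<Longrightarrow> tensor_twist R M N (tens R M N m n) = tens R M N (twist M m) (twist N n)"
    unfolding tw by (rule sweedler_tens) (assumption | rule rules)+
qed

text \<open>The twist is bijective because the tensor product \<open>g\<close> of the two inverse
  twists is a two-sided inverse, as is checked on pure tensors.\<close>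

lemma tensor_object_hom_object:
  assumes "hom_object R M" "hom_object R N"
  shows "hom_object R (tensor_object R M N)"
proof -
  interpret M: hom_object R M by fact
  interpret N: hom_object R N by fact
  let ?T = "tensor_module R M N"
  interpret T: module R ?T by (rule tensor_module_module) (rule M.module_axioms N.module_axioms)+
  note rules = multilinear M.module_axioms N.module_axioms M.twist_rules N.twist_rules
  note tw = tensor_twist_linear[OF assms]
  define g where "g t = sweedler R M N ?T t (\<lambda>m n. tens R M N (twist_inv M m) (twist_inv N n))" for t
  have g: "g \<in> linear_maps R ?T ?T"
    unfolding g_def[abs_def] by (assumption | rule rules)+
  have gt: "g (tens R M N m n) = tens R M N (twist_inv M m) (twist_inv N n)"
    if "m \<in> carrier M" "n \<in> carrier N" for m n
    unfolding g_def by (rule sweedler_tens) (assumption | rule rules that)+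
  have 1: "g (tensor_twist R M N t) = t" if "t \<in> carrier ?T" for t
    by (rule tensor_ext[OF M.module_axioms N.module_axioms T.module_axioms
          linear_maps_comp[OF g tw(1)] linear_maps_id _ that])
      (simp add: tw(2) gt M.twist_simps N.twist_simps)
  have 2: "tensor_twist R M N (g t) = t" if "t \<in> carrier ?T" for t
    by (rule tensor_ext[OF M.module_axioms N.module_axioms T.module_axioms
          linear_maps_comp[OF tw(1) g] linear_maps_id _ that])
      (simp add: tw(2) gt M.twist_simps N.twist_simps)
  have "bij_betw (tensor_twist R M N) (carrier ?T) (carrier ?T)"
    by (rule bij_betw_byWitness[where f' = g])
      (use 1 2 linear_mapsD(1)[OF tw(1)] linear_mapsD(1)[OF g] in auto)
  moreover have "module R (tensor_object R M N)"
    by (subst module_same[where M = ?T]) (simp_all add: tensor_object_simps T.module_axioms)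
  ultimately show ?thesis
    using tw(1) by (simp add: hom_object_def hom_object_axioms_def tensor_object_simps
        linear_maps_same[where X = "tensor_object R M N" and M = ?T])
qed

lemma tensor_twist_inv:
  assumes "hom_object R M" "hom_object R N"
  shows "tensor_twist_inv R M N \<in> linear_maps R (tensor_module R M N) (tensor_module R M N)"
    and "\<lbrakk>m \<in> carrier M; n \<in> carrier N\<rbrakk>
      \<Longrightarrow> tensor_twist_inv R M N (tens R M N m n) = tens R M N (twist_inv M m) (twist_inv N n)"
proof -
  interpret M: hom_object R M by fact
  interpret N: hom_object R N by fact
  interpret T: hom_object R "tensor_object R M N" by (rule tensor_object_hom_object) fact+
  show "tensor_twist_inv R M N \<in> linear_maps R (tensor_module R M N) (tensor_module R M N)"
    using T.twist_inv_linear by (simp add: tensor_object_simps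
        linear_maps_same[where X = "tensor_object R M N" and M = "tensor_module R M N"])
  show "\<lbrakk>m \<in> carrier M; n \<in> carrier N\<rbrakk>
      \<Longrightarrow> tensor_twist_inv R M N (tens R M N m n) = tens R M N (twist_inv M m) (twist_inv N n)"
    using T.twist_inv_eqI[of "tens R M N (twist_inv M m) (twist_inv N n)" "tens R M N m n"]
    by (simp add: tensor_object_simps tensor_twist_linear(2)[OF assms] M.twist_simps N.twist_simps
        tens_closed M.module_axioms N.module_axioms)
qed

section \<open>The relative Hom-Hopf module \<open>G(A)\<close>\<close>

context hom_comodule_algebra
begin

abbreviation AH where "AH \<equiv> tensor_module R A H"
abbreviation HH where "HH \<equiv> tensor_module R H H"
abbreviation AHH where "AHH \<equiv> tensor_module R AH H"

abbreviation tensor_AH (infixl "\<boxtimes>" 70) where "a \<boxtimes> h \<equiv> tens R A H a h"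
abbreviation tensor_AHH (infixl "\<boxtimes>\<^sub>H" 65) where "t \<boxtimes>\<^sub>H h \<equiv> tens R AH H t h"

text \<open>Named copies of the fields of \<open>G_of R H A\<close>, which keep the nested sums
  folded; \<open>G_of_simps\<close> makes the identification.\<close>

definition G_act where
  "G_act t b = sweedler R A H AH t (\<lambda>a h. coact_sum AH b (\<lambda>b0 b1. (a \<otimes>\<^bsub>A\<^esub> b0) \<boxtimes> (h \<otimes>\<^bsub>H\<^esub> b1)))"

definition G_coact where
  "G_coact t = sweedler R A H AHH t (\<lambda>a h. H.comult_sum AHH h (\<lambda>h1 h2.
    (twist_inv A a \<boxtimes> h1) \<boxtimes>\<^sub>H twist H h2))"

lemmas AH_modules = M.module_axioms H.module_axioms
  tensor_module_module[OF M.module_axioms H.module_axioms]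
  tensor_module_module[OF tensor_module_module[OF M.module_axioms H.module_axioms] H.module_axioms]

lemmas AH_twist = tensor_twist_linear[OF M.hom_object_axioms H.hom_object_axioms]
lemmas AH_twist_inv = tensor_twist_inv[OF M.hom_object_axioms H.hom_object_axioms]

lemmas AH_rules = multilinear coact_rules A.mult_rules H.module_axioms
  linear_maps_comp[OF AH_twist(1)] linear_maps_comp[OF AH_twist_inv(1)]
  linear_mapsD(1)[OF AH_twist(1)] linear_mapsD(1)[OF AH_twist_inv(1)]

lemmas AH_simps = A.mult_simps H.hopf_simps tens_closed AH_modules AH_twist(2) AH_twist_inv(2)

lemmas AH_ext = tensor_ext[OF M.module_axioms H.module_axioms]

lemma G_act_bilinear: "bilinear_map R AH A AH G_act"
  unfolding G_act_def by (assumption | rule AH_rules)+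

lemma G_act_tens:
  assumes "a \<in> carrier A" "h \<in> carrier H" "b \<in> carrier A"
  shows "G_act (a \<boxtimes> h) b = coact_sum AH b (\<lambda>b0 b1. (a \<otimes>\<^bsub>A\<^esub> b0) \<boxtimes> (h \<otimes>\<^bsub>H\<^esub> b1))"
  unfolding G_act_def by (rule sweedler_tens) (assumption | rule AH_rules assms)+

lemma G_coact_linear: "G_coact \<in> linear_maps R AH AHH"
  unfolding G_coact_def[abs_def] by (assumption | rule AH_rules)+

lemma G_coact_tens:
  assumes "a \<in> carrier A" "h \<in> carrier H"
  shows "G_coact (a \<boxtimes> h) = H.comult_sum AHH h (\<lambda>h1 h2. (twist_inv A a \<boxtimes> h1) \<boxtimes>\<^sub>H twist H h2)"
  unfolding G_coact_def by (rule sweedler_tens) (assumption | rule AH_rules assms)+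

lemmas G_rules = AH_rules bilinear_map_comp[OF G_act_bilinear] bilinear_mapD(3)[OF G_act_bilinear]
  linear_maps_comp[OF G_coact_linear] linear_mapsD(1)[OF G_coact_linear]

lemma G_coact_sum:
  assumes P: "module R P" and F: "bilinear_map R AH H P F" and a: "a \<in> carrier A" and h: "h \<in> carrier H"
  shows "sweedler R AH H P (G_coact (a \<boxtimes> h)) F =
    H.comult_sum P h (\<lambda>h1 h2. F (twist_inv A a \<boxtimes> h1) (twist H h2))"
proof -
  note rules = AH_rules linear_maps_comp[OF H.twist_linear] P F a h
  show ?thesis
    unfolding G_coact_tens[OF a h]
    by (rule sweedler_sweedler_tens) (assumption | rule rules)+
qed

section \<open>Hom-module axioms for G(A)\<close>

lemma G_twist_act:
  assumes t: "t \<in> carrier AH" and b: "b \<in> carrier A"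
  shows "tensor_twist R A H (G_act t b) = G_act (tensor_twist R A H t) (twist A b)"
proof (rule AH_ext[OF _ _ _ _ t])
  note rules = G_rules b
  fix a h assume ah: "a \<in> carrier A" "h \<in> carrier H"
  have "tensor_twist R A H (G_act (a \<boxtimes> h) b) =
      coact_sum AH b (\<lambda>b0 b1. tensor_twist R A H ((a \<otimes>\<^bsub>A\<^esub> b0) \<boxtimes> (h \<otimes>\<^bsub>H\<^esub> b1)))"
    unfolding G_act_tens[OF ah b]
    by (rule linear_sweedler[OF _ _ _ _ AH_twist(1)]) (assumption | rule rules ah)+
  also have "\<dots> = coact_sum AH b (\<lambda>b0 b1. (twist A a \<otimes>\<^bsub>A\<^esub> twist A b0) \<boxtimes> (twist H h \<otimes>\<^bsub>H\<^esub> twist H b1))"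
    by (rule sweedler_eqI) (simp add: AH_simps ah)
  also have "\<dots> = coact_sum AH (twist A b) (\<lambda>b0 b1. (twist A a \<otimes>\<^bsub>A\<^esub> b0) \<boxtimes> (twist H h \<otimes>\<^bsub>H\<^esub> b1))"
    by (rule coact_sum_twist[symmetric]) (assumption | rule rules ah)+
  also have "\<dots> = G_act (tensor_twist R A H (a \<boxtimes> h)) (twist A b)"
    by (simp add: G_act_tens AH_simps ah b)
  finally show "tensor_twist R A H (G_act (a \<boxtimes> h) b) = G_act (tensor_twist R A H (a \<boxtimes> h)) (twist A b)" .
qed (assumption | rule G_rules b)+

text \<open>Hom-associativity in both tensor factors rebrackets the iterated action, and
  multiplicativity of the coaction merges the sums over \<open>b\<close> and
  \<open>c\<close>.\<close>

lemma G_act_assoc: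
  assumes t: "t \<in> carrier AH" and b: "b \<in> carrier A" and c: "c \<in> carrier A"
  shows "G_act (G_act t b) (twist A c) = G_act (tensor_twist R A H t) (b \<otimes>\<^bsub>A\<^esub> c)"
proof (rule AH_ext[OF _ _ _ _ t])
  note rules = G_rules b c
  fix a h assume ah: "a \<in> carrier A" "h \<in> carrier H"
  have "G_act (G_act (a \<boxtimes> h) b) (twist A c) =
      coact_sum AH b (\<lambda>b0 b1. G_act ((a \<otimes>\<^bsub>A\<^esub> b0) \<boxtimes> (h \<otimes>\<^bsub>H\<^esub> b1)) (twist A c))"
    unfolding G_act_tens[OF ah b]
    by (rule linear_sweedler[where L = "\<lambda>t. G_act t (twist A c)"]) (assumption | rule rules ah)+
  also have "\<dots> = coact_sum AH b (\<lambda>b0 b1. coact_sum AH (twist A c) (\<lambda>c0 c1.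
      (a \<otimes>\<^bsub>A\<^esub> b0 \<otimes>\<^bsub>A\<^esub> c0) \<boxtimes> (h \<otimes>\<^bsub>H\<^esub> b1 \<otimes>\<^bsub>H\<^esub> c1)))"
    by (rule sweedler_eqI) (simp add: G_act_tens AH_simps ah c)
  also have "\<dots> = coact_sum AH b (\<lambda>b0 b1. coact_sum AH c (\<lambda>c0 c1.
      (a \<otimes>\<^bsub>A\<^esub> b0 \<otimes>\<^bsub>A\<^esub> twist A c0) \<boxtimes> (h \<otimes>\<^bsub>H\<^esub> b1 \<otimes>\<^bsub>H\<^esub> twist H c1)))"
    by (rule sweedler_eqI, rule coact_sum_twist) (assumption | rule rules ah)+
  also have "\<dots> = coact_sum AH b (\<lambda>b0 b1. coact_sum AH c (\<lambda>c0 c1.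
      (twist A a \<otimes>\<^bsub>A\<^esub> (b0 \<otimes>\<^bsub>A\<^esub> c0)) \<boxtimes> (twist H h \<otimes>\<^bsub>H\<^esub> (b1 \<otimes>\<^bsub>H\<^esub> c1))))"
    by (intro sweedler_eqI) (simp add: ah A.hom_assoc H.hom_assoc)
  also have "\<dots> = coact_sum AH (b \<otimes>\<^bsub>A\<^esub> c) (\<lambda>x y. (twist A a \<otimes>\<^bsub>A\<^esub> x) \<boxtimes> (twist H h \<otimes>\<^bsub>H\<^esub> y))"
    by (rule coact_sum_mult[symmetric]) (assumption | rule rules ah)+
  also have "\<dots> = G_act (tensor_twist R A H (a \<boxtimes> h)) (b \<otimes>\<^bsub>A\<^esub> c)"
    by (simp add: G_act_tens AH_simps ah b c)
  finally show "G_act (G_act (a \<boxtimes> h) b) (twist A c) = G_act (tensor_twist R A H (a \<boxtimes> h)) (b \<otimes>\<^bsub>A\<^esub> c)" .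
qed (assumption | rule G_rules b c)+

lemma G_act_unit:
  assumes t: "t \<in> carrier AH"
  shows "G_act t \<one>\<^bsub>A\<^esub> = tensor_twist R A H t"
proof (rule AH_ext[OF _ _ _ _ t])
  fix a h assume ah: "a \<in> carrier A" "h \<in> carrier H"
  have "G_act (a \<boxtimes> h) \<one>\<^bsub>A\<^esub> = (a \<otimes>\<^bsub>A\<^esub> \<one>\<^bsub>A\<^esub>) \<boxtimes> (h \<otimes>\<^bsub>H\<^esub> \<one>\<^bsub>H\<^esub>)"
    unfolding G_act_tens[OF ah A.unit_closed]
    by (rule coact_sum_unit) (assumption | rule AH_rules ah)+
  then show "G_act (a \<boxtimes> h) \<one>\<^bsub>A\<^esub> = tensor_twist R A H (a \<boxtimes> h)"
    by (simp add: AH_simps ah)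
qed (assumption | rule G_rules)+

section \<open>Hom-comodule axioms and compatibility for G(A)\<close>

lemma G_coact_twist:
  assumes t: "t \<in> carrier AH"
  shows "G_coact (tensor_twist R A H t) =
    sweedler R AH H AHH (G_coact t) (\<lambda>x y. tensor_twist R A H x \<boxtimes>\<^sub>H twist H y)"
proof (rule AH_ext[OF _ _ _ _ t])
  fix a h assume ah: "a \<in> carrier A" "h \<in> carrier H"
  have "G_coact (tensor_twist R A H (a \<boxtimes> h)) =
      H.comult_sum AHH (twist H h) (\<lambda>h1 h2. (a \<boxtimes> h1) \<boxtimes>\<^sub>H twist H h2)"
    by (simp add: G_coact_tens AH_simps ah)
  also have "\<dots> = H.comult_sum AHH h (\<lambda>h1 h2. (a \<boxtimes> twist H h1) \<boxtimes>\<^sub>H twist H (twist H h2))"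
    by (rule H.comult_sum_twist) (assumption | rule AH_rules ah)+
  also have "\<dots> = H.comult_sum AHH h (\<lambda>h1 h2.
      tensor_twist R A H (twist_inv A a \<boxtimes> h1) \<boxtimes>\<^sub>H twist H (twist H h2))"
    by (rule sweedler_eqI) (simp add: AH_simps ah)
  also have "\<dots> = sweedler R AH H AHH (G_coact (a \<boxtimes> h)) (\<lambda>x y. tensor_twist R A H x \<boxtimes>\<^sub>H twist H y)"
    by (rule G_coact_sum[symmetric]) (assumption | rule AH_rules ah)+
  finally show "G_coact (tensor_twist R A H (a \<boxtimes> h)) =
      sweedler R AH H AHH (G_coact (a \<boxtimes> h)) (\<lambda>x y. tensor_twist R A H x \<boxtimes>\<^sub>H twist H y)" .
qed (assumption | rule G_rules)+

lemma G_coact_coassoc: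
  assumes t: "t \<in> carrier AH"
  defines "P \<equiv> tensor_module R AH HH"
  shows "sweedler R AH H P (G_coact t) (\<lambda>m0 m1. sweedler R AH H P (G_coact m0) (\<lambda>x y.
      tens R AH HH x (tens R H H y (twist_inv H m1)))) =
    sweedler R AH H P (G_coact t) (\<lambda>m0 m1. tens R AH HH (tensor_twist_inv R A H m0) (comult H m1))"
proof (rule AH_ext[OF _ _ _ _ t])
  have P: "module R P"
    unfolding P_def by (rule AH_rules)+
  \<comment> \<open>\<open>P\<close> stays folded, so the linearity rules for tensors with values in
    it are restated.\<close>
  have T: "(\<lambda>x. tens R AH HH (f x) s) \<in> linear_maps R M P"
    if "s \<in> carrier HH" "f \<in> linear_maps R M AH" for f s and M :: "('a, 'n, 'q) module_scheme"
    unfolding P_def by (assumption | rule AH_rules that)+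
  have T': "(\<lambda>x. tens R AH HH t (f x)) \<in> linear_maps R M P"
    if "t \<in> carrier AH" "f \<in> linear_maps R M HH" for f t and M :: "('a, 'n, 'q) module_scheme"
    unfolding P_def by (assumption | rule AH_rules that)+
  note rules = T T' G_rules P
  fix a h assume ah: "a \<in> carrier A" "h \<in> carrier H"
  let ?a = "twist_inv A (twist_inv A a)"
  have "sweedler R AH H P (G_coact (a \<boxtimes> h)) (\<lambda>m0 m1. sweedler R AH H P (G_coact m0) (\<lambda>x y.
      tens R AH HH x (tens R H H y (twist_inv H m1)))) =
    H.comult_sum P h (\<lambda>h1 h2. sweedler R AH H P (G_coact (twist_inv A a \<boxtimes> h1)) (\<lambda>x y.
      tens R AH HH x (tens R H H y (twist_inv H (twist H h2)))))"
    by (rule G_coact_sum) (assumption | rule rules ah)+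
  also have "\<dots> = H.comult_sum P h (\<lambda>h1 h2. H.comult_sum P h1 (\<lambda>x y.
      tens R AH HH (?a \<boxtimes> x) (tens R H H (twist H y) (twist_inv H (twist H h2)))))"
    by (rule sweedler_eqI, rule G_coact_sum) (assumption | rule rules ah)+
  \<comment> \<open>Exchanging the twist with its inverse exposes \<open>twist_inv H h2\<close>, the
    third slot required by \<open>comult_sum_coassoc\<close>.\<close>
  also have "\<dots> = H.comult_sum P h (\<lambda>h1 h2. H.comult_sum P h1 (\<lambda>x y.
      tens R AH HH (?a \<boxtimes> x) (tens R H H (twist H y) (twist H (twist_inv H h2)))))"
    by (intro sweedler_eqI) (simp add: AH_simps)
  also have "\<dots> = H.comult_sum P h (\<lambda>h1 h2. H.comult_sum P h2 (\<lambda>x y.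
      tens R AH HH (?a \<boxtimes> twist_inv H h1) (tens R H H (twist H x) (twist H y))))"
    by (rule H.comult_sum_coassoc[symmetric]) (assumption | rule rules ah)+
  also have "\<dots> = H.comult_sum P h (\<lambda>h1 h2.
      tens R AH HH (?a \<boxtimes> twist_inv H h1) (H.comult_sum HH h2 (\<lambda>x y. tens R H H (twist H x) (twist H y))))"
    by (rule sweedler_eqI, rule linear_sweedler[symmetric]) (assumption | rule rules ah)+
  also have "\<dots> = H.comult_sum P h (\<lambda>h1 h2.
      tens R AH HH (tensor_twist_inv R A H (twist_inv A a \<boxtimes> h1)) (comult H (twist H h2)))"
    by (rule sweedler_eqI) (simp add: AH_simps ah H.comult_twist)
  also have "\<dots> = sweedler R AH H P (G_coact (a \<boxtimes> h))
      (\<lambda>m0 m1. tens R AH HH (tensor_twist_inv R A H m0) (comult H m1))"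
    by (rule G_coact_sum[symmetric]) (assumption | rule rules ah)+
  finally show "sweedler R AH H P (G_coact (a \<boxtimes> h)) (\<lambda>m0 m1. sweedler R AH H P (G_coact m0) (\<lambda>x y.
      tens R AH HH x (tens R H H y (twist_inv H m1)))) =
    sweedler R AH H P (G_coact (a \<boxtimes> h)) (\<lambda>m0 m1. tens R AH HH (tensor_twist_inv R A H m0) (comult H m1))" .
qed (unfold P_def, (assumption | rule G_rules)+)

lemma G_coact_counit:
  assumes t: "t \<in> carrier AH"
  shows "sweedler R AH H AH (G_coact t) (\<lambda>x y. counit H y \<odot>\<^bsub>AH\<^esub> x) = tensor_twist_inv R A H t"
proof (rule AH_ext[OF _ _ _ _ t])
  fix a h assume ah: "a \<in> carrier A" "h \<in> carrier H"
  have "sweedler R AH H AH (G_coact (a \<boxtimes> h)) (\<lambda>x y. counit H y \<odot>\<^bsub>AH\<^esub> x) =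
      H.comult_sum AH h (\<lambda>x y. counit H (twist H y) \<odot>\<^bsub>AH\<^esub> (twist_inv A a \<boxtimes> x))"
    by (rule G_coact_sum) (assumption | rule AH_rules ah)+
  also have "\<dots> = H.comult_sum AH h (\<lambda>x y. counit H y \<odot>\<^bsub>AH\<^esub> (twist_inv A a \<boxtimes> x))"
    by (rule sweedler_eqI) (simp add: H.counit_twist)
  also have "\<dots> = twist_inv A a \<boxtimes> twist_inv H h"
    by (rule H.comult_sum_counit_right) (assumption | rule AH_rules ah)+
  finally show "sweedler R AH H AH (G_coact (a \<boxtimes> h)) (\<lambda>x y. counit H y \<odot>\<^bsub>AH\<^esub> x) =
      tensor_twist_inv R A H (a \<boxtimes> h)"
    by (simp add: AH_simps ah)
qed (assumption | rule G_rules)+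

text \<open>Multiplicativity of \<open>comult H\<close> splits off a comultiplication of
  \<open>b1\<close>; Hom-coassociativity of the coaction trades it for a coaction on
  \<open>b0\<close>, which is the one contained in \<open>G_act\<close>.\<close>

lemma G_coact_act:
  assumes t: "t \<in> carrier AH" and b: "b \<in> carrier A"
  shows "G_coact (G_act t b) = sweedler R AH H AHH (G_coact t) (\<lambda>m0 m1.
    coact_sum AHH b (\<lambda>b0 b1. G_act m0 b0 \<boxtimes>\<^sub>H (m1 \<otimes>\<^bsub>H\<^esub> b1)))"
proof (rule AH_ext[OF _ _ _ _ t])
  note rules = G_rules b
  fix a h assume ah: "a \<in> carrier A" "h \<in> carrier H"
  have "G_coact (G_act (a \<boxtimes> h) b) = coact_sum AHH b (\<lambda>b0 b1. G_coact ((a \<otimes>\<^bsub>A\<^esub> b0) \<boxtimes> (h \<otimes>\<^bsub>H\<^esub> b1)))"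
    unfolding G_act_tens[OF ah b]
    by (rule linear_sweedler) (assumption | rule rules ah)+
  also have "\<dots> = coact_sum AHH b (\<lambda>b0 b1. H.comult_sum AHH (h \<otimes>\<^bsub>H\<^esub> b1) (\<lambda>x y.
      (twist_inv A (a \<otimes>\<^bsub>A\<^esub> b0) \<boxtimes> x) \<boxtimes>\<^sub>H twist H y))"
    by (rule sweedler_eqI) (simp add: G_coact_tens AH_simps ah)
  also have "\<dots> = coact_sum AHH b (\<lambda>b0 b1. H.comult_sum AHH h (\<lambda>h1 h2. H.comult_sum AHH b1 (\<lambda>x y.
      (twist_inv A (a \<otimes>\<^bsub>A\<^esub> b0) \<boxtimes> (h1 \<otimes>\<^bsub>H\<^esub> x)) \<boxtimes>\<^sub>H twist H (h2 \<otimes>\<^bsub>H\<^esub> y))))"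
    by (rule sweedler_eqI, rule H.comult_sum_mult) (assumption | rule rules ah)+
  \<comment> \<open>The swap brings the coaction of \<open>b\<close> next to the comultiplication of
    \<open>b1\<close>.\<close>
  also have "\<dots> = H.comult_sum AHH h (\<lambda>h1 h2. coact_sum AHH b (\<lambda>b0 b1. H.comult_sum AHH b1 (\<lambda>x y.
      (twist_inv A (a \<otimes>\<^bsub>A\<^esub> b0) \<boxtimes> (h1 \<otimes>\<^bsub>H\<^esub> x)) \<boxtimes>\<^sub>H twist H (h2 \<otimes>\<^bsub>H\<^esub> y))))"
    by (rule sweedler_swap) (assumption | rule rules ah)+
  \<comment> \<open>Distributing the twists exposes \<open>twist_inv A b0\<close>, the first slot
    required by \<open>coact_sum_coassoc\<close>.\<close>
  also have "\<dots> = H.comult_sum AHH h (\<lambda>h1 h2. coact_sum AHH b (\<lambda>b0 b1. H.comult_sum AHH b1 (\<lambda>x y.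
      ((twist_inv A a \<otimes>\<^bsub>A\<^esub> twist_inv A b0) \<boxtimes> (h1 \<otimes>\<^bsub>H\<^esub> x)) \<boxtimes>\<^sub>H (twist H h2 \<otimes>\<^bsub>H\<^esub> twist H y))))"
    by (intro sweedler_eqI) (simp add: AH_simps ah)
  also have "\<dots> = H.comult_sum AHH h (\<lambda>h1 h2. coact_sum AHH b (\<lambda>b0 b1. coact_sum AHH b0 (\<lambda>x y.
      ((twist_inv A a \<otimes>\<^bsub>A\<^esub> x) \<boxtimes> (h1 \<otimes>\<^bsub>H\<^esub> y)) \<boxtimes>\<^sub>H (twist H h2 \<otimes>\<^bsub>H\<^esub> twist H (twist_inv H b1)))))"
    by (rule sweedler_eqI, rule coact_sum_coassoc[symmetric]) (assumption | rule rules ah)+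
  also have "\<dots> = H.comult_sum AHH h (\<lambda>h1 h2. coact_sum AHH b (\<lambda>b0 b1.
      coact_sum AH b0 (\<lambda>x y. (twist_inv A a \<otimes>\<^bsub>A\<^esub> x) \<boxtimes> (h1 \<otimes>\<^bsub>H\<^esub> y)) \<boxtimes>\<^sub>H
        (twist H h2 \<otimes>\<^bsub>H\<^esub> twist H (twist_inv H b1))))"
    by (rule sweedler_eqI, rule sweedler_eqI, rule linear_sweedler[symmetric])
      (assumption | rule rules ah)+
  also have "\<dots> = H.comult_sum AHH h (\<lambda>h1 h2. coact_sum AHH b (\<lambda>b0 b1.
      G_act (twist_inv A a \<boxtimes> h1) b0 \<boxtimes>\<^sub>H (twist H h2 \<otimes>\<^bsub>H\<^esub> b1)))"
    by (intro sweedler_eqI) (simp add: AH_simps ah G_act_tens)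
  also have "\<dots> = sweedler R AH H AHH (G_coact (a \<boxtimes> h)) (\<lambda>m0 m1.
      coact_sum AHH b (\<lambda>b0 b1. G_act m0 b0 \<boxtimes>\<^sub>H (m1 \<otimes>\<^bsub>H\<^esub> b1)))"
    by (rule G_coact_sum[symmetric]) (assumption | rule rules ah)+
  finally show "G_coact (G_act (a \<boxtimes> h) b) = sweedler R AH H AHH (G_coact (a \<boxtimes> h)) (\<lambda>m0 m1.
      coact_sum AHH b (\<lambda>b0 b1. G_act m0 b0 \<boxtimes>\<^sub>H (m1 \<otimes>\<^bsub>H\<^esub> b1)))" .
qed (assumption | rule G_rules b)+

lemma G_of_simps:
  "carrier (G_of R H A) = carrier AH" "zero (G_of R H A) = zero AH"
  "add (G_of R H A) = add AH" "smult (G_of R H A) = smult AH"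
  "twist (G_of R H A) = tensor_twist R A H" "coact (G_of R H A) = G_coact"
  "act (G_of R H A) = G_act"
  by (auto simp: G_of_def relative_structure_def tensor_object_simps Let_def G_coact_def[abs_def] G_act_def[abs_def])

lemmas G_same = G_of_simps module_same[OF G_of_simps(1-4)] linear_maps_same[OF G_of_simps(1,3,4)]
  tensor_same_left[OF G_of_simps(1,3,4)] tensor_lift_same_target[OF G_of_simps(1,3,4)]

lemma G_relative_hom_hopf_module: "relative_hom_hopf_module R H A (G_of R H A)"
proof -
  interpret T: hom_object R "tensor_object R A H"
    by (rule tensor_object_hom_object[OF M.hom_object_axioms H.hom_object_axioms])
  have obj: "hom_object R (G_of R H A)"
    using T.twist_bij AH_twist(1) AH_modules(3)
    by (simp add: hom_object_def hom_object_axioms_def G_same tensor_object_simps)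
  have com: "right_hom_comodule R H (G_of R H A)"
    by (intro right_hom_comodule.intro right_hom_comodule_axioms.intro
        H.monoidal_hom_hopf_algebra_axioms obj)
      (simp_all add: G_same Let_def G_coact_linear G_coact_twist G_coact_coassoc G_coact_counit)
  have modu: "right_hom_module R A (G_of R H A) (act (G_of R H A))"
    by (intro right_hom_module.intro right_hom_module_axioms.intro
        A.monoidal_hom_algebra_axioms obj)
      (simp_all add: G_same bilinear_map_def G_act_bilinear[unfolded bilinear_map_def]
        G_twist_act G_act_assoc G_act_unit)
  show ?thesis
    by (intro relative_hom_hopf_module.intro relative_hom_hopf_module_axioms.intro
        hom_comodule_algebra_axioms com modu)
      (simp add: G_same Let_def G_coact_act)
qed

end

section \<open>The isomorphism\<close>

text \<open>The identities for \<open>g\<close> come from those for \<open>f\<close> by cancelling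
  \<open>f\<close>, so linearity and colinearity of the isomorphism have to be checked in one
  direction only.\<close>

lemma relative_hom_hopf_morphisms_inverse:
  assumes M: "relative_hom_hopf_module R H A M" and N: "relative_hom_hopf_module R H A N"
    and f: "f \<in> relative_hom_hopf_morphisms R H A M N"
    and closed: "\<And>n. n \<in> carrier N \<Longrightarrow> g n \<in> carrier M"
    and gf: "\<And>m. m \<in> carrier M \<Longrightarrow> g (f m) = m"
    and fg: "\<And>n. n \<in> carrier N \<Longrightarrow> f (g n) = n"
  shows "g \<in> relative_hom_hopf_morphisms R H A N M"
proof -
  interpret M: relative_hom_hopf_module R H A M by fact
  interpret N: relative_hom_hopf_module R H A N by fact
  note Mm = M.M.M.module_axioms and Nm = N.M.M.module_axioms and Hm = M.A.H.module_axioms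
  have fl: "f \<in> linear_maps R M N"
    and ft: "\<And>m. m \<in> carrier M \<Longrightarrow> f (twist M m) = twist N (f m)"
    and fa: "\<And>m a. m \<in> carrier M \<Longrightarrow> a \<in> carrier A \<Longrightarrow> f (act M m a) = act N (f m) a"
    and fc: "\<And>m. m \<in> carrier M \<Longrightarrow> coact N (f m) =
        sweedler R M H (tensor_module R N H) (coact M m) (\<lambda>m0 m1. tens R N H (f m0) m1)"
    using f unfolding relative_hom_hopf_morphisms_def by blast+
  \<comment> \<open>An equation for \<open>g\<close> is thereby proved by applying
    \<open>f\<close>.\<close>
  have geq: "g y = x" if "x \<in> carrier M" "f x = y" for x y
    using gf that by blast
  have gl: "g \<in> linear_maps R N M"
    by (rule linear_mapsI)
      (auto intro!: geq simp: closed fg linear_mapsD(2,3)[OF fl] M.M.M.smult_closed)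
  have "g (twist N n) = twist M (g n)" if "n \<in> carrier N" for n
    by (rule geq) (simp_all add: that closed ft fg M.M.M.twist_closed)
  moreover have "g (act N n a) = act M (g n) a" if "n \<in> carrier N" "a \<in> carrier A" for n a
    by (rule geq) (simp_all add: that closed fa fg bilinear_mapD(3)[OF M.M.action_bilinear])
  moreover have "coact M (g n) =
      sweedler R N H (tensor_module R M H) (coact N n) (\<lambda>n0 n1. tens R M H (g n0) n1)"
    if n: "n \<in> carrier N" for n
  proof -
    note rules = multilinear Mm Nm Hm linear_maps_comp[OF gl] linear_maps_comp[OF fl]
      fl M.M.coact_closed[OF closed[OF n]] closed
    \<comment> \<open>Writing \<open>n\<close> as \<open>f (g n)\<close> expresses
      \<open>coact N n\<close> through \<open>coact M (g n)\<close> by colinearity of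
      \<open>f\<close>; then \<open>g\<close> cancels \<open>f\<close> in the first factor.\<close>
    have "sweedler R N H (tensor_module R M H) (coact N n) (\<lambda>n0 n1. tens R M H (g n0) n1) =
        sweedler R N H (tensor_module R M H) (sweedler R M H (tensor_module R N H)
          (coact M (g n)) (\<lambda>m0 m1. tens R N H (f m0) m1)) (\<lambda>n0 n1. tens R M H (g n0) n1)"
      using fc[OF closed[OF n]] by (simp add: fg n)
    also have "\<dots> = sweedler R M H (tensor_module R M H) (coact M (g n)) (\<lambda>m0 m1. tens R M H (g (f m0)) m1)"
      by (rule sweedler_sweedler_tens[where g = "\<lambda>x. x"]) (assumption | rule rules)+
    also have "\<dots> = sweedler R M H (tensor_module R M H) (coact M (g n)) (tens R M H)"
      by (rule sweedler_eqI) (simp add: gf)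
    also have "\<dots> = coact M (g n)"
      by (rule sweedler_tens_id[OF Mm Hm M.M.coact_closed[OF closed[OF n]]])
    finally show ?thesis ..
  qed
  ultimately show ?thesis
    unfolding relative_hom_hopf_morphisms_def using gl by blast
qed

section \<open>The candidate isomorphism and its inverse\<close>

context hom_comodule_algebra
begin

definition G_iso where
  "G_iso t = sweedler R A H AH t (\<lambda>a h. coact_sum AH a (\<lambda>a0 a1.
    twist_inv A a0 \<boxtimes> (a1 \<otimes>\<^bsub>H\<^esub> twist_inv H h)))"

text \<open>The exponents fit the cancellations in \<open>G_iso_inv_G_iso\<close>. Of the three
  twists on \<open>a0\<close>, one meets the \<open>twist_inv\<close> in \<open>G_iso\<close>, and
  Hom-coassociativity and the counit axiom absorb one each. Of the two on \<open>a1\<close>, one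
  meets that same inverse and one is used by Hom-associativity.\<close>

definition G_iso_inv where
  "G_iso_inv t = sweedler R A H AH t (\<lambda>a h. coact_sum AH a (\<lambda>a0 a1.
    twist A (twist A (twist A a0)) \<boxtimes> (H.S (twist H (twist H a1)) \<otimes>\<^bsub>H\<^esub> twist_inv H h)))"

lemma G_iso_linear: "G_iso \<in> linear_maps R AH AH"
  unfolding G_iso_def[abs_def] by (assumption | rule AH_rules)+

lemma G_iso_inv_linear: "G_iso_inv \<in> linear_maps R AH AH"
  unfolding G_iso_inv_def[abs_def] by (assumption | rule AH_rules)+

lemma G_iso_tens:
  assumes "a \<in> carrier A" "h \<in> carrier H"
  shows "G_iso (a \<boxtimes> h) = coact_sum AH a (\<lambda>a0 a1. twist_inv A a0 \<boxtimes> (a1 \<otimes>\<^bsub>H\<^esub> twist_inv H h))"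
  unfolding G_iso_def by (rule sweedler_tens) (assumption | rule AH_rules assms)+

lemma G_iso_inv_tens:
  assumes "a \<in> carrier A" "h \<in> carrier H"
  shows "G_iso_inv (a \<boxtimes> h) = coact_sum AH a (\<lambda>a0 a1.
    twist A (twist A (twist A a0)) \<boxtimes> (H.S (twist H (twist H a1)) \<otimes>\<^bsub>H\<^esub> twist_inv H h))"
  unfolding G_iso_inv_def by (rule sweedler_tens) (assumption | rule AH_rules assms)+

lemmas G_iso_rules = G_rules linear_maps_comp[OF G_iso_linear] linear_mapsD(1)[OF G_iso_linear]
  linear_maps_comp[OF G_iso_inv_linear] linear_mapsD(1)[OF G_iso_inv_linear]

text \<open>Hom-coassociativity turns the iterated coaction on \<open>a\<close> into a
  comultiplication of \<open>a1\<close>, whose legs meet as \<open>H.S x\<close> and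
  \<open>y\<close>; the antipode identity and the counit axiom then remove them.\<close>

lemma G_iso_inv_G_iso:
  assumes t: "t \<in> carrier AH"
  shows "G_iso_inv (G_iso t) = t"
proof (rule AH_ext[OF _ _ _ _ t])
  fix a h assume ah: "a \<in> carrier A" "h \<in> carrier H"
  let ?h = "twist_inv H h"
  have "G_iso_inv (G_iso (a \<boxtimes> h)) =
      coact_sum AH a (\<lambda>a0 a1. G_iso_inv (twist_inv A a0 \<boxtimes> (a1 \<otimes>\<^bsub>H\<^esub> ?h)))"
    unfolding G_iso_tens[OF ah]
    by (rule linear_sweedler[OF _ _ _ _ G_iso_inv_linear]) (assumption | rule G_iso_rules ah)+
  also have "\<dots> = coact_sum AH a (\<lambda>a0 a1. coact_sum AH (twist_inv A a0) (\<lambda>u v.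
      twist A (twist A (twist A u)) \<boxtimes> (H.S (twist H (twist H v)) \<otimes>\<^bsub>H\<^esub> twist_inv H (a1 \<otimes>\<^bsub>H\<^esub> ?h))))"
    by (rule sweedler_eqI, rule G_iso_inv_tens) (assumption | rule G_iso_rules ah)+
  also have "\<dots> = coact_sum AH a (\<lambda>a0 a1. coact_sum AH a0 (\<lambda>u v.
      twist A (twist A (twist A (twist_inv A u))) \<boxtimes>
        (H.S (twist H (twist H (twist_inv H v))) \<otimes>\<^bsub>H\<^esub> twist_inv H (a1 \<otimes>\<^bsub>H\<^esub> ?h))))"
    by (rule sweedler_eqI, rule coact_sum_twist_inv) (assumption | rule G_iso_rules ah)+
  \<comment> \<open>Hom-associativity places \<open>twist_inv H a1\<close> next to
    \<open>H.S v\<close>, using up the one twist still left on \<open>H.S v\<close>.\<close>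
  also have "\<dots> = coact_sum AH a (\<lambda>a0 a1. coact_sum AH a0 (\<lambda>u v.
      twist A (twist A u) \<boxtimes> ((H.S v \<otimes>\<^bsub>H\<^esub> twist_inv H a1) \<otimes>\<^bsub>H\<^esub> ?h)))"
    by (intro sweedler_eqI) (simp add: AH_simps H.hom_assoc ah)
  also have "\<dots> = coact_sum AH a (\<lambda>a0 a1. H.comult_sum AH a1 (\<lambda>x y.
      twist A (twist A (twist_inv A a0)) \<boxtimes> ((H.S x \<otimes>\<^bsub>H\<^esub> y) \<otimes>\<^bsub>H\<^esub> ?h)))"
    by (rule coact_sum_coassoc) (assumption | rule G_iso_rules ah)+
  also have "\<dots> = coact_sum AH a (\<lambda>a0 a1.
      counit H a1 \<odot>\<^bsub>AH\<^esub> (twist A (twist A (twist_inv A a0)) \<boxtimes> (\<one>\<^bsub>H\<^esub> \<otimes>\<^bsub>H\<^esub> ?h)))"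
    by (rule sweedler_eqI, rule H.comult_sum_S_left) (assumption | rule G_iso_rules ah)+
  also have "\<dots> = twist A (twist A (twist_inv A (twist_inv A a))) \<boxtimes> (\<one>\<^bsub>H\<^esub> \<otimes>\<^bsub>H\<^esub> ?h)"
    by (rule coact_sum_counit) (assumption | rule G_iso_rules ah)+
  also have "\<dots> = a \<boxtimes> h"
    by (simp add: AH_simps ah)
  finally show "G_iso_inv (G_iso (a \<boxtimes> h)) = a \<boxtimes> h" .
qed (assumption | rule G_iso_rules)+

lemma G_iso_G_iso_inv:
  assumes t: "t \<in> carrier AH"
  shows "G_iso (G_iso_inv t) = t"
proof (rule AH_ext[OF _ _ _ _ t])
  fix a h assume ah: "a \<in> carrier A" "h \<in> carrier H"
  let ?h = "twist_inv H h"
  let ?F = "\<lambda>a0 a1 u v. twist_inv A u \<boxtimes> (v \<otimes>\<^bsub>H\<^esub> twist_inv H (H.S (twist H (twist H a1)) \<otimes>\<^bsub>H\<^esub> ?h))"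
  have "G_iso (G_iso_inv (a \<boxtimes> h)) =
      coact_sum AH a (\<lambda>a0 a1. G_iso (twist A (twist A (twist A a0)) \<boxtimes>
        (H.S (twist H (twist H a1)) \<otimes>\<^bsub>H\<^esub> ?h)))"
    unfolding G_iso_inv_tens[OF ah]
    by (rule linear_sweedler[OF _ _ _ _ G_iso_linear]) (assumption | rule G_iso_rules ah)+
  also have "\<dots> = coact_sum AH a (\<lambda>a0 a1. coact_sum AH (twist A (twist A (twist A a0))) (?F a0 a1))"
    by (rule sweedler_eqI, rule G_iso_tens) (assumption | rule G_iso_rules ah)+
  \<comment> \<open>The triple twist is moved through the coaction one layer at a time.\<close>
  also have "\<dots> = coact_sum AH a (\<lambda>a0 a1. coact_sum AH (twist A (twist A a0)) (\<lambda>u v.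
      ?F a0 a1 (twist A u) (twist H v)))"
    by (rule sweedler_eqI, rule coact_sum_twist) (assumption | rule G_iso_rules ah)+
  also have "\<dots> = coact_sum AH a (\<lambda>a0 a1. coact_sum AH (twist A a0) (\<lambda>u v.
      ?F a0 a1 (twist A (twist A u)) (twist H (twist H v))))"
    by (rule sweedler_eqI, rule coact_sum_twist) (assumption | rule G_iso_rules ah)+
  also have "\<dots> = coact_sum AH a (\<lambda>a0 a1. coact_sum AH a0 (\<lambda>u v.
      ?F a0 a1 (twist A (twist A (twist A u))) (twist H (twist H (twist H v)))))"
    by (rule sweedler_eqI, rule coact_sum_twist) (assumption | rule G_iso_rules ah)+
  \<comment> \<open>A common double twist is extracted from the product, leaving \<open>v\<close>
    times \<open>H.S (twist_inv H a1)\<close>, the shape to which \<open>coact_sum_coassoc\<close>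
    applies.\<close>
  also have "\<dots> = coact_sum AH a (\<lambda>a0 a1. coact_sum AH a0 (\<lambda>u v.
      twist A (twist A u) \<boxtimes> (twist H (twist H (v \<otimes>\<^bsub>H\<^esub> H.S (twist_inv H a1))) \<otimes>\<^bsub>H\<^esub> ?h)))"
    by (intro sweedler_eqI) (simp add: AH_simps H.hom_assoc ah)
  also have "\<dots> = coact_sum AH a (\<lambda>a0 a1. H.comult_sum AH a1 (\<lambda>x y.
      twist A (twist A (twist_inv A a0)) \<boxtimes> (twist H (twist H (x \<otimes>\<^bsub>H\<^esub> H.S y)) \<otimes>\<^bsub>H\<^esub> ?h)))"
    by (rule coact_sum_coassoc) (assumption | rule G_iso_rules ah)+
  also have "\<dots> = coact_sum AH a (\<lambda>a0 a1.
      counit H a1 \<odot>\<^bsub>AH\<^esub> (twist A (twist A (twist_inv A a0)) \<boxtimes> (twist H (twist H \<one>\<^bsub>H\<^esub>) \<otimes>\<^bsub>H\<^esub> ?h)))"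
    by (rule sweedler_eqI, rule H.comult_sum_S_right) (assumption | rule G_iso_rules ah)+
  also have "\<dots> = twist A (twist A (twist_inv A (twist_inv A a))) \<boxtimes> (twist H (twist H \<one>\<^bsub>H\<^esub>) \<otimes>\<^bsub>H\<^esub> ?h)"
    by (rule coact_sum_counit) (assumption | rule G_iso_rules ah)+
  also have "\<dots> = a \<boxtimes> h"
    by (simp add: AH_simps ah)
  finally show "G_iso (G_iso_inv (a \<boxtimes> h)) = a \<boxtimes> h" .
qed (assumption | rule G_iso_rules)+

lemma G_iso_twist:
  assumes t: "t \<in> carrier AH"
  shows "G_iso (tensor_twist R A H t) = tensor_twist R A H (G_iso t)"
proof (rule AH_ext[OF _ _ _ _ t])
  fix a h assume ah: "a \<in> carrier A" "h \<in> carrier H"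
  have "G_iso (tensor_twist R A H (a \<boxtimes> h)) =
      coact_sum AH (twist A a) (\<lambda>a0 a1. twist_inv A a0 \<boxtimes> (a1 \<otimes>\<^bsub>H\<^esub> h))"
    by (simp add: G_iso_tens AH_simps ah)
  also have "\<dots> = coact_sum AH a (\<lambda>a0 a1. twist_inv A (twist A a0) \<boxtimes> (twist H a1 \<otimes>\<^bsub>H\<^esub> h))"
    by (rule coact_sum_twist) (assumption | rule G_iso_rules ah)+
  also have "\<dots> = coact_sum AH a (\<lambda>a0 a1. tensor_twist R A H (twist_inv A a0 \<boxtimes> (a1 \<otimes>\<^bsub>H\<^esub> twist_inv H h)))"
    by (rule sweedler_eqI) (simp add: AH_simps ah)
  also have "\<dots> = tensor_twist R A H (G_iso (a \<boxtimes> h))"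
    unfolding G_iso_tens[OF ah]
    by (rule linear_sweedler[OF _ _ _ _ AH_twist(1), symmetric]) (assumption | rule G_iso_rules ah)+
  finally show "G_iso (tensor_twist R A H (a \<boxtimes> h)) = tensor_twist R A H (G_iso (a \<boxtimes> h))" .
qed (assumption | rule G_iso_rules)+

section \<open>Action and coaction of \<open>G_tilde_of R H A\<close>\<close>

definition G_tilde_act where
  "G_tilde_act t b = sweedler R A H AH t (\<lambda>a h. (a \<otimes>\<^bsub>A\<^esub> twist A b) \<boxtimes> twist_inv H h)"

definition G_tilde_coact where
  "G_tilde_coact t = sweedler R A H AHH t (\<lambda>a h. coact_sum AHH a (\<lambda>a0 a1.
    H.comult_sum AHH h (\<lambda>h1 h2. (a0 \<boxtimes> h1) \<boxtimes>\<^sub>H (a1 \<otimes>\<^bsub>H\<^esub> h2))))"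

lemma G_tilde_act_bilinear: "bilinear_map R AH A AH G_tilde_act"
  unfolding G_tilde_act_def by (assumption | rule AH_rules)+

lemma G_tilde_act_tens:
  assumes "a \<in> carrier A" "h \<in> carrier H" "b \<in> carrier A"
  shows "G_tilde_act (a \<boxtimes> h) b = (a \<otimes>\<^bsub>A\<^esub> twist A b) \<boxtimes> twist_inv H h"
  unfolding G_tilde_act_def by (rule sweedler_tens) (assumption | rule AH_rules assms)+

lemma G_tilde_coact_linear: "G_tilde_coact \<in> linear_maps R AH AHH"
  unfolding G_tilde_coact_def[abs_def] by (assumption | rule AH_rules)+

lemma G_tilde_coact_sum:
  assumes P: "module R P" and F: "bilinear_map R AH H P F" and a: "a \<in> carrier A" and h: "h \<in> carrier H"
  shows "sweedler R AH H P (G_tilde_coact (a \<boxtimes> h)) F =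
    coact_sum P a (\<lambda>a0 a1. H.comult_sum P h (\<lambda>h1 h2. F (a0 \<boxtimes> h1) (a1 \<otimes>\<^bsub>H\<^esub> h2)))"
proof -
  note rules = AH_rules P F bilinear_map_comp[OF F] a h
  have "G_tilde_coact (a \<boxtimes> h) =
      coact_sum AHH a (\<lambda>a0 a1. H.comult_sum AHH h (\<lambda>h1 h2. (a0 \<boxtimes> h1) \<boxtimes>\<^sub>H (a1 \<otimes>\<^bsub>H\<^esub> h2)))"
    unfolding G_tilde_coact_def by (rule sweedler_tens) (assumption | rule rules)+
  then have "sweedler R AH H P (G_tilde_coact (a \<boxtimes> h)) F = sweedler R AH H P
      (coact_sum AHH a (\<lambda>a0 a1. H.comult_sum AHH h (\<lambda>h1 h2. (a0 \<boxtimes> h1) \<boxtimes>\<^sub>H (a1 \<otimes>\<^bsub>H\<^esub> h2)))) F"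
    by simp
  also have "\<dots> = coact_sum P a (\<lambda>a0 a1. sweedler R AH H P
      (H.comult_sum AHH h (\<lambda>h1 h2. (a0 \<boxtimes> h1) \<boxtimes>\<^sub>H (a1 \<otimes>\<^bsub>H\<^esub> h2))) F)"
    by (rule sweedler_sweedler) (assumption | rule rules)+
  also have "\<dots> = coact_sum P a (\<lambda>a0 a1. H.comult_sum P h (\<lambda>h1 h2. F (a0 \<boxtimes> h1) (a1 \<otimes>\<^bsub>H\<^esub> h2)))"
    by (rule sweedler_eqI, rule sweedler_sweedler_tens) (assumption | rule rules)+
  finally show ?thesis .
qed

lemma G_tilde_of_simps:
  "carrier (G_tilde_of R H A) = carrier AH" "zero (G_tilde_of R H A) = zero AH"
  "add (G_tilde_of R H A) = add AH" "smult (G_tilde_of R H A) = smult AH"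
  "twist (G_tilde_of R H A) = tensor_twist R A H" "coact (G_tilde_of R H A) = G_tilde_coact"
  "act (G_tilde_of R H A) = G_tilde_act"
  by (auto simp: G_tilde_of_def relative_structure_def tensor_object_simps Let_def
      G_tilde_coact_def[abs_def] G_tilde_act_def[abs_def])

lemmas G_tilde_same = G_tilde_of_simps
  linear_maps_same[OF G_tilde_of_simps(1,3,4)] tensor_same_left[OF G_tilde_of_simps(1,3,4)]
  tensor_lift_same_target[OF G_tilde_of_simps(1,3,4)]

end

section \<open>Identities forced by the axioms of \<open>G_tilde_of R H A\<close>\<close>

locale hom_comodule_algebra_tilde = hom_comodule_algebra R H A
  for R (structure) and H (structure) and A (structure) +
  assumes G_tilde_module: "relative_hom_hopf_module R H A (G_tilde_of R H A)"
begin

interpretation T: relative_hom_hopf_module R H A "G_tilde_of R H A"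
  by (rule G_tilde_module)

lemmas G_tilde_rules = G_iso_rules
  bilinear_map_comp[OF G_tilde_act_bilinear] bilinear_mapD(3)[OF G_tilde_act_bilinear]
  linear_maps_comp[OF G_tilde_coact_linear] linear_mapsD(1)[OF G_tilde_coact_linear]

text \<open>This is the weak unit axiom of the action on \<open>G_tilde_of R H A\<close>.\<close>

lemma tens_twist_twist:
  assumes "a \<in> carrier A" "h \<in> carrier H"
  shows "a \<boxtimes> twist H (twist H h) = a \<boxtimes> h"
proof -
  \<comment> \<open>The element is chosen so that the unit acts on it to give
    \<open>a \<boxtimes> h\<close>, while its twist is
    \<open>a \<boxtimes> twist H (twist H h)\<close>.\<close>
  have "G_tilde_act (twist_inv A a \<boxtimes> twist H h) \<one>\<^bsub>A\<^esub> = tensor_twist R A H (twist_inv A a \<boxtimes> twist H h)"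
    using T.M.action_unit[of "twist_inv A a \<boxtimes> twist H h"] by (simp add: G_tilde_same AH_simps assms)
  then show ?thesis
    by (simp add: G_tilde_act_tens AH_simps assms)
qed

text \<open>\<open>tens_twist_twist\<close> is an equation in the tensor product, so it can be
  applied to any bilinear map, which factors through that product.\<close>

lemma sweedler_twist_twist:
  assumes P: "module R P" and F: "bilinear_map R A H P F" and t: "t \<in> carrier AH"
  shows "sweedler R A H P t (\<lambda>a h. F a (twist H (twist H h))) = sweedler R A H P t F"
proof (rule AH_ext[OF P _ _ _ t])
  note rules = AH_rules bilinear_map_comp[OF F] P F
  fix a h assume ah: "a \<in> carrier A" "h \<in> carrier H"
  have "sweedler R A H P (a \<boxtimes> h) (\<lambda>a h. F a (twist H (twist H h))) = F a (twist H (twist H h))"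
    by (rule sweedler_tens) (assumption | rule rules ah)+
  also have "\<dots> = sweedler R A H P (a \<boxtimes> twist H (twist H h)) F"
    by (rule sweedler_tens[symmetric]) (assumption | rule rules ah)+
  also have "\<dots> = sweedler R A H P (a \<boxtimes> h) F"
    by (simp add: tens_twist_twist ah)
  finally show "sweedler R A H P (a \<boxtimes> h) (\<lambda>a h. F a (twist H (twist H h))) = sweedler R A H P (a \<boxtimes> h) F" .
qed (assumption | rule AH_rules bilinear_map_comp[OF F] P F)+

text \<open>Compatibility of action and coaction on \<open>G_tilde_of R H A\<close>, read off at \<open>1 \<otimes> h\<close>, is
  the only source of commutativity.\<close>

lemma coact_comult_commute_tens:
  assumes b: "b \<in> carrier A" and h: "h \<in> carrier H"
  shows "coact_sum AHH b (\<lambda>b0 b1. H.comult_sum AHH h (\<lambda>h1 h2.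
      (twist A (twist A b0) \<boxtimes> h1) \<boxtimes>\<^sub>H (b1 \<otimes>\<^bsub>H\<^esub> h2))) =
    coact_sum AHH b (\<lambda>b0 b1. H.comult_sum AHH h (\<lambda>h1 h2.
      (twist A (twist A b0) \<boxtimes> h1) \<boxtimes>\<^sub>H (twist H (twist H h2) \<otimes>\<^bsub>H\<^esub> b1)))"
proof -
  note rules = G_tilde_rules A.unit_closed b h
  \<comment> \<open>Two twists are inserted on \<open>b1\<close> to match those on
    \<open>b0\<close>; both pairs can then be pulled into the argument of the coaction.\<close>
  have "coact_sum AHH b (\<lambda>b0 b1. H.comult_sum AHH h (\<lambda>h1 h2.
      (twist A (twist A b0) \<boxtimes> h1) \<boxtimes>\<^sub>H (b1 \<otimes>\<^bsub>H\<^esub> h2))) =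
    coact_sum AHH b (\<lambda>b0 b1. H.comult_sum AHH h (\<lambda>h1 h2.
      (twist A (twist A b0) \<boxtimes> h1) \<boxtimes>\<^sub>H (twist H (twist H b1) \<otimes>\<^bsub>H\<^esub> h2)))"
    by (rule sweedler_twist_twist[symmetric]) (assumption | rule rules)+
  also have "\<dots> = coact_sum AHH (twist A b) (\<lambda>b0 b1. H.comult_sum AHH h (\<lambda>h1 h2.
      (twist A b0 \<boxtimes> h1) \<boxtimes>\<^sub>H (twist H b1 \<otimes>\<^bsub>H\<^esub> h2)))"
    by (rule coact_sum_twist[symmetric]) (assumption | rule rules)+
  also have "\<dots> = coact_sum AHH (twist A (twist A b)) (\<lambda>b0 b1. H.comult_sum AHH h (\<lambda>h1 h2.
      (b0 \<boxtimes> h1) \<boxtimes>\<^sub>H (b1 \<otimes>\<^bsub>H\<^esub> h2)))"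
    by (rule coact_sum_twist[symmetric]) (assumption | rule rules)+
  also have "\<dots> = sweedler R AH H AHH (G_tilde_coact (twist A (twist A b) \<boxtimes> h)) (tens R AH H)"
    by (rule G_tilde_coact_sum[symmetric]) (assumption | rule rules)+
  also have "\<dots> = G_tilde_coact (twist A (twist A b) \<boxtimes> h)"
    by (rule sweedler_tens_id) (assumption | rule rules)+
  also have "\<dots> = G_tilde_coact (G_tilde_act (\<one>\<^bsub>A\<^esub> \<boxtimes> twist H h) b)"
    by (simp add: G_tilde_act_tens AH_simps b h)
  also have "\<dots> = sweedler R AH H AHH (G_tilde_coact (\<one>\<^bsub>A\<^esub> \<boxtimes> twist H h)) (\<lambda>m0 m1.
      coact_sum AHH b (\<lambda>b0 b1. G_tilde_act m0 b0 \<boxtimes>\<^sub>H (m1 \<otimes>\<^bsub>H\<^esub> b1)))"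
    using T.coact_act[of "\<one>\<^bsub>A\<^esub> \<boxtimes> twist H h" b] by (simp add: G_tilde_same Let_def AH_simps b h)
  also have "\<dots> = coact_sum AHH \<one>\<^bsub>A\<^esub> (\<lambda>a0 a1. H.comult_sum AHH (twist H h) (\<lambda>h1 h2.
      coact_sum AHH b (\<lambda>b0 b1. G_tilde_act (a0 \<boxtimes> h1) b0 \<boxtimes>\<^sub>H ((a1 \<otimes>\<^bsub>H\<^esub> h2) \<otimes>\<^bsub>H\<^esub> b1))))"
    by (rule G_tilde_coact_sum) (assumption | rule rules)+
  \<comment> \<open>The coaction of the unit is trivial, which leaves \<open>b1\<close> as the right
    factor behind \<open>h2\<close>: the order of multiplication is now reversed.\<close>
  also have "\<dots> = H.comult_sum AHH (twist H h) (\<lambda>h1 h2.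
      coact_sum AHH b (\<lambda>b0 b1. G_tilde_act (\<one>\<^bsub>A\<^esub> \<boxtimes> h1) b0 \<boxtimes>\<^sub>H ((\<one>\<^bsub>H\<^esub> \<otimes>\<^bsub>H\<^esub> h2) \<otimes>\<^bsub>H\<^esub> b1)))"
    by (rule coact_sum_unit) (assumption | rule rules)+
  also have "\<dots> = H.comult_sum AHH h (\<lambda>h1 h2. coact_sum AHH b (\<lambda>b0 b1.
      G_tilde_act (\<one>\<^bsub>A\<^esub> \<boxtimes> twist H h1) b0 \<boxtimes>\<^sub>H ((\<one>\<^bsub>H\<^esub> \<otimes>\<^bsub>H\<^esub> twist H h2) \<otimes>\<^bsub>H\<^esub> b1)))"
    by (rule H.comult_sum_twist) (assumption | rule rules)+
  also have "\<dots> = coact_sum AHH b (\<lambda>b0 b1. H.comult_sum AHH h (\<lambda>h1 h2.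
      G_tilde_act (\<one>\<^bsub>A\<^esub> \<boxtimes> twist H h1) b0 \<boxtimes>\<^sub>H ((\<one>\<^bsub>H\<^esub> \<otimes>\<^bsub>H\<^esub> twist H h2) \<otimes>\<^bsub>H\<^esub> b1)))"
    by (rule sweedler_swap) (assumption | rule rules)+
  also have "\<dots> = coact_sum AHH b (\<lambda>b0 b1. H.comult_sum AHH h (\<lambda>h1 h2.
      (twist A (twist A b0) \<boxtimes> h1) \<boxtimes>\<^sub>H (twist H (twist H h2) \<otimes>\<^bsub>H\<^esub> b1)))"
    by (intro sweedler_eqI) (simp add: G_tilde_act_tens AH_simps)
  finally show ?thesis .
qed

text \<open>The linear map \<open>L\<close> induced by \<open>F\<close> on the left-bracketed triple
  tensor product transports \<open>coact_comult_commute_tens\<close> to an arbitrary target.\<close>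

lemma coact_comult_commute:
  assumes P: "module R P" and F: "trilinear_map R A H H P F" and b: "b \<in> carrier A" and h: "h \<in> carrier H"
  shows "coact_sum P b (\<lambda>b0 b1. H.comult_sum P h (\<lambda>h1 h2. F b0 h1 (b1 \<otimes>\<^bsub>H\<^esub> h2))) =
    coact_sum P b (\<lambda>b0 b1. H.comult_sum P h (\<lambda>h1 h2. F b0 h1 (twist H (twist H h2) \<otimes>\<^bsub>H\<^esub> b1)))"
proof -
  note rules = G_rules trilinear_mapD[OF F] P b h
  \<comment> \<open>The first slot is untwisted twice to cancel the double twist on
    \<open>b0\<close> in \<open>coact_comult_commute_tens\<close>.\<close>
  define F' where "F' x y z = F (twist_inv A (twist_inv A x)) y z" for x y z
  have F': "trilinear_map R A H H P F'"
    unfolding F'_def by (assumption | rule rules)+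
  note rules = rules trilinear_mapD[OF F']
  define L where "L t = sweedler R AH H P t (\<lambda>s z. sweedler R A H P s (\<lambda>x y. F' x y z))" for t
  have B: "bilinear_map R AH H P (\<lambda>s z. sweedler R A H P s (\<lambda>x y. F' x y z))"
    by (assumption | rule rules)+
  have L: "L \<in> linear_maps R AHH P"
    unfolding L_def[abs_def] by (assumption | rule rules B)+
  have L_tens: "L ((x \<boxtimes> y) \<boxtimes>\<^sub>H z) = F' x y z" if "x \<in> carrier A" "y \<in> carrier H" "z \<in> carrier H" for x y z
  proof -
    have "L ((x \<boxtimes> y) \<boxtimes>\<^sub>H z) = sweedler R A H P (x \<boxtimes> y) (\<lambda>x y. F' x y z)"
      unfolding L_def by (rule sweedler_tens[OF _ _ _ _ _ B]) (assumption | rule rules that)+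
    also have "\<dots> = F' x y z"
      by (rule sweedler_tens) (assumption | rule rules that)+
    finally show ?thesis .
  qed
  \<comment> \<open>\<open>G\<close> stands for either order of multiplication, so one computation
    serves both sides.\<close>
  have step: "L (coact_sum AHH b (\<lambda>b0 b1. H.comult_sum AHH h (\<lambda>h1 h2.
        (twist A (twist A b0) \<boxtimes> h1) \<boxtimes>\<^sub>H G b1 h2))) =
      coact_sum P b (\<lambda>b0 b1. H.comult_sum P h (\<lambda>h1 h2. F b0 h1 (G b1 h2)))"
    if G: "bilinear_map R H H H G" for G
  proof -
    note rules = rules bilinear_map_comp[OF G] bilinear_mapD(3)[OF G]
    have "L (coact_sum AHH b (\<lambda>b0 b1. H.comult_sum AHH h (\<lambda>h1 h2.
          (twist A (twist A b0) \<boxtimes> h1) \<boxtimes>\<^sub>H G b1 h2))) =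
        coact_sum P b (\<lambda>b0 b1. L (H.comult_sum AHH h (\<lambda>h1 h2.
          (twist A (twist A b0) \<boxtimes> h1) \<boxtimes>\<^sub>H G b1 h2)))"
      by (rule linear_sweedler[OF _ _ _ _ L]) (assumption | rule rules)+
    also have "\<dots> = coact_sum P b (\<lambda>b0 b1. H.comult_sum P h (\<lambda>h1 h2.
        L ((twist A (twist A b0) \<boxtimes> h1) \<boxtimes>\<^sub>H G b1 h2)))"
      by (rule sweedler_eqI, rule linear_sweedler[OF _ _ _ _ L]) (assumption | rule rules)+
    also have "\<dots> = coact_sum P b (\<lambda>b0 b1. H.comult_sum P h (\<lambda>h1 h2. F b0 h1 (G b1 h2)))"
      by (intro sweedler_eqI) (simp add: L_tens F'_def AH_simps bilinear_mapD(3)[OF G])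
    finally show ?thesis .
  qed
  have "bilinear_map R H H H (\<lambda>x y. x \<otimes>\<^bsub>H\<^esub> y)" "bilinear_map R H H H (\<lambda>x y. twist H (twist H y) \<otimes>\<^bsub>H\<^esub> x)"
    by (assumption | rule rules)+
  note step[OF this(1)] step[OF this(2)]
  then show ?thesis
    using coact_comult_commute_tens[OF b h] by simp
qed

text \<open>\<open>coact_comult_commute\<close> with its middle slot fed to the counit, which
  contracts the comultiplication of \<open>h\<close> on both sides.\<close>

lemma coact_commute:
  assumes P: "module R P" and F: "bilinear_map R A H P F" and b: "b \<in> carrier A" and h: "h \<in> carrier H"
  shows "coact_sum P b (\<lambda>b0 b1. F b0 (b1 \<otimes>\<^bsub>H\<^esub> twist_inv H h)) =
    coact_sum P b (\<lambda>b0 b1. F b0 (twist H h \<otimes>\<^bsub>H\<^esub> b1))"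
proof -
  note rules = G_rules bilinear_map_comp[OF F] bilinear_mapD(3)[OF F] P b h
  have "coact_sum P b (\<lambda>b0 b1. F b0 (b1 \<otimes>\<^bsub>H\<^esub> twist_inv H h)) =
      coact_sum P b (\<lambda>b0 b1. H.comult_sum P h (\<lambda>h1 h2. counit H h1 \<odot>\<^bsub>P\<^esub> F b0 (b1 \<otimes>\<^bsub>H\<^esub> h2)))"
    by (rule sweedler_eqI, rule H.comult_sum_counit_left[symmetric]) (assumption | rule rules)+
  also have "\<dots> = coact_sum P b (\<lambda>b0 b1. H.comult_sum P h (\<lambda>h1 h2.
      counit H h1 \<odot>\<^bsub>P\<^esub> F b0 (twist H (twist H h2) \<otimes>\<^bsub>H\<^esub> b1)))"
    by (rule coact_comult_commute) (assumption | rule rules)+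
  also have "\<dots> = coact_sum P b (\<lambda>b0 b1. F b0 (twist H (twist H (twist_inv H h)) \<otimes>\<^bsub>H\<^esub> b1))"
    by (rule sweedler_eqI, rule H.comult_sum_counit_left) (assumption | rule rules)+
  finally show ?thesis
    using h by (simp add: AH_simps)
qed

text \<open>With \<open>h\<close> moved to the left of \<open>a1\<close>, further factors can be
  multiplied on the right as in \<open>G_act\<close>.\<close>

lemma G_iso_tens':
  assumes a: "a \<in> carrier A" and h: "h \<in> carrier H"
  shows "G_iso (a \<boxtimes> h) = coact_sum AH a (\<lambda>a0 a1. twist_inv A a0 \<boxtimes> (twist H h \<otimes>\<^bsub>H\<^esub> a1))"
  unfolding G_iso_tens[OF a h] by (rule coact_commute) (assumption | rule AH_rules a h)+

text \<open>Multiplicativity of the coaction and Hom-associativity give the right-hand side up to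
  double twists in the factor \<open>H\<close>, which the tensor product with \<open>A\<close> does
  not see.\<close>

lemma G_iso_act:
  assumes t: "t \<in> carrier AH" and b: "b \<in> carrier A"
  shows "G_iso (G_tilde_act t b) = G_act (G_iso t) b"
proof (rule AH_ext[OF _ _ _ _ t])
  fix a h assume ah: "a \<in> carrier A" "h \<in> carrier H"
  note rules = G_tilde_rules ah b
  let ?h = "twist_inv H h"
  have "G_iso (G_tilde_act (a \<boxtimes> h) b) =
      coact_sum AH (a \<otimes>\<^bsub>A\<^esub> twist A b) (\<lambda>x y. twist_inv A x \<boxtimes> (h \<otimes>\<^bsub>H\<^esub> y))"
    by (simp add: G_tilde_act_tens G_iso_tens' AH_simps ah b)
  also have "\<dots> = coact_sum AH a (\<lambda>a0 a1. coact_sum AH (twist A b) (\<lambda>b0 b1.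
      twist_inv A (a0 \<otimes>\<^bsub>A\<^esub> b0) \<boxtimes> (h \<otimes>\<^bsub>H\<^esub> (a1 \<otimes>\<^bsub>H\<^esub> b1))))"
    by (rule coact_sum_mult) (assumption | rule rules)+
  also have "\<dots> = coact_sum AH a (\<lambda>a0 a1. coact_sum AH b (\<lambda>b0 b1.
      twist_inv A (a0 \<otimes>\<^bsub>A\<^esub> twist A b0) \<boxtimes> (h \<otimes>\<^bsub>H\<^esub> (a1 \<otimes>\<^bsub>H\<^esub> twist H b1))))"
    by (rule sweedler_eqI, rule coact_sum_twist) (assumption | rule rules)+
  also have "\<dots> = coact_sum AH a (\<lambda>a0 a1. coact_sum AH b (\<lambda>b0 b1.
      (twist_inv A a0 \<otimes>\<^bsub>A\<^esub> b0) \<boxtimes> ((?h \<otimes>\<^bsub>H\<^esub> a1) \<otimes>\<^bsub>H\<^esub> twist H (twist H b1))))"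
    by (intro sweedler_eqI) (simp add: AH_simps H.hom_assoc_left ah)
  also have "\<dots> = coact_sum AH a (\<lambda>a0 a1. coact_sum AH b (\<lambda>b0 b1.
      (twist_inv A a0 \<otimes>\<^bsub>A\<^esub> b0) \<boxtimes> ((?h \<otimes>\<^bsub>H\<^esub> a1) \<otimes>\<^bsub>H\<^esub> b1)))"
    by (rule sweedler_eqI, rule sweedler_twist_twist) (assumption | rule rules)+
  also have "\<dots> = coact_sum AH a (\<lambda>a0 a1. G_act (twist_inv A a0 \<boxtimes> (?h \<otimes>\<^bsub>H\<^esub> a1)) b)"
    by (rule sweedler_eqI) (simp add: G_act_tens AH_simps ah b)
  also have "\<dots> = G_act (coact_sum AH a (\<lambda>a0 a1. twist_inv A a0 \<boxtimes> (?h \<otimes>\<^bsub>H\<^esub> a1))) b"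
    by (rule linear_sweedler[where L = "\<lambda>t. G_act t b", symmetric]) (assumption | rule rules)+
  \<comment> \<open>\<open>?h\<close> is the twist of \<open>twist_inv H ?h\<close>, so
    \<open>G_iso_tens'\<close> folds the sum back; the next step removes the double untwisting of
    \<open>h\<close>.\<close>
  also have "\<dots> = G_act (G_iso (a \<boxtimes> twist_inv H ?h)) b"
    by (simp add: G_iso_tens' AH_simps ah)
  also have "a \<boxtimes> twist_inv H ?h = a \<boxtimes> h"
    using tens_twist_twist[of a "twist_inv H ?h"] by (simp add: AH_simps ah)
  finally show "G_iso (G_tilde_act (a \<boxtimes> h) b) = G_act (G_iso (a \<boxtimes> h)) b" .
qed (assumption | rule G_tilde_rules b)+

text \<open>In the form \<open>G_iso_tens'\<close> the coaction of G(A) comultiplies a product.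
  Hom-coassociativity reassembles a \<open>G_iso\<close> in the left factor, and the right factor
  then differs from that of the other coaction by the order of multiplication alone, up to a double
  twist.\<close>

lemma G_iso_coact:
  assumes t: "t \<in> carrier AH"
  shows "G_coact (G_iso t) = sweedler R AH H AHH (G_tilde_coact t) (\<lambda>x y. G_iso x \<boxtimes>\<^sub>H y)"
proof (rule AH_ext[OF _ _ _ _ t])
  fix a h assume ah: "a \<in> carrier A" "h \<in> carrier H"
  note rules = G_tilde_rules ah
  have "G_coact (G_iso (a \<boxtimes> h)) =
      coact_sum AHH a (\<lambda>a0 a1. G_coact (twist_inv A a0 \<boxtimes> (twist H h \<otimes>\<^bsub>H\<^esub> a1)))"
    unfolding G_iso_tens'[OF ah]
    by (rule linear_sweedler[OF _ _ _ _ G_coact_linear]) (assumption | rule rules)+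
  also have "\<dots> = coact_sum AHH a (\<lambda>a0 a1. H.comult_sum AHH (twist H h \<otimes>\<^bsub>H\<^esub> a1) (\<lambda>x y.
      (twist_inv A (twist_inv A a0) \<boxtimes> x) \<boxtimes>\<^sub>H twist H y))"
    by (rule sweedler_eqI, rule G_coact_tens) (assumption | rule rules)+
  also have "\<dots> = coact_sum AHH a (\<lambda>a0 a1. H.comult_sum AHH (twist H h) (\<lambda>h1 h2.
      H.comult_sum AHH a1 (\<lambda>x y.
        (twist_inv A (twist_inv A a0) \<boxtimes> (h1 \<otimes>\<^bsub>H\<^esub> x)) \<boxtimes>\<^sub>H twist H (h2 \<otimes>\<^bsub>H\<^esub> y))))"
    by (rule sweedler_eqI, rule H.comult_sum_mult) (assumption | rule rules)+
  also have "\<dots> = coact_sum AHH a (\<lambda>a0 a1. H.comult_sum AHH h (\<lambda>h1 h2.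
      H.comult_sum AHH a1 (\<lambda>x y.
        (twist_inv A (twist_inv A a0) \<boxtimes> (twist H h1 \<otimes>\<^bsub>H\<^esub> x)) \<boxtimes>\<^sub>H twist H (twist H h2 \<otimes>\<^bsub>H\<^esub> y))))"
    by (rule sweedler_eqI, rule H.comult_sum_twist) (assumption | rule rules)+
  \<comment> \<open>The sums are swapped so that \<open>coact_sum_coassoc\<close> sees the coaction
    of \<open>a\<close> together with the comultiplication of \<open>a1\<close>; the swap is undone
    once \<open>G_iso\<close> has been recognised.\<close>
  also have "\<dots> = H.comult_sum AHH h (\<lambda>h1 h2. coact_sum AHH a (\<lambda>a0 a1.
      H.comult_sum AHH a1 (\<lambda>x y.
        (twist_inv A (twist_inv A a0) \<boxtimes> (twist H h1 \<otimes>\<^bsub>H\<^esub> x)) \<boxtimes>\<^sub>H twist H (twist H h2 \<otimes>\<^bsub>H\<^esub> y))))"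
    by (rule sweedler_swap) (assumption | rule rules)+
  also have "\<dots> = H.comult_sum AHH h (\<lambda>h1 h2. coact_sum AHH a (\<lambda>a0 a1. coact_sum AHH a0 (\<lambda>x y.
        (twist_inv A x \<boxtimes> (twist H h1 \<otimes>\<^bsub>H\<^esub> y)) \<boxtimes>\<^sub>H twist H (twist H h2 \<otimes>\<^bsub>H\<^esub> twist_inv H a1))))"
    by (rule sweedler_eqI, rule coact_sum_coassoc[symmetric]) (assumption | rule rules)+
  also have "\<dots> = H.comult_sum AHH h (\<lambda>h1 h2. coact_sum AHH a (\<lambda>a0 a1. 
      coact_sum AH a0 (\<lambda>x y. twist_inv A x \<boxtimes> (twist H h1 \<otimes>\<^bsub>H\<^esub> y)) \<boxtimes>\<^sub>H
        twist H (twist H h2 \<otimes>\<^bsub>H\<^esub> twist_inv H a1)))"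
    by (rule sweedler_eqI, rule sweedler_eqI, rule linear_sweedler[symmetric])
      (assumption | rule rules)+
  also have "\<dots> = H.comult_sum AHH h (\<lambda>h1 h2. coact_sum AHH a (\<lambda>a0 a1. 
      G_iso (a0 \<boxtimes> h1) \<boxtimes>\<^sub>H (twist H (twist H h2) \<otimes>\<^bsub>H\<^esub> a1)))"
    by (intro sweedler_eqI) (simp add: G_iso_tens' AH_simps)
  also have "\<dots> = coact_sum AHH a (\<lambda>a0 a1. H.comult_sum AHH h (\<lambda>h1 h2.
      G_iso (a0 \<boxtimes> h1) \<boxtimes>\<^sub>H (twist H (twist H h2) \<otimes>\<^bsub>H\<^esub> a1)))"
    by (rule sweedler_swap) (assumption | rule rules)+
  \<comment> \<open>The trilinear map here sends its first two slots through \<open>G_iso\<close>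
    and keeps the third as the right tensor factor.\<close>
  also have "\<dots> = coact_sum AHH a (\<lambda>a0 a1. H.comult_sum AHH h (\<lambda>h1 h2.
      G_iso (a0 \<boxtimes> h1) \<boxtimes>\<^sub>H (a1 \<otimes>\<^bsub>H\<^esub> h2)))"
    by (rule coact_comult_commute[symmetric]) (assumption | rule rules)+
  also have "\<dots> = sweedler R AH H AHH (G_tilde_coact (a \<boxtimes> h)) (\<lambda>x y. G_iso x \<boxtimes>\<^sub>H y)"
    by (rule G_tilde_coact_sum[symmetric]) (assumption | rule rules)+
  finally show "G_coact (G_iso (a \<boxtimes> h)) =
      sweedler R AH H AHH (G_tilde_coact (a \<boxtimes> h)) (\<lambda>x y. G_iso x \<boxtimes>\<^sub>H y)" .
qed (assumption | rule G_tilde_rules)+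

lemma G_iso_morphism: "G_iso \<in> relative_hom_hopf_morphisms R H A (G_tilde_of R H A) (G_of R H A)"
  by (simp add: relative_hom_hopf_morphisms_def G_tilde_same G_same
      G_iso_linear G_iso_twist G_iso_act G_iso_coact)

lemma G_isomorphic_G_tilde: "relative_hom_hopf_isomorphic R H A (G_of R H A) (G_tilde_of R H A)"
proof -
  have "G_iso_inv \<in> relative_hom_hopf_morphisms R H A (G_of R H A) (G_tilde_of R H A)"
    by (rule relative_hom_hopf_morphisms_inverse[OF G_tilde_module G_relative_hom_hopf_module G_iso_morphism])
      (simp_all add: G_same G_tilde_same G_iso_inv_G_iso G_iso_G_iso_inv linear_mapsD(1)[OF G_iso_inv_linear])
  then show ?thesis
    unfolding relative_hom_hopf_isomorphic_def
    using G_tilde_module G_relative_hom_hopf_module G_iso_morphism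
    by (intro conjI bexI[of _ G_iso_inv] bexI[of _ G_iso])
      (simp_all add: G_of_simps G_tilde_of_simps G_iso_inv_G_iso G_iso_G_iso_inv)
qed

end

text \<open>An isomorphism in the category presupposes that both structures are objects of it. For
  G(A) this is proved above; for \<open>G_tilde_of R H A\<close> it is the last hypothesis, which
  also supplies the commutation identities.\<close>

theorem proposition3p1:
  fixes R :: "('r, 'x) ring_scheme"
    and H :: "('r, 'h, 'y) hom_coalgebra_scheme"
    and A :: "('r, 'a, 'h, 'z) hom_comodule_scheme"
  assumes "cring R"
    and "monoidal_hom_hopf_algebra R H"
    and "hom_comodule_algebra R H A"
    and "relative_hom_hopf_module R H A (G_tilde_of R H A)"
  shows "relative_hom_hopf_isomorphic R H A (G_of R H A) (G_tilde_of R H A)"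
  by (rule hom_comodule_algebra_tilde.G_isomorphic_G_tilde)
    (intro hom_comodule_algebra_tilde.intro hom_comodule_algebra_tilde_axioms.intro assms(3,4))

end
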